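(* Let $I\subset R=\mathbb{k}[x,y,z]$ be an ideal as in the setting described in the context, with presentation matrix $\varphi$ in Case III. Let $S=\mathbb{k}[x,y,z,w_0,\dots,w_{n-1}]$, $[l_1,\dots,l_{n-1}]=[w_0,\dots,w_{n-1}]\cdot\varphi$, $\mathcal{J}=(l_1,\dots,l_{n-2}):_S(x,y)$, $B=S/\mathcal{J}$, and let $\mathcal{A}\subset S$ be the defining ideal of the Rees algebra of $I$. Put $$\overline{\mathcal{K}}''=(\overline{z^2w_0}):_B(\overline{x,y,z^2w_0}),\qquad \mathcal{D}=\frac{\overline{l_{n-1}}\,\overline{\mathcal{K}}''}{\overline{z^2w_0}}.$$ Then the $B$-ideals $\mathcal{D}$ and $\overline{\mathcal{A}}$ are equal.
   Context: Setting. $\mathbb{k}$ is an algebraically closed field, $R=\mathbb{k}[x,y,z]$, $\mathfrak{m}=(x,y,z)$. $I\subset R$ is an ideal such that: $I$ is a height two perfect ideal; $I=(f_1,\dots,f_n)$ is generated by homogeneous elements of the same degree with $\mu(I)=n>4$; its presentation matrix $\varphi$ is $n\times(n-1)$ and almost linear, i.e. all columns except the last have linear entries and the entries of the last column are homogeneous of degree $2$; $I_1(\varphi)=\mathfrak{m}$; after a change of variables, $\varphi$ has rank at most $1$ modulo the prime ideal generated by two of the variables; $I$ satisfies $(G_2)$ but not $(G_3)$. Here $I$ satisfies $(G_s)$ if $\mu(I_{\mathfrak p})\le \operatorname{ht}\mathfrak p$ for all $\mathfrak p\in V(I)$ with $\operatorname{ht}\mathfrak p\le s-1$; $\mu$ is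 the minimal number of generators and $I_i(\cdot)$ is the ideal of $i\times i$ minors. Case III. (After a change of variables and elementary row and column operations) the first row of $\varphi$ is $( *,\dots,*,z^2)$ with $z^2$ in the last column; the block $\varphi'$ formed by the last $n-1$ rows and first $n-2$ columns and the entries $*$ consist of linear forms in $\mathbb{k}[x,y]$; the remaining entries of the last column are homogeneous of degree $2$ in $\mathbb{k}[x,y,z]$ with no $z^2$ term. Notation. $\mathcal{A}$ is the kernel of the $R$-algebra map $S\to R[It]$ sending $w_0,\dots,w_{n-1}$ to $f_1t,\dots,f_nt$, where the $f_i$ are the generators presented by $\varphi$. A bar denotes image in $B$, which is a Cohen-Macaulay domain of dimension $5$. The quotient defining $\mathcal D$ is taken in $\operatorname{Frac}(B)$, i.e. $\mathcal D=\{\overline{l_{n-1}}k/(\overline{z^2w_0}):k\in\overline{\mathcal K}''\}$; it is an ideal of $B$.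
   Formalization: The condition $I_1(\varphi)=\mathfrak m$ is replaced by $\sqrt{I_1(\varphi)}=\mathfrak m$, because in Case III $I_1(\varphi)\subseteq(x,y,z^2)$, so the literal condition can never hold. *)

theory Defs
  imports
    "HOL-Algebra.Algebra"
    "HOL-Library.Poly_Mapping"
    "HOL-Library.Extended_Nat"
    "Jordan_Normal_Form.Determinant"
    "Jordan_Normal_Form.DL_Submatrix"
begin

section \<open>Commutative algebra over HOL-Algebra rings\<close>

subsection \<open>Ideals\<close>

definition colon :: "('a, 'b) ring_scheme \<Rightarrow> 'a set \<Rightarrow> 'a set \<Rightarrow> 'a set" where
  "colon R I J = {r \<in> carrier R. \<forall>b\<in>J. r \<otimes>\<^bsub>R\<^esub> b \<in> I}"

definition radical :: "('a, 'b) ring_scheme \<Rightarrow> 'a set \<Rightarrow> 'a set" where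
  "radical R I = {r \<in> carrier R. \<exists>k::nat. r [^]\<^bsub>R\<^esub> k \<in> I}"

text \<open>The minimal number of generators \<open>\<mu>\<close>; it is \<open>\<infinity>\<close> if the ideal is not finitely generated.\<close>
definition min_gens :: "('a, 'b) ring_scheme \<Rightarrow> 'a set \<Rightarrow> enat" where
  "min_gens R I = Inf {enat (card A) | A. finite A \<and> A \<subseteq> carrier R \<and> Idl\<^bsub>R\<^esub> A = I}"

definition prime_height :: "('a, 'b) ring_scheme \<Rightarrow> 'a set \<Rightarrow> enat" where
  "prime_height R p = Sup {enat k | k. \<exists>c :: nat \<Rightarrow> 'a set.
     (\<forall>i\<le>k. primeideal (c i) R) \<and> (\<forall>i<k. c i \<subset> c (Suc i)) \<and> c k = p}"

definition ideal_height :: "('a, 'b) ring_scheme \<Rightarrow> 'a set \<Rightarrow> enat" where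
  "ideal_height R I = Inf {prime_height R p | p. primeideal p R \<and> I \<subseteq> p}"

definition regular_sequence :: "('a, 'b) ring_scheme \<Rightarrow> 'a list \<Rightarrow> bool" where
  "regular_sequence R xs \<longleftrightarrow> set xs \<subseteq> carrier R \<and> Idl\<^bsub>R\<^esub> (set xs) \<noteq> carrier R \<and>
     (\<forall>i<length xs. \<forall>r\<in>carrier R.
        xs ! i \<otimes>\<^bsub>R\<^esub> r \<in> Idl\<^bsub>R\<^esub> (set (take i xs)) \<longrightarrow> r \<in> Idl\<^bsub>R\<^esub> (set (take i xs)))"

definition grade :: "('a, 'b) ring_scheme \<Rightarrow> 'a set \<Rightarrow> enat" where
  "grade R I = Sup {enat (length xs) | xs. set xs \<subseteq> I \<and> regular_sequence R xs}"

subsection \<open>Projective dimension and perfect ideals\<close>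

definition lin_maps ::
    "('a, 'm) ring_scheme \<Rightarrow> ('a, 'b) module \<Rightarrow> ('a, 'c) module \<Rightarrow> ('b \<Rightarrow> 'c) set" where
  "lin_maps R M N = {h \<in> carrier M \<rightarrow> carrier N.
     (\<forall>u\<in>carrier M. \<forall>v\<in>carrier M. h (u \<oplus>\<^bsub>M\<^esub> v) = h u \<oplus>\<^bsub>N\<^esub> h v) \<and>
     (\<forall>a\<in>carrier R. \<forall>u\<in>carrier M. h (a \<odot>\<^bsub>M\<^esub> u) = a \<odot>\<^bsub>N\<^esub> h u)}"

text \<open>
  Module records extend ring records; the fields \<open>mult\<close> and \<open>one\<close> play no role for modules.
\<close>
definition free_mod :: "('a, 'm) ring_scheme \<Rightarrow> nat \<Rightarrow> ('a, nat \<Rightarrow> 'a) module" where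
  "free_mod R m = \<lparr>carrier = {..<m} \<rightarrow>\<^sub>E carrier R, monoid.mult = undefined, monoid.one = undefined,
     ring.zero = (\<lambda>i\<in>{..<m}. \<zero>\<^bsub>R\<^esub>), ring.add = (\<lambda>u v. \<lambda>i\<in>{..<m}. u i \<oplus>\<^bsub>R\<^esub> v i),
     module.smult = (\<lambda>a v. \<lambda>i\<in>{..<m}. a \<otimes>\<^bsub>R\<^esub> v i)\<rparr>"

definition quot_module :: "('a, 'm) ring_scheme \<Rightarrow> 'a set \<Rightarrow> ('a, 'a set) module" where
  "quot_module R I = \<lparr>carrier = carrier (R Quot I), monoid.mult = monoid.mult (R Quot I),
     monoid.one = monoid.one (R Quot I),
     ring.zero = ring.zero (R Quot I), ring.add = ring.add (R Quot I),
     module.smult = (\<lambda>a C. \<Union>r\<in>C. I +>\<^bsub>R\<^esub> (a \<otimes>\<^bsub>R\<^esub> r))\<rparr>"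

text \<open>Finitely generated projective modules: direct summands (retracts) of some \<open>R\<^sup>m\<close>.\<close>
definition fg_projective :: "('a, 'm) ring_scheme \<Rightarrow> ('a, 'b) module \<Rightarrow> bool" where
  "fg_projective R P \<longleftrightarrow> module R P \<and>
     (\<exists>m. \<exists>s\<in>lin_maps R P (free_mod R m). \<exists>q\<in>lin_maps R (free_mod R m) P.
        \<forall>v\<in>carrier P. q (s v) = v)"

text \<open>
  \<open>M\<close> has a resolution \<open>0 \<rightarrow> P\<^sub>d \<rightarrow> \<dots> \<rightarrow> P\<^sub>0 \<rightarrow> M \<rightarrow> 0\<close> by finitely generated projective modules.
  For a finitely generated module over a Noetherian ring these resolutions compute the projective
  dimension. A finitely generated projective module is isomorphic to a submodule of some \<open>R\<^sup>m\<close>, so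
  taking the carriers of the \<open>P\<^sub>i\<close> in the type of \<open>free_mod\<close> is no restriction.
\<close>
definition has_proj_resolution :: "('a, 'm) ring_scheme \<Rightarrow> ('a, 'b) module \<Rightarrow> nat \<Rightarrow> bool" where
  "has_proj_resolution R M d \<longleftrightarrow>
     (\<exists>(P :: nat \<Rightarrow> ('a, nat \<Rightarrow> 'a) module) \<delta> \<epsilon>.
        (\<forall>i\<le>d. fg_projective R (P i)) \<and>
        \<epsilon> \<in> lin_maps R (P 0) M \<and> \<epsilon> ` carrier (P 0) = carrier M \<and>
        (\<forall>i<d. \<delta> i \<in> lin_maps R (P (Suc i)) (P i)) \<and>
        (\<forall>i\<le>d. (if i < d then \<delta> i ` carrier (P (Suc i)) else {\<zero>\<^bsub>P i\<^esub>}) =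
                {v \<in> carrier (P i).
                   case i of 0 \<Rightarrow> \<epsilon> v = \<zero>\<^bsub>M\<^esub> | Suc j \<Rightarrow> \<delta> j v = \<zero>\<^bsub>P j\<^esub>}))"

definition proj_dim :: "('a, 'm) ring_scheme \<Rightarrow> ('a, 'b) module \<Rightarrow> enat" where
  "proj_dim R M = Inf {enat d | d. has_proj_resolution R M d}"

definition perfect_ideal :: "('a, 'm) ring_scheme \<Rightarrow> 'a set \<Rightarrow> bool" where
  "perfect_ideal R I \<longleftrightarrow> ideal I R \<and> I \<noteq> carrier R \<and> proj_dim R (quot_module R I) = grade R I"

subsection \<open>Localization and the condition \<open>G\<^sub>s\<close>\<close>

text \<open>The fraction \<open>a / s\<close>, as the class of \<open>(a, s)\<close> among the pairs with denominator in \<open>U\<close>.\<close>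
definition fraction :: "('a, 'b) ring_scheme \<Rightarrow> 'a set \<Rightarrow> 'a \<Rightarrow> 'a \<Rightarrow> ('a \<times> 'a) set" where
  "fraction R U a s = {(b, t). b \<in> carrier R \<and> t \<in> U \<and>
     (\<exists>u\<in>U. u \<otimes>\<^bsub>R\<^esub> (a \<otimes>\<^bsub>R\<^esub> t) = u \<otimes>\<^bsub>R\<^esub> (b \<otimes>\<^bsub>R\<^esub> s))}"

definition localization :: "('a, 'b) ring_scheme \<Rightarrow> 'a set \<Rightarrow> ('a \<times> 'a) set ring" where
  "localization R U = \<lparr>carrier = {fraction R U a s | a s. a \<in> carrier R \<and> s \<in> U},
     monoid.mult = (\<lambda>C D. \<Union>(a, s)\<in>C. \<Union>(b, t)\<in>D. fraction R U (a \<otimes>\<^bsub>R\<^esub> b) (s \<otimes>\<^bsub>R\<^esub> t)),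
     monoid.one = fraction R U \<one>\<^bsub>R\<^esub> \<one>\<^bsub>R\<^esub>, ring.zero = fraction R U \<zero>\<^bsub>R\<^esub> \<one>\<^bsub>R\<^esub>,
     ring.add = (\<lambda>C D. \<Union>(a, s)\<in>C. \<Union>(b, t)\<in>D.
              fraction R U ((a \<otimes>\<^bsub>R\<^esub> t) \<oplus>\<^bsub>R\<^esub> (b \<otimes>\<^bsub>R\<^esub> s)) (s \<otimes>\<^bsub>R\<^esub> t))\<rparr>"

definition local_ideal :: "('a, 'b) ring_scheme \<Rightarrow> 'a set \<Rightarrow> 'a set \<Rightarrow> ('a \<times> 'a) set set" where
  "local_ideal R U I = {fraction R U a s | a s. a \<in> I \<and> s \<in> U}"

definition G_cond :: "nat \<Rightarrow> ('a, 'b) ring_scheme \<Rightarrow> 'a set \<Rightarrow> bool" where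
  "G_cond s R I \<longleftrightarrow> (\<forall>p. primeideal p R \<and> I \<subseteq> p \<and> prime_height R p \<le> enat (s - 1) \<longrightarrow>
     min_gens (localization R (carrier R - p)) (local_ideal R (carrier R - p) I)
       \<le> prime_height R p)"

text \<open>Division in \<open>Frac(B)\<close>, for a domain \<open>B\<close>, and the inclusion of \<open>B\<close> in \<open>Frac(B)\<close>.\<close>

abbreviation fdiv :: "('a, 'b) ring_scheme \<Rightarrow> 'a \<Rightarrow> 'a \<Rightarrow> ('a \<times> 'a) set" where
  "fdiv B a s \<equiv> fraction B (carrier B - {\<zero>\<^bsub>B\<^esub>}) a s"

abbreviation to_Frac :: "('a, 'b) ring_scheme \<Rightarrow> 'a \<Rightarrow> ('a \<times> 'a) set" where
  "to_Frac B b \<equiv> fdiv B b \<one>\<^bsub>B\<^esub>"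

section \<open>Polynomials and matrices of polynomials\<close>

text \<open>
  All polynomials live in one type, with variables \<open>x\<close>, \<open>y\<close>, \<open>z\<close>, the Rees variable \<open>t\<close> and
  \<open>w\<^sub>0, w\<^sub>1, \<dots>\<close>; the polynomial rings of interest are cut out by their variables, so that
  \<open>R \<subseteq> S\<close> and \<open>R \<subseteq> R[t]\<close> are literal inclusions.
\<close>
datatype var = Vx | Vy | Vz | Vt | Vw nat

type_synonym 'k mpoly = "(var \<Rightarrow>\<^sub>0 nat) \<Rightarrow>\<^sub>0 'k"

definition Const :: "'k::zero \<Rightarrow> 'k mpoly" where
  "Const c = Poly_Mapping.single 0 c"

definition Var :: "var \<Rightarrow> 'k::zero_neq_one mpoly" where
  "Var v = Poly_Mapping.single (Poly_Mapping.single v 1) 1"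

definition mpoly_ring :: "var set \<Rightarrow> 'k::comm_ring_1 mpoly ring" where
  "mpoly_ring V = \<lparr>carrier = {p. \<forall>m\<in>Poly_Mapping.keys p. Poly_Mapping.keys m \<subseteq> V},
     monoid.mult = (*), monoid.one = 1, ring.zero = 0, ring.add = (+)\<rparr>"

text \<open>The zero polynomial is homogeneous of every degree.\<close>
definition homogeneous :: "nat \<Rightarrow> 'k::zero mpoly \<Rightarrow> bool" where
  "homogeneous d p \<longleftrightarrow>
     (\<forall>m\<in>Poly_Mapping.keys p. (\<Sum>v\<in>Poly_Mapping.keys m. Poly_Mapping.lookup m v) = d)"

definition subst :: "(var \<Rightarrow> 'k::comm_ring_1 mpoly) \<Rightarrow> 'k mpoly \<Rightarrow> 'k mpoly" where
  "subst \<sigma> p = (\<Sum>m\<in>Poly_Mapping.keys p. Const (Poly_Mapping.lookup p m) *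
     (\<Prod>v\<in>Poly_Mapping.keys m. \<sigma> v ^ Poly_Mapping.lookup m v))"

abbreviation Rxyz :: "'k::comm_ring_1 mpoly ring" where
  "Rxyz \<equiv> mpoly_ring {Vx, Vy, Vz}"

definition det_ideal :: "nat \<Rightarrow> 'k::comm_ring_1 mpoly mat \<Rightarrow> 'k mpoly set" where
  "det_ideal i A = Idl\<^bsub>Rxyz\<^esub> {det (submatrix A J K) | J K.
     J \<subseteq> {..<dim_row A} \<and> K \<subseteq> {..<dim_col A} \<and> card J = i \<and> card K = i}"

text \<open>
  \<open>\<phi>\<close> presents the ideal generated by \<open>f\<^sub>0, \<dots>, f\<^sub>n\<^sub>-\<^sub>1\<close> with respect to these generators: its columns
  generate the module of syzygies, i.e. \<open>R\<^sup>n\<^sup>-\<^sup>1 \<rightarrow> R\<^sup>n \<rightarrow> I \<rightarrow> 0\<close> is exact.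
\<close>
definition presents :: "'k::comm_ring_1 mpoly mat \<Rightarrow> 'k mpoly vec \<Rightarrow> bool" where
  "presents \<phi> f \<longleftrightarrow> dim_row \<phi> = dim_vec f \<and>
     (\<forall>c \<in> carrier_vec (dim_vec f). set\<^sub>v c \<subseteq> carrier Rxyz \<longrightarrow>
        (f \<bullet> c = 0 \<longleftrightarrow>
          (\<exists>b \<in> carrier_vec (dim_col \<phi>). set\<^sub>v b \<subseteq> carrier Rxyz \<and> c = \<phi> *\<^sub>v b)))"

text \<open>
  A prime generated by two of the variables, after a linear change of variables, is a prime
  generated by two linearly independent linear forms \<open>u\<close>, \<open>v\<close>. The rank of \<open>\<phi>\<close> modulo a prime is at
  most 1 iff all \<open>2 \<times> 2\<close> minors lie in that prime.
\<close>
definition rank_le_1_mod_two_vars :: "'k::comm_ring_1 mpoly mat \<Rightarrow> bool" where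
  "rank_le_1_mod_two_vars \<phi> \<longleftrightarrow> (\<exists>u v. u \<in> carrier Rxyz \<and> v \<in> carrier Rxyz \<and>
     homogeneous 1 u \<and> homogeneous 1 v \<and>
     (\<forall>a b. Const a * u + Const b * v = 0 \<longrightarrow> a = 0 \<and> b = 0) \<and>
     det_ideal 2 \<phi> \<subseteq> Idl\<^bsub>Rxyz\<^esub> {u, v})"

definition gens_ideal :: "'k::comm_ring_1 mpoly vec \<Rightarrow> 'k mpoly set" where
  "gens_ideal f = Idl\<^bsub>Rxyz\<^esub> (set\<^sub>v f)"

text \<open>
  The condition on \<open>I\<^sub>1(\<phi>)\<close> is imposed up to radical. The equality \<open>I\<^sub>1(\<phi>) = (x, y, z)\<close> would be
  incompatible with the shape in \<open>case_III\<close> below, which forces \<open>I\<^sub>1(\<phi>) \<subseteq> (x, y, z\<^sup>2)\<close>.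
\<close>
definition setting :: "nat \<Rightarrow> 'k::alg_closed_field mpoly vec \<Rightarrow> 'k mpoly mat \<Rightarrow> bool" where
  "setting n f \<phi> \<longleftrightarrow>
     n > 4 \<and>
     f \<in> carrier_vec n \<and> set\<^sub>v f \<subseteq> carrier Rxyz \<and>
     (\<exists>d. \<forall>i<n. homogeneous d (f $ i)) \<and>
     min_gens Rxyz (gens_ideal f) = enat n \<and>
     ideal_height Rxyz (gens_ideal f) = 2 \<and>
     perfect_ideal Rxyz (gens_ideal f) \<and>
     \<phi> \<in> carrier_mat n (n - 1) \<and> elements_mat \<phi> \<subseteq> carrier Rxyz \<and>
     presents \<phi> f \<and>
     (\<forall>i<n. \<forall>j<n - 2. homogeneous 1 (\<phi> $$ (i, j))) \<and>
     (\<forall>i<n. homogeneous 2 (\<phi> $$ (i, n - 2))) \<and>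
     radical Rxyz (det_ideal 1 \<phi>) = Idl\<^bsub>Rxyz\<^esub> {Var Vx, Var Vy, Var Vz} \<and>
     rank_le_1_mod_two_vars \<phi> \<and>
     G_cond 2 Rxyz (gens_ideal f) \<and>
     \<not> G_cond 3 Rxyz (gens_ideal f)"

definition case_III :: "nat \<Rightarrow> 'k::comm_ring_1 mpoly mat \<Rightarrow> bool" where
  "case_III n \<phi> \<longleftrightarrow>
     \<phi> $$ (0, n - 2) = Var Vz ^ 2 \<and>
     (\<forall>i<n. \<forall>j<n - 2. \<phi> $$ (i, j) \<in> carrier (mpoly_ring {Vx, Vy}) \<and> homogeneous 1 (\<phi> $$ (i, j))) \<and>
     (\<forall>i. 1 \<le> i \<and> i < n \<longrightarrow>
        \<phi> $$ (i, n - 2) \<in> carrier Rxyz \<and> homogeneous 2 (\<phi> $$ (i, n - 2)) \<and>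
        Poly_Mapping.lookup (\<phi> $$ (i, n - 2)) (Poly_Mapping.single Vz 2) = 0)"

section \<open>The Rees algebra, the ring \<open>B\<close> and its ideals\<close>

definition Rees_algebra :: "'k::comm_ring_1 mpoly set \<Rightarrow> 'k mpoly ring" where
  "Rees_algebra I = (mpoly_ring {Vx, Vy, Vz, Vt})
     \<lparr>carrier := generate_ring (mpoly_ring {Vx, Vy, Vz, Vt}) (carrier Rxyz \<union> {a * Var Vt | a. a \<in> I})\<rparr>"

definition S_ring :: "nat \<Rightarrow> 'k::comm_ring_1 mpoly ring" where
  "S_ring n = mpoly_ring ({Vx, Vy, Vz} \<union> Vw ` {..<n})"

definition Rees_map :: "'k::comm_ring_1 mpoly vec \<Rightarrow> 'k mpoly \<Rightarrow> 'k mpoly" where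
  "Rees_map f = subst (\<lambda>v. case v of Vw i \<Rightarrow> f $ i * Var Vt | _ \<Rightarrow> Var v)"

definition A_ideal :: "'k::comm_ring_1 mpoly vec \<Rightarrow> 'k mpoly set" where
  "A_ideal f = a_kernel (S_ring (dim_vec f)) (Rees_algebra (gens_ideal f)) (Rees_map f)"

text \<open>Indices are shifted: \<open>l_form \<phi> j\<close> is \<open>l\<^sub>j\<^sub>+\<^sub>1\<close>, so that \<open>l_form \<phi> (n - 2)\<close> is \<open>l\<^sub>n\<^sub>-\<^sub>1\<close>.\<close>
definition l_form :: "'k::comm_ring_1 mpoly mat \<Rightarrow> nat \<Rightarrow> 'k mpoly" where
  "l_form \<phi> j = vec (dim_row \<phi>) (\<lambda>i. Var (Vw i)) \<bullet> col \<phi> j"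

definition J_ideal :: "nat \<Rightarrow> 'k::comm_ring_1 mpoly mat \<Rightarrow> 'k mpoly set" where
  "J_ideal n \<phi> = colon (S_ring n) (Idl\<^bsub>S_ring n\<^esub> (l_form \<phi> ` {..<n - 2}))
     (Idl\<^bsub>S_ring n\<^esub> {Var Vx, Var Vy})"

definition B_ring :: "nat \<Rightarrow> 'k::comm_ring_1 mpoly mat \<Rightarrow> 'k mpoly set ring" where
  "B_ring n \<phi> = S_ring n Quot J_ideal n \<phi>"

definition bar :: "nat \<Rightarrow> 'k::comm_ring_1 mpoly mat \<Rightarrow> 'k mpoly \<Rightarrow> 'k mpoly set" where
  "bar n \<phi> a = J_ideal n \<phi> +>\<^bsub>S_ring n\<^esub> a"

definition K_ideal :: "nat \<Rightarrow> 'k::comm_ring_1 mpoly mat \<Rightarrow> 'k mpoly set set" where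
  "K_ideal n \<phi> = colon (B_ring n \<phi>)
     (Idl\<^bsub>B_ring n \<phi>\<^esub> {bar n \<phi> (Var Vz ^ 2 * Var (Vw 0))})
     (Idl\<^bsub>B_ring n \<phi>\<^esub> {bar n \<phi> (Var Vx), bar n \<phi> (Var Vy), bar n \<phi> (Var Vz ^ 2 * Var (Vw 0))})"

definition D_ideal ::
    "nat \<Rightarrow> 'k::comm_ring_1 mpoly mat \<Rightarrow> ('k mpoly set \<times> 'k mpoly set) set set" where
  "D_ideal n \<phi> =
     {fdiv (B_ring n \<phi>) (bar n \<phi> (l_form \<phi> (n - 2)) \<otimes>\<^bsub>B_ring n \<phi>\<^esub> k)
        (bar n \<phi> (Var Vz ^ 2 * Var (Vw 0))) | k. k \<in> K_ideal n \<phi>}"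

end

theory Submission
  imports Defs "Jordan_Normal_Form.Char_Poly"
begin

text \<open>
  Both ideals are the principal ideal of \<open>B\<close> generated by the image of \<open>F = l\<^sub>n\<^sub>-\<^sub>1\<close>.

  The forms \<open>l\<^sub>j = x a\<^sub>j + y b\<^sub>j\<close> with \<open>j \<le> n - 2\<close> come from a matrix pencil with scalar coefficients.  As
  the generators of \<open>I\<close> are minimal and \<open>\<phi>\<close> is injective, its columns are independent at every point of
  the projective line (\<open>columns_independent_mod\<close>).  Independent linear forms have only Koszul syzygies,
  and this implies that modulo \<open>L = (l\<^sub>1, \<dots>, l\<^sub>n\<^sub>-\<^sub>2)\<close> elements of positive degree in \<open>x, y\<close> have no
  torsion with respect to any linear form \<open>x - e y\<close> (\<open>pencil_torsion_free\<close>).  So \<open>J = L : (x, y)\<close> is the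
  full torsion of \<open>S / L\<close> over \<open>k[x, y]\<close>.  Inverting a product \<open>\<Lambda>\<close> of linear forms, one for
  each eigenvalue of a matrix attached to the pencil, all \<open>w\<^sub>i\<close> can be expressed by two of them,
  without further relations.  Hence \<open>J\<close> is prime and \<open>B\<close> is a domain (\<open>J_prime\<close>).

  In \<open>B\<close> the ideal of \<open>x - e y\<close> is the intersection of two primes: \<open>(x, y)\<close>, and the kernel of the
  evaluation \<open>\<chi> e\<close> at the point \<open>x = e y\<close> (\<open>point_form_dvd_mod_J\<close>).  Up to multiples of \<open>x\<close> and \<open>y\<close>,
  \<open>F\<close> is \<open>z\<^sup>2 w\<^sub>0\<close>, which is nonzero in \<open>B\<close>; so neither element lies in \<open>(x, y)\<close>.  This has two
  consequences.

  \<^item> The colon ideal of \<open>z\<^sup>2 w\<^sub>0\<close> and \<open>(x, y)\<close> is generated by \<open>z\<^sup>2 w\<^sub>0\<close> (\<open>colon_xy_mod_J\<close>).  So \<open>\<D>\<close> is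
    generated by \<open>F\<close>.

  \<^item> Moreover \<open>F\<close> is not in the kernel of any \<open>\<chi> e\<close>, for otherwise its column would be torsion modulo
    the others (\<open>\<chi>_F_nonzero\<close>).  So linear forms are regular modulo \<open>F\<close>, and the equality of \<open>(F)\<close>
    with the Rees ideal can be checked after inverting \<open>\<Lambda>\<close>.  There only \<open>w\<^sub>p\<close> and \<open>w\<^sub>q\<close> are left and \<open>F\<close>
    becomes \<open>\<alpha> w\<^sub>p + \<beta> w\<^sub>q\<close>.  Exactness of the presentation makes \<open>\<alpha>, \<beta>\<close> a regular sequence, and the
    ideal is of linear type (\<open>Rees_ideal_mod_J\<close>).

  The computations take place in the ring of all polynomials, where ideals are easier to handle; setting
  the superfluous variables to zero brings the results back to \<open>S\<close>.
\<close>

section \<open>Polynomials and substitutions\<close>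

text \<open>Some linear order on the variables is what makes the polynomials an instance of \<open>idom\<close>.\<close>

fun var_code :: "var \<Rightarrow> nat" where
  "var_code Vx = 0"
| "var_code Vy = 1"
| "var_code Vz = 2"
| "var_code Vt = 3"
| "var_code (Vw i) = i + 4"

lemma var_code_inject: "var_code u = var_code v \<longleftrightarrow> u = v"
  by (cases u; cases v) auto

instantiation var :: linorder
begin

definition "u \<le> v \<longleftrightarrow> var_code u \<le> var_code v"
definition "u < v \<longleftrightarrow> var_code u < var_code v"

instance
  by standard (auto simp: less_eq_var_def less_var_def var_code_inject)

end

lemma sum_single_lookup:
  "(\<Sum>k\<in>Poly_Mapping.keys p. Poly_Mapping.single k (Poly_Mapping.lookup p k)) = p"
proof (rule poly_mapping_eqI)
  fix i
  have "Poly_Mapping.lookup (\<Sum>k\<in>Poly_Mapping.keys p. Poly_Mapping.single k (Poly_Mapping.lookup p k)) i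
    = (\<Sum>k\<in>Poly_Mapping.keys p. if k = i then Poly_Mapping.lookup p k else 0)"
    by (simp add: lookup_sum lookup_single when_def)
  also have "\<dots> = Poly_Mapping.lookup p i"
    by (simp add: in_keys_iff)
  finally show "Poly_Mapping.lookup (\<Sum>k\<in>Poly_Mapping.keys p. Poly_Mapping.single k (Poly_Mapping.lookup p k)) i
    = Poly_Mapping.lookup p i" .
qed

lemma Const_0 [simp]: "Const 0 = 0"
  and Const_1 [simp]: "Const 1 = (1 :: 'k::comm_ring_1 mpoly)"
  by (simp_all add: Const_def)

lemma Const_add: "Const (a + b) = Const a + Const (b :: 'k::comm_ring_1)"
  by (simp add: Const_def single_add)

lemma Const_mult: "Const (a * b) = Const a * Const (b :: 'k::comm_ring_1)"
  by (simp add: Const_def mult_single)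

lemma Const_minus: "Const (- a) = - Const (a :: 'k::comm_ring_1)"
  by (simp add: Const_def single_uminus)

lemma Const_diff: "Const (a - b) = Const a - Const (b :: 'k::comm_ring_1)"
  by (simp add: Const_def single_diff)

lemma Const_sum: "Const (sum f A) = (\<Sum>x\<in>A. Const (f x :: 'k::comm_ring_1))"
  by (induction A rule: infinite_finite_induct) (auto simp: Const_add)

lemma Const_eq_0_iff [simp]: "Const c = 0 \<longleftrightarrow> c = (0 :: 'k::comm_ring_1)"
  by (metis Const_def lookup_single_eq lookup_zero single_zero)

lemma Var_power: "Var v ^ k = (Poly_Mapping.single (Poly_Mapping.single v k) 1 :: 'k::comm_ring_1 mpoly)"
  by (induction k) (simp_all add: Var_def mult_single flip: single_add)

lemma monomial_eq_prod:
  "Poly_Mapping.single m (c :: 'k::comm_ring_1)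
    = Const c * (\<Prod>v\<in>Poly_Mapping.keys m. Var v ^ Poly_Mapping.lookup m v)"
proof -
  have "(\<Prod>v\<in>K. Var v ^ Poly_Mapping.lookup m v)
    = (Poly_Mapping.single (\<Sum>v\<in>K. Poly_Mapping.single v (Poly_Mapping.lookup m v)) 1 :: 'k mpoly)"
    if "finite K" for K
    using that by (induction K) (simp_all add: Var_power mult_single)
  from this[of "Poly_Mapping.keys m"] show ?thesis
    by (simp add: sum_single_lookup Const_def mult_single)
qed

lemma mpoly_ring_simps [simp]:
  "p \<otimes>\<^bsub>mpoly_ring V\<^esub> q = p * q" "p \<oplus>\<^bsub>mpoly_ring V\<^esub> q = p + q"
  "\<one>\<^bsub>mpoly_ring V\<^esub> = 1" "\<zero>\<^bsub>mpoly_ring V\<^esub> = 0"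
  by (simp_all add: mpoly_ring_def)

lemma carrier_mpoly_ring:
  "p \<in> carrier (mpoly_ring V) \<longleftrightarrow> (\<forall>m\<in>Poly_Mapping.keys p. Poly_Mapping.keys m \<subseteq> V)"
  by (simp add: mpoly_ring_def)

lemma Const_carrier [simp]: "Const c \<in> carrier (mpoly_ring V)"
  by (auto simp: carrier_mpoly_ring Const_def split: if_splits)

lemma zero_carrier [simp]: "0 \<in> carrier (mpoly_ring V)"
  and one_carrier [simp]: "1 \<in> carrier (mpoly_ring V)"
  by (simp_all add: carrier_mpoly_ring)

lemma Var_carrier [simp]:
  "(Var v :: 'k::comm_ring_1 mpoly) \<in> carrier (mpoly_ring V) \<longleftrightarrow> v \<in> V"
  by (auto simp: carrier_mpoly_ring Var_def)

lemma add_carrier [simp]: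
  "p \<in> carrier (mpoly_ring V) \<Longrightarrow> q \<in> carrier (mpoly_ring V) \<Longrightarrow> p + q \<in> carrier (mpoly_ring V)"
  unfolding carrier_mpoly_ring using Poly_Mapping.keys_add[of p q] by blast

lemma mult_carrier [simp]:
  assumes "p \<in> carrier (mpoly_ring V)" "q \<in> carrier (mpoly_ring V)"
  shows "p * q \<in> carrier (mpoly_ring V)"
  unfolding carrier_mpoly_ring
proof (intro ballI)
  fix m assume "m \<in> Poly_Mapping.keys (p * q)"
  then obtain a b where "m = a + b" "a \<in> Poly_Mapping.keys p" "b \<in> Poly_Mapping.keys q"
    using Poly_Mapping.keys_mult[of p q] by blast
  then show "Poly_Mapping.keys m \<subseteq> V"
    using assms Poly_Mapping.keys_add[of a b] unfolding carrier_mpoly_ring by blast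
qed

lemma uminus_carrier [simp]:
  "p \<in> carrier (mpoly_ring V) \<Longrightarrow> - p \<in> carrier (mpoly_ring V)"
  unfolding carrier_mpoly_ring by (auto simp: in_keys_iff)

lemma diff_carrier [simp]:
  "p \<in> carrier (mpoly_ring V) \<Longrightarrow> q \<in> carrier (mpoly_ring V) \<Longrightarrow> p - q \<in> carrier (mpoly_ring V)"
  using add_carrier[of p V "- q"] by simp

lemma power_carrier [simp]:
  "p \<in> carrier (mpoly_ring V) \<Longrightarrow> p ^ k \<in> carrier (mpoly_ring V)"
  by (induction k) auto

lemma sum_carrier [simp]:
  "(\<And>i. i \<in> I \<Longrightarrow> f i \<in> carrier (mpoly_ring V)) \<Longrightarrow> sum f I \<in> carrier (mpoly_ring V)"
  by (induction I rule: infinite_finite_induct) auto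

lemma prod_carrier [simp]:
  "(\<And>i. i \<in> I \<Longrightarrow> f i \<in> carrier (mpoly_ring V)) \<Longrightarrow> prod f I \<in> carrier (mpoly_ring V)"
  by (induction I rule: infinite_finite_induct) auto

lemma carrier_mono: "V \<subseteq> W \<Longrightarrow> p \<in> carrier (mpoly_ring V) \<Longrightarrow> p \<in> carrier (mpoly_ring W)"
  unfolding carrier_mpoly_ring by blast

lemma carrier_UNIV [simp]: "p \<in> carrier (mpoly_ring UNIV)"
  by (simp add: carrier_mpoly_ring)

lemma cring_mpoly_ring: "cring (mpoly_ring V :: 'k::comm_ring_1 mpoly ring)"
proof (rule cringI)
  show "abelian_group (mpoly_ring V :: 'k mpoly ring)"
  proof (rule abelian_groupI)
    fix p :: "'k mpoly" assume "p \<in> carrier (mpoly_ring V)"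
    then show "\<exists>q\<in>carrier (mpoly_ring V). q \<oplus>\<^bsub>mpoly_ring V\<^esub> p = \<zero>\<^bsub>mpoly_ring V\<^esub>"
      by (intro bexI[of _ "- p"]) auto
  qed (auto simp: algebra_simps)
  show "comm_monoid (mpoly_ring V :: 'k mpoly ring)"
    by (rule comm_monoidI) (auto simp: algebra_simps)
qed (auto simp: algebra_simps)

text \<open>Polynomials in the variables \<open>V\<close> are generated by constants and the variables in \<open>V\<close>; nearly
  every fact about substitutions below is proved by induction along this generation.\<close>

lemma mpoly_ring_induct [consumes 1, case_names Const Var add mult]:
  fixes p :: "'k::comm_ring_1 mpoly"
  assumes "p \<in> carrier (mpoly_ring V)"
    and Const: "\<And>c. P (Const c)"
    and Var: "\<And>v. v \<in> V \<Longrightarrow> P (Var v)"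
    and add: "\<And>p q. P p \<Longrightarrow> P q \<Longrightarrow> P (p + q)"
    and mult: "\<And>p q. P p \<Longrightarrow> P q \<Longrightarrow> P (p * q)"
  shows "P p"
proof -
  have one: "P 1" and zero: "P 0"
    using Const[of 1] Const[of 0] by auto
  have sum: "P (sum f I)" if "\<And>i. i \<in> I \<Longrightarrow> P (f i)" for f :: "(var \<Rightarrow>\<^sub>0 nat) \<Rightarrow> 'k mpoly" and I
    using that by (induction I rule: infinite_finite_induct) (auto intro: add zero)
  have power: "P (q ^ k)" if "P q" for q k
    using that by (induction k) (auto intro: one mult)
  have prod: "P (prod f I)" if "\<And>i. i \<in> I \<Longrightarrow> P (f i)" for f :: "var \<Rightarrow> 'k mpoly" and I
    using that by (induction I rule: infinite_finite_induct) (auto intro: mult one)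
  have "P (Poly_Mapping.single m (Poly_Mapping.lookup p m))" if "m \<in> Poly_Mapping.keys p" for m
    unfolding monomial_eq_prod using that assms(1)
    by (intro mult Const prod power Var) (auto simp: carrier_mpoly_ring)
  then have "P (\<Sum>m\<in>Poly_Mapping.keys p. Poly_Mapping.single m (Poly_Mapping.lookup p m))"
    by (rule sum)
  then show ?thesis
    by (simp add: sum_single_lookup)
qed

lemmas mpoly_induct = mpoly_ring_induct[OF carrier_UNIV, case_names Const Var add mult]

subsection \<open>Substitution is a ring homomorphism\<close>

definition eval_monomial :: "(var \<Rightarrow> 'k::comm_ring_1 mpoly) \<Rightarrow> (var \<Rightarrow>\<^sub>0 nat) \<Rightarrow> 'k mpoly" where
  "eval_monomial \<sigma> m = (\<Prod>v\<in>Poly_Mapping.keys m. \<sigma> v ^ Poly_Mapping.lookup m v)"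

lemma eval_monomial_superset:
  "finite K \<Longrightarrow> Poly_Mapping.keys m \<subseteq> K \<Longrightarrow> eval_monomial \<sigma> m = (\<Prod>v\<in>K. \<sigma> v ^ Poly_Mapping.lookup m v)"
  unfolding eval_monomial_def by (rule prod.mono_neutral_left) (auto simp: in_keys_iff)

lemma eval_monomial_add: "eval_monomial \<sigma> (m + m') = eval_monomial \<sigma> m * eval_monomial \<sigma> m'"
proof -
  let ?K = "Poly_Mapping.keys m \<union> Poly_Mapping.keys m'"
  have "Poly_Mapping.keys (m + m') \<subseteq> ?K"
    by (rule Poly_Mapping.keys_add)
  then show ?thesis
    by (simp add: eval_monomial_superset[of ?K] lookup_add power_add prod.distrib)
qed

lemma subst_superset:
  assumes "finite K" "Poly_Mapping.keys p \<subseteq> K"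
  shows "subst \<sigma> p = (\<Sum>m\<in>K. Const (Poly_Mapping.lookup p m) * eval_monomial \<sigma> m)"
  unfolding subst_def eval_monomial_def using assms
  by (intro sum.mono_neutral_left) (auto simp: in_keys_iff)

lemma subst_add [simp]: "subst \<sigma> (p + q) = subst \<sigma> p + subst \<sigma> q"
proof -
  let ?K = "Poly_Mapping.keys p \<union> Poly_Mapping.keys q"
  have "Poly_Mapping.keys (p + q) \<subseteq> ?K"
    by (rule Poly_Mapping.keys_add)
  then show ?thesis
    by (simp add: subst_superset[of ?K] lookup_add Const_add sum.distrib algebra_simps)
qed

lemma subst_single: "subst \<sigma> (Poly_Mapping.single m c) = Const c * eval_monomial \<sigma> m"
  by (simp add: subst_superset[of "{m}"])

lemma subst_0 [simp]: "subst \<sigma> 0 = 0"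
  by (simp add: subst_def)

lemma subst_Const [simp]: "subst \<sigma> (Const c) = Const c"
  by (simp add: Const_def subst_single eval_monomial_def)

lemma subst_1 [simp]: "subst \<sigma> 1 = 1"
  using subst_Const[of \<sigma> 1] by simp

lemma subst_Var [simp]: "subst \<sigma> (Var v) = \<sigma> v"
  by (simp add: Var_def subst_single eval_monomial_def)

lemma subst_sum [simp]: "subst \<sigma> (sum f I) = (\<Sum>i\<in>I. subst \<sigma> (f i))"
  by (induction I rule: infinite_finite_induct) auto

lemma subst_mult [simp]: "subst \<sigma> (p * q) = subst \<sigma> p * subst \<sigma> q"
proof -
  let ?s = "\<lambda>p m. Poly_Mapping.single m (Poly_Mapping.lookup p m)"
  have "subst \<sigma> (p * q) = subst \<sigma> ((\<Sum>m\<in>Poly_Mapping.keys p. ?s p m) * (\<Sum>m\<in>Poly_Mapping.keys q. ?s q m))"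
    by (simp add: sum_single_lookup)
  also have "\<dots> = subst \<sigma> (\<Sum>m\<in>Poly_Mapping.keys p. ?s p m) * subst \<sigma> (\<Sum>m\<in>Poly_Mapping.keys q. ?s q m)"
    unfolding sum_product
    by (simp add: mult_single subst_single eval_monomial_add Const_mult sum_product algebra_simps)
  finally show ?thesis
    by (simp add: sum_single_lookup)
qed

lemma subst_uminus [simp]: "subst \<sigma> (- p) = - subst \<sigma> p"
  using subst_add[of \<sigma> p "- p"] by (simp add: eq_neg_iff_add_eq_0 add.commute)

lemma subst_diff [simp]: "subst \<sigma> (p - q) = subst \<sigma> p - subst \<sigma> q"
  using subst_add[of \<sigma> p "- q"] by simp

lemma subst_power [simp]: "subst \<sigma> (p ^ k) = subst \<sigma> p ^ k"
  by (induction k) auto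

lemma subst_cong_carrier:
  "p \<in> carrier (mpoly_ring V) \<Longrightarrow> (\<And>v. v \<in> V \<Longrightarrow> \<sigma> v = \<tau> v) \<Longrightarrow> subst \<sigma> p = subst \<tau> p"
  by (induction p rule: mpoly_ring_induct) auto

lemma subst_id_carrier:
  "p \<in> carrier (mpoly_ring V) \<Longrightarrow> (\<And>v. v \<in> V \<Longrightarrow> \<sigma> v = Var v) \<Longrightarrow> subst \<sigma> p = p"
  by (induction p rule: mpoly_ring_induct) auto

lemma subst_in_carrier:
  "p \<in> carrier (mpoly_ring V) \<Longrightarrow> (\<And>v. v \<in> V \<Longrightarrow> \<sigma> v \<in> carrier (mpoly_ring W)) \<Longrightarrow>
    subst \<sigma> p \<in> carrier (mpoly_ring W)"
  by (induction p rule: mpoly_ring_induct) auto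

lemma subst_subst: "subst \<sigma> (subst \<tau> p) = subst (\<lambda>v. subst \<sigma> (\<tau> v)) p"
  by (induction p rule: mpoly_induct) auto

subsection \<open>Ideals of the whole polynomial ring\<close>

definition ideal_set :: "'a::comm_ring_1 set \<Rightarrow> bool" where
  "ideal_set D \<longleftrightarrow> 0 \<in> D \<and> (\<forall>u\<in>D. \<forall>v\<in>D. u + v \<in> D) \<and> (\<forall>u\<in>D. \<forall>r. r * u \<in> D)"

lemma ideal_setD:
  assumes "ideal_set D"
  shows "0 \<in> D" "u \<in> D \<Longrightarrow> v \<in> D \<Longrightarrow> u + v \<in> D" "u \<in> D \<Longrightarrow> r * u \<in> D" "u \<in> D \<Longrightarrow> u * r \<in> D"
    "u \<in> D \<Longrightarrow> - u \<in> D" "u \<in> D \<Longrightarrow> v \<in> D \<Longrightarrow> u - v \<in> D"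
proof -
  show *: "0 \<in> D" "u \<in> D \<Longrightarrow> v \<in> D \<Longrightarrow> u + v \<in> D" "u \<in> D \<Longrightarrow> r * u \<in> D" for u v r
    using assms by (auto simp: ideal_set_def)
  show "u \<in> D \<Longrightarrow> u * r \<in> D"
    using *(3)[of u r] by (simp add: mult.commute)
  show m: "u \<in> D \<Longrightarrow> - u \<in> D" for u
    using *(3)[of u "- 1"] by simp
  show "u \<in> D \<Longrightarrow> v \<in> D \<Longrightarrow> u - v \<in> D"
    using *(2)[of u "- v"] m[of v] by simp
qed

lemma ideal_set_sum:
  "ideal_set D \<Longrightarrow> (\<And>i. i \<in> I \<Longrightarrow> f i \<in> D) \<Longrightarrow> sum f I \<in> D"
  by (induction I rule: infinite_finite_induct) (auto intro: ideal_setD)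

text \<open>Congruent images of the variables give congruent substitutions.  With \<open>\<tau> = Var\<close> this is the
  point_form theorem, and more generally says that \<open>p\<close> is its value plus a member of \<open>D\<close>.\<close>

lemma subst_cong_mod:
  assumes D: "ideal_set D" and v: "\<And>v. \<sigma> v - \<tau> v \<in> D"
  shows "subst \<sigma> p - subst \<tau> p \<in> D"
proof (induction p rule: mpoly_induct)
  case (add p q)
  then have "(subst \<sigma> p - subst \<tau> p) + (subst \<sigma> q - subst \<tau> q) \<in> D"
    by (rule ideal_setD[OF D])
  then show ?case
    by (simp add: algebra_simps)
next
  case (mult p q)
  then have "(subst \<sigma> p - subst \<tau> p) * subst \<sigma> q + subst \<tau> p * (subst \<sigma> q - subst \<tau> q) \<in> D"
    by (intro ideal_setD(2)[OF D] ideal_setD(3)[OF D, of "subst \<sigma> q - subst \<tau> q"]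
        ideal_setD(4)[OF D, of "subst \<sigma> p - subst \<tau> p"])
  then show ?case
    by (simp add: algebra_simps)
qed (auto simp: ideal_setD[OF D] v)

lemma subst_Var_id [simp]: "subst Var p = p"
  by (rule subst_id_carrier[OF carrier_UNIV]) auto

lemma diff_subst_mem:
  assumes "ideal_set D" "\<And>v. Var v - \<sigma> v \<in> D"
  shows "p - subst \<sigma> p \<in> D"
  using subst_cong_mod[of D Var \<sigma> p] assms by simp

definition lin_ideal :: "(nat \<Rightarrow> 'a::comm_ring_1) \<Rightarrow> nat \<Rightarrow> 'a set" where
  "lin_ideal l m = {(\<Sum>j<m. l j * c j) | c. True}"

lemma lin_idealI: "u = (\<Sum>j<m. l j * c j) \<Longrightarrow> u \<in> lin_ideal l m"
  by (auto simp: lin_ideal_def)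

lemma lin_idealE:
  assumes "u \<in> lin_ideal l m"
  obtains c where "u = (\<Sum>j<m. l j * c j)"
  using assms by (auto simp: lin_ideal_def)

lemma ideal_set_lin_ideal [simp]: "ideal_set (lin_ideal l m)"
  unfolding ideal_set_def
proof (intro conjI ballI allI)
  show "0 \<in> lin_ideal l m"
    by (rule lin_idealI[of _ _ "\<lambda>_. 0"]) simp
next
  fix u v assume "u \<in> lin_ideal l m" "v \<in> lin_ideal l m"
  then obtain c d where "u = (\<Sum>j<m. l j * c j)" "v = (\<Sum>j<m. l j * d j)"
    by (metis lin_idealE)
  then show "u + v \<in> lin_ideal l m"
    by (intro lin_idealI[of _ _ "\<lambda>j. c j + d j"]) (simp add: sum.distrib algebra_simps)
next
  fix u r assume "u \<in> lin_ideal l m"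
  then obtain c where "u = (\<Sum>j<m. l j * c j)"
    by (metis lin_idealE)
  then show "r * u \<in> lin_ideal l m"
    by (intro lin_idealI[of _ _ "\<lambda>j. r * c j"]) (simp add: sum_distrib_left algebra_simps)
qed

lemma gen_in_lin_ideal: "j < m \<Longrightarrow> l j \<in> lin_ideal l m"
  by (rule lin_idealI[of _ _ "\<lambda>i. if i = j then 1 else 0"]) (simp add: if_distrib cong: if_cong)

lemma ideal_set_multiples: "ideal_set {u. d dvd u}"
  by (auto simp: ideal_set_def)

lemma factor_theorem: "(Var v - q) dvd (p - subst (Var(v := q)) p)"
proof -
  have "p - subst (Var(v := q)) p \<in> {u. (Var v - q) dvd u}"
    by (rule diff_subst_mem[OF ideal_set_multiples]) auto
  then show ?thesis
    by simp
qed

lemma Var_nonzero [simp]: "Var v \<noteq> (0 :: 'k::comm_ring_1 mpoly)"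
  by (metis Var_def lookup_single_eq lookup_zero zero_neq_one)

text \<open>A nonzero polynomial is divisible by only finitely many powers of a variable.\<close>

lemma eq_0_if_all_powers_dvd:
  fixes u :: "'k::comm_ring_1 mpoly"
  assumes "\<And>N. Var v ^ N dvd u"
  shows "u = 0"
proof (rule ccontr)
  assume "u \<noteq> 0"
  then obtain m where m: "m \<in> Poly_Mapping.keys u"
    by (metis all_not_in_conv keys_eq_empty)
  let ?N = "Suc (Poly_Mapping.lookup m v)"
  obtain q where "u = Var v ^ ?N * q"
    using assms[of ?N] by (elim dvdE)
  then obtain b where "m = Poly_Mapping.single v ?N + b"
    using Poly_Mapping.keys_mult[of "Var v ^ ?N" q] m by (auto simp: Var_power simp del: power_Suc)
  then have "Poly_Mapping.lookup m v \<ge> ?N"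
    by (metis le_add1 lookup_add lookup_single_eq)
  then show False
    by simp
qed

section \<open>Linear algebra over the ground field\<close>

text \<open>For a matrix \<open>A\<close> with independent columns: the rows in \<open>I\<close> (the pivots) form an
  invertible block, and \<open>t\<close> is its inverse, extended by zero.\<close>

definition pivot_inverse ::
    "nat \<Rightarrow> nat \<Rightarrow> (nat \<Rightarrow> nat \<Rightarrow> 'k::field) \<Rightarrow> (nat \<Rightarrow> nat \<Rightarrow> 'k) \<Rightarrow> nat set \<Rightarrow> bool" where
  "pivot_inverse n m A t I \<longleftrightarrow> I \<subseteq> {..<n} \<and> card I = m \<and>
    (\<forall>j<m. \<forall>k<m. (\<Sum>i<n. t j i * A i k) = (if j = k then 1 else 0)) \<and>
    (\<forall>i\<in>I. \<forall>i'<n. (\<Sum>j<m. A i j * t j i') = (if i = i' then 1 else 0)) \<and>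
    (\<forall>j<m. \<forall>i<n. i \<notin> I \<longrightarrow> t j i = 0)"

definition independent_columns :: "nat \<Rightarrow> nat \<Rightarrow> (nat \<Rightarrow> nat \<Rightarrow> 'k::field) \<Rightarrow> bool" where
  "independent_columns n m A \<longleftrightarrow>
    (\<forall>c. (\<forall>i<n. (\<Sum>j<m. A i j * c j) = 0) \<longrightarrow> (\<forall>j<m. c j = 0))"

lemma independent_columns_Suc:
  assumes "independent_columns n (Suc m) A"
  shows "independent_columns n m A"
  unfolding independent_columns_def
proof (intro allI impI)
  fix c j assume "\<forall>i<n. (\<Sum>j<m. A i j * c j) = 0" "j < m"
  then show "c j = 0"
    using assms[unfolded independent_columns_def, rule_format, of "c(m := 0)" j] by auto
qed

lemma pivot_inverse_exists:
  assumes "independent_columns n m A"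
  shows "\<exists>t I. pivot_inverse n m A t I"
  using assms
proof (induction m)
  case 0
  have "pivot_inverse n 0 A (\<lambda>_ _. 0) {}"
    by (simp add: pivot_inverse_def)
  then show ?case
    by blast
next
  case (Suc m)
  obtain t I where "pivot_inverse n m A t I"
    using Suc.IH independent_columns_Suc[OF Suc.prems] by blast
  then have I: "I \<subseteq> {..<n}" "card I = m"
    and tA: "\<And>j k. j < m \<Longrightarrow> k < m \<Longrightarrow> (\<Sum>i<n. t j i * A i k) = (if j = k then 1 else 0)"
    and At: "\<And>i i'. i \<in> I \<Longrightarrow> i' < n \<Longrightarrow> (\<Sum>j<m. A i j * t j i') = (if i = i' then 1 else 0)"
    and t0: "\<And>j i. j < m \<Longrightarrow> i < n \<Longrightarrow> i \<notin> I \<Longrightarrow> t j i = 0"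
    by (simp_all add: pivot_inverse_def)
  define \<tau> where "\<tau> j = (\<Sum>i<n. t j i * A i m)" for j
  \<comment> \<open>the residue of the new column; a row where it does not vanish is the new pivot\<close>
  define r where "r i = A i m - (\<Sum>j<m. A i j * \<tau> j)" for i
  obtain i0 where i0: "i0 < n" "r i0 \<noteq> 0"
  proof (rule ccontr)
    assume "\<not> thesis"
    then have "\<forall>i<n. (\<Sum>j<Suc m. A i j * ((\<lambda>j. - \<tau> j)(m := 1)) j) = 0"
      using that by (auto simp: r_def sum_negf)
    with Suc.prems have "\<forall>j<Suc m. ((\<lambda>j. - \<tau> j)(m := 1)) j = 0"
      unfolding independent_columns_def by blast
    then show False
      by auto
  qed
  have r0: "r i = 0" if "i \<in> I" for i
  proof -
    have "i < n"
      using that I by auto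
    have "(\<Sum>j<m. A i j * \<tau> j) = (\<Sum>i'<n. (\<Sum>j<m. A i j * t j i') * A i' m)"
      unfolding \<tau>_def sum_distrib_left sum_distrib_right
      by (subst sum.swap) (simp add: mult.assoc)
    also have "\<dots> = (\<Sum>i'<n. if i = i' then A i' m else 0)"
      using that by (intro sum.cong) (auto simp: At)
    finally show ?thesis
      using \<open>i < n\<close> by (simp add: r_def)
  qed
  then have "i0 \<notin> I"
    using i0 by auto
  define s where "s i' = ((if i0 = i' then 1 else 0) - (\<Sum>j<m. A i0 j * t j i')) / r i0" for i'
  define t' where "t' j = (if j = m then s else (\<lambda>i. t j i - \<tau> j * s i))" for j
  have sA: "(\<Sum>i<n. s i * A i k) = (if k = m then 1 else 0)" if "k \<le> m" for k
  proof -
    have "(\<Sum>i<n. s i * A i k)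
      = ((\<Sum>i<n. (if i0 = i then 1 else 0) * A i k) - (\<Sum>i<n. (\<Sum>j<m. A i0 j * t j i) * A i k)) / r i0"
      unfolding s_def by (simp only: times_divide_eq_left left_diff_distrib sum_subtractf
          sum_divide_distrib[symmetric])
    also have "(\<Sum>i<n. (if i0 = i then 1 else 0) * A i k) = A i0 k"
      using i0 by (simp add: if_distrib[of "\<lambda>z. z * _"] cong: if_cong)
    also have "(\<Sum>i<n. (\<Sum>j<m. A i0 j * t j i) * A i k) = (\<Sum>j<m. A i0 j * (\<Sum>i<n. t j i * A i k))"
      unfolding sum_distrib_left sum_distrib_right
      by (subst sum.swap) (simp add: mult.assoc)
    also have "\<dots> = (if k = m then \<Sum>j<m. A i0 j * \<tau> j else A i0 k)"
    proof (cases "k = m")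
      case False
      then have "(\<Sum>j<m. A i0 j * (\<Sum>i<n. t j i * A i k)) = (\<Sum>j<m. if j = k then A i0 j else 0)"
        using that by (intro sum.cong) (auto simp: tA)
      then show ?thesis
        using False that by simp
    qed (simp add: \<tau>_def)
    finally show ?thesis
      using i0 by (simp add: r_def)
  qed
  have At': "(\<Sum>j<Suc m. A i j * t' j i') = (\<Sum>j<m. A i j * t j i') + r i * s i'" for i i'
  proof -
    have "(\<Sum>j<m. A i j * t' j i') = (\<Sum>j<m. A i j * t j i' - A i j * \<tau> j * s i')"
      by (intro sum.cong) (auto simp: t'_def algebra_simps)
    also have "\<dots> = (\<Sum>j<m. A i j * t j i') - (\<Sum>j<m. A i j * \<tau> j) * s i'"
      by (simp add: sum_subtractf sum_distrib_right)
    finally show ?thesis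
      by (simp add: r_def t'_def algebra_simps)
  qed
  show ?case
    unfolding pivot_inverse_def
  proof (intro exI[of _ t'] exI[of _ "insert i0 I"] conjI allI impI ballI)
    show "insert i0 I \<subseteq> {..<n}"
      using I i0 by auto
    show "card (insert i0 I) = Suc m"
      using I \<open>i0 \<notin> I\<close> finite_subset[OF I(1)] by simp
  next
    fix j k assume jk: "j < Suc m" "k < Suc m"
    show "(\<Sum>i<n. t' j i * A i k) = (if j = k then 1 else 0)"
    proof (cases "j = m")
      case False
      then have "(\<Sum>i<n. t' j i * A i k) = (\<Sum>i<n. t j i * A i k) - \<tau> j * (\<Sum>i<n. s i * A i k)"
        by (simp add: t'_def algebra_simps sum_subtractf sum_distrib_left)
      with False jk show ?thesis
        by (auto simp: sA tA \<tau>_def less_Suc_eq)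
    qed (use jk in \<open>auto simp: t'_def sA\<close>)
  next
    fix i i' assume "i \<in> insert i0 I" "i' < n"
    then show "(\<Sum>j<Suc m. A i j * t' j i') = (if i = i' then 1 else 0)"
      unfolding At' using i0 by (auto simp: r0 At s_def simp del: sum.lessThan_Suc)
  next
    fix j i assume "j < Suc m" "i < n" "i \<notin> insert i0 I"
    then show "t' j i = 0"
      by (auto simp: t'_def t0 s_def)
  qed
qed

lemma left_eigenvector_exists:
  fixes N :: "nat \<Rightarrow> nat \<Rightarrow> 'k::alg_closed_field"
  assumes "finite I" "I \<noteq> {}"
  shows "\<exists>e v. (\<exists>j\<in>I. v j \<noteq> 0) \<and> (\<forall>k\<in>I. (\<Sum>j\<in>I. v j * N j k) = e * v k)"
proof -
  define m where "m = card I"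
  have "m > 0"
    using assms by (simp add: m_def card_gt_0_iff)
  obtain h where h: "bij_betw h {..<m} I"
    using ex_bij_betw_nat_finite[OF assms(1)] by (auto simp: m_def atLeast0LessThan)
  define M where "M = mat m m (\<lambda>(a, b). N (h b) (h a))"
  have M: "M \<in> carrier_mat m m"
    by (simp add: M_def)
  have "degree (char_poly M) > 0"
    using degree_monic_char_poly[OF M] \<open>m > 0\<close> by simp
  then obtain e where "poly (char_poly M) e = 0"
    using alg_closed_imp_poly_has_root by blast
  then obtain w where w: "w \<in> carrier_vec m" "w \<noteq> 0\<^sub>v m" "M *\<^sub>v w = e \<cdot>\<^sub>v w"
    using eigenvalue_root_char_poly[OF M] M unfolding eigenvalue_def eigenvector_def by auto
  define v where "v j = w $ the_inv_into {..<m} h j" for j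
  have vh: "v (h a) = w $ a" if "a < m" for a
    using that h by (simp add: v_def bij_betw_def the_inv_into_f_f)
  obtain a where a: "a < m" "w $ a \<noteq> 0"
    using w(1,2) by (metis carrier_vecD eq_vecI index_zero_vec)
  have "h a \<in> I"
    using a h by (auto simp: bij_betw_def)
  moreover have "(\<Sum>j\<in>I. v j * N j k) = e * v k" if "k \<in> I" for k
  proof -
    have "k \<in> h ` {..<m}"
      using that h by (simp add: bij_betw_def)
    then obtain b where b: "b < m" "k = h b"
      by auto
    have "(\<Sum>j\<in>I. v j * N j k) = (\<Sum>a<m. v (h a) * N (h a) k)"
      using h by (rule sum.reindex_bij_betw[symmetric])
    also have "\<dots> = (M *\<^sub>v w) $ b"
      using b w(1) M by (simp add: scalar_prod_def M_def vh atLeast0LessThan mult.commute)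
    also have "\<dots> = e * v k"
      using b w by (simp add: vh)
    finally show ?thesis .
  qed
  ultimately show ?thesis
    using a vh by metis
qed

definition homogeneous_module :: "'k::comm_ring_1 mpoly \<Rightarrow> 'k mpoly \<Rightarrow> 'k mpoly set \<Rightarrow> bool" where
  "homogeneous_module x y D \<longleftrightarrow> 0 \<in> D \<and> (\<forall>u\<in>D. \<forall>v\<in>D. u + v \<in> D) \<and>
     (\<forall>u\<in>D. x * u \<in> D \<and> y * u \<in> D \<and> (\<forall>c. Const c * u \<in> D))"

lemma homogeneous_moduleD:
  assumes "homogeneous_module x y D"
  shows "0 \<in> D" "u \<in> D \<Longrightarrow> v \<in> D \<Longrightarrow> u + v \<in> D" "u \<in> D \<Longrightarrow> x * u \<in> D" "u \<in> D \<Longrightarrow> y * u \<in> D"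
    "u \<in> D \<Longrightarrow> Const c * u \<in> D" "u \<in> D \<Longrightarrow> - u \<in> D" "u \<in> D \<Longrightarrow> v \<in> D \<Longrightarrow> u - v \<in> D"
    "u \<in> D \<Longrightarrow> (x - Const c * y) * u \<in> D"
proof -
  show *: "0 \<in> D" "u \<in> D \<Longrightarrow> v \<in> D \<Longrightarrow> u + v \<in> D" "u \<in> D \<Longrightarrow> x * u \<in> D" "u \<in> D \<Longrightarrow> y * u \<in> D"
    "u \<in> D \<Longrightarrow> Const c * u \<in> D" for u v c
    using assms by (auto simp: homogeneous_module_def)
  show m: "u \<in> D \<Longrightarrow> - u \<in> D" for u
    using *(5)[of u "- 1"] by (simp add: Const_minus)
  show d: "u \<in> D \<Longrightarrow> v \<in> D \<Longrightarrow> u - v \<in> D" for u v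
    using *(2)[of u "- v"] m[of v] by simp
  show "u \<in> D \<Longrightarrow> (x - Const c * y) * u \<in> D"
    using d[of "x * u" "Const c * (y * u)"] *(3,4,5) by (simp add: left_diff_distrib mult.assoc)
qed

lemma homogeneous_module_sum:
  "homogeneous_module x y D \<Longrightarrow> (\<And>i. i \<in> I \<Longrightarrow> f i \<in> D) \<Longrightarrow> sum f I \<in> D"
  by (induction I rule: infinite_finite_induct) (auto intro: homogeneous_moduleD)

lemma homogeneous_module_prod:
  "homogeneous_module x y D \<Longrightarrow> u \<in> D \<Longrightarrow> (\<Prod>e\<leftarrow>es. x - Const e * y) * u \<in> D"
  by (induction es) (auto simp: mult.assoc intro: homogeneous_moduleD(8))

text \<open>If multiplication by \<open>x\<close> acts on the \<open>a\<^sub>j\<close> modulo \<open>D\<close> as \<open>y\<close> times a scalar matrix, then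
  triangularising that matrix splits off one linear factor \<open>x - e y\<close> per eigenvalue; this is where
  the ground field has to be algebraically closed.\<close>

lemma linear_factors_annihilate:
  fixes a :: "nat \<Rightarrow> 'k::alg_closed_field mpoly"
  assumes "finite I" "homogeneous_module x y D"
    and "\<And>j. j \<in> I \<Longrightarrow> x * a j - y * (\<Sum>k\<in>I. Const (N j k) * a k) \<in> D"
  shows "\<exists>es. \<forall>j\<in>I. (\<Prod>e\<leftarrow>es. x - Const e * y) * a j \<in> D"
  using assms
proof (induction I arbitrary: D N rule: finite_remove_induct)
  case empty
  then show ?case by auto
next
  case (remove I)
  note D = homogeneous_moduleD[OF remove.prems(1)]
  obtain e v j0 where j0: "j0 \<in> I" "v j0 \<noteq> 0"
    and ev: "\<And>k. k \<in> I \<Longrightarrow> (\<Sum>j\<in>I. v j * N j k) = e * v k"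
    using left_eigenvector_exists[OF remove.hyps(1,2), of N] by metis
  define av where "av = (\<Sum>j\<in>I. Const (v j) * a j)"
  have split: "av = Const (v j0) * a j0 + (\<Sum>k\<in>I - {j0}. Const (v k) * a k)"
    unfolding av_def by (rule sum.remove[OF remove.hyps(1) j0(1)])
  define D' where "D' = {u. (x - Const e * y) * u \<in> D}"
  have D': "homogeneous_module x y D'"
    unfolding homogeneous_module_def D'_def
  proof (intro conjI ballI allI; (unfold mem_Collect_eq)?)
    fix u assume "(x - Const e * y) * u \<in> D"
    then show "(x - Const e * y) * (x * u) \<in> D" "(x - Const e * y) * (y * u) \<in> D"
      "(x - Const e * y) * (Const c * u) \<in> D" for c
      by (metis D(3) mult.left_commute, metis D(4) mult.left_commute, metis D(5) mult.left_commute)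
  qed (auto simp: D distrib_left)
  have sub: "D \<subseteq> D'"
    unfolding D'_def using D(8) by blast
  have "(x - Const e * y) * av
      = (\<Sum>j\<in>I. Const (v j) * (x * a j - y * (\<Sum>k\<in>I. Const (N j k) * a k)))"
  proof -
    have "(\<Sum>j\<in>I. \<Sum>k\<in>I. Const (v j) * (Const (N j k) * a k)) = (\<Sum>k\<in>I. Const (\<Sum>j\<in>I. v j * N j k) * a k)"
      by (subst sum.swap) (simp add: Const_sum Const_mult sum_distrib_right mult.assoc)
    also have "\<dots> = Const e * av"
      by (simp add: ev av_def Const_mult sum_distrib_left mult.assoc)
    finally have *: "Const e * av = (\<Sum>j\<in>I. \<Sum>k\<in>I. Const (v j) * (Const (N j k) * a k))" ..
    have "y * (Const e * av) = (\<Sum>j\<in>I. Const (v j) * (y * (\<Sum>k\<in>I. Const (N j k) * a k)))"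
      unfolding * by (simp add: sum_distrib_left mult.left_commute)
    moreover have "x * av = (\<Sum>j\<in>I. Const (v j) * (x * a j))"
      by (simp add: av_def sum_distrib_left mult.left_commute)
    moreover have "(x - Const e * y) * av = x * av - y * (Const e * av)"
      by (simp add: algebra_simps)
    ultimately show ?thesis
      by (simp add: right_diff_distrib sum_subtractf)
  qed
  then have av: "av \<in> D'"
    unfolding D'_def using remove.prems(2)
    by (auto intro!: homogeneous_module_sum[OF remove.prems(1)] D(5))
  \<comment> \<open>modulo the eigenvector \<open>av\<close>, eliminate \<open>a j0\<close> and pass to the quotient matrix\<close>
  define N' where "N' j k = N j k - N j j0 * v k / v j0" for j k
  have rel: "x * a j - y * (\<Sum>k\<in>I - {j0}. Const (N' j k) * a k) \<in> D'" if j: "j \<in> I - {j0}" for j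
  proof -
    have "(\<Sum>k\<in>I - {j0}. Const (N' j k) * a k)
      = (\<Sum>k\<in>I - {j0}. Const (N j k) * a k) - Const (N j j0 / v j0) * (\<Sum>k\<in>I - {j0}. Const (v k) * a k)"
      by (simp add: N'_def Const_diff left_diff_distrib sum_subtractf sum_distrib_left
          mult.assoc[symmetric] flip: Const_mult)
    also have "(\<Sum>k\<in>I - {j0}. Const (N j k) * a k)
      = (\<Sum>k\<in>I. Const (N j k) * a k) - Const (N j j0) * a j0"
      by (simp add: sum.remove[OF remove.hyps(1) j0(1)])
    also have "(\<Sum>k\<in>I - {j0}. Const (v k) * a k) = av - Const (v j0) * a j0"
      by (simp add: split)
    also have "Const (N j j0 / v j0) * (av - Const (v j0) * a j0)
       = Const (N j j0 / v j0) * av - Const (N j j0) * a j0"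
      using j0 by (simp add: right_diff_distrib mult.assoc[symmetric] flip: Const_mult)
    finally have *: "(\<Sum>k\<in>I - {j0}. Const (N' j k) * a k)
      = (\<Sum>k\<in>I. Const (N j k) * a k) - Const (N j j0 / v j0) * av"
      by simp
    have "x * a j - y * (\<Sum>k\<in>I. Const (N j k) * a k) \<in> D'"
      using remove.prems(2)[of j] j sub by auto
    then have "(x * a j - y * (\<Sum>k\<in>I. Const (N j k) * a k)) + y * (Const (N j j0 / v j0) * av) \<in> D'"
      by (intro homogeneous_moduleD(2,4,5)[OF D'] av)
    moreover have "x * a j - y * (\<Sum>k\<in>I - {j0}. Const (N' j k) * a k)
      = (x * a j - y * (\<Sum>k\<in>I. Const (N j k) * a k)) + y * (Const (N j j0 / v j0) * av)"
      unfolding * by (simp add: algebra_simps)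
    ultimately show ?thesis
      by (simp only:)
  qed
  obtain es where es: "\<And>j. j \<in> I - {j0} \<Longrightarrow> (\<Prod>e\<leftarrow>es. x - Const e * y) * a j \<in> D'"
    using remove.IH[OF j0(1) D' rel] by blast
  let ?\<Lambda> = "\<Prod>e\<leftarrow>es. x - Const e * y"
  have "a j0 = Const (1 / v j0) * (av - (\<Sum>k\<in>I - {j0}. Const (v k) * a k))"
    using j0 by (simp add: split mult.assoc[symmetric] flip: Const_mult)
  then have "?\<Lambda> * a j0
    = Const (1 / v j0) * (?\<Lambda> * av - (\<Sum>k\<in>I - {j0}. Const (v k) * (?\<Lambda> * a k)))"
    by (simp add: sum_distrib_left right_diff_distrib mult.left_commute)
  moreover have "\<dots> \<in> D'"
    by (intro homogeneous_moduleD(5,7)[OF D'] homogeneous_module_prod[OF D'] av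
        homogeneous_module_sum[OF D'] es)
  ultimately have "?\<Lambda> * a j \<in> D'" if "j \<in> I" for j
    using es that by (cases "j = j0") auto
  then show ?case
    by (intro exI[of _ "e # es"]) (simp add: D'_def mult.assoc)
qed

section \<open>Ideals generated by independent linear forms\<close>

definition linear_form :: "nat \<Rightarrow> (nat \<Rightarrow> 'k::comm_ring_1) \<Rightarrow> 'k mpoly" where
  "linear_form n \<alpha> = (\<Sum>i<n. Const (\<alpha> i) * Var (Vw i))"

lemma subst_linear_form: "subst \<sigma> (linear_form n \<alpha>) = (\<Sum>i<n. Const (\<alpha> i) * \<sigma> (Vw i))"
  by (simp add: linear_form_def)

lemma subst_linear_form_id [simp]:
  "(\<And>i. \<sigma> (Vw i) = Var (Vw i)) \<Longrightarrow> subst \<sigma> (linear_form n \<alpha>) = linear_form n \<alpha>"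
  by (simp add: linear_form_def)

lemma linear_form_add: "linear_form n \<alpha> + linear_form n \<beta> = linear_form n (\<lambda>i. \<alpha> i + \<beta> i)"
  by (simp add: linear_form_def Const_add sum.distrib algebra_simps)

lemma linear_form_scale: "Const c * linear_form n \<alpha> = linear_form n (\<lambda>i. c * \<alpha> i)"
  by (simp add: linear_form_def Const_mult sum_distrib_left mult.assoc)

lemma linear_form_sum: "(\<Sum>j\<in>K. linear_form n (\<alpha> j)) = linear_form n (\<lambda>i. \<Sum>j\<in>K. \<alpha> j i)"
  unfolding linear_form_def by (subst sum.swap) (simp add: Const_sum sum_distrib_right)

lemma linear_form_diff: "linear_form n \<alpha> - linear_form n \<beta> = linear_form n (\<lambda>i. \<alpha> i - \<beta> i)"
  by (simp add: linear_form_def Const_diff sum_subtractf algebra_simps)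

lemma linear_form_eq_0D:
  assumes "linear_form n \<alpha> = (0 :: 'k::comm_ring_1 mpoly)" "i < n"
  shows "\<alpha> i = 0"
proof -
  have "subst (\<lambda>v. if v = Vw i then 1 else 0) (linear_form n \<alpha>) = Const (\<alpha> i)"
    using assms(2) by (simp add: subst_linear_form if_distrib cong: if_cong)
  then show ?thesis
    using assms(1) by simp
qed

abbreviation column_form :: "nat \<Rightarrow> (nat \<Rightarrow> nat \<Rightarrow> 'k::comm_ring_1) \<Rightarrow> nat \<Rightarrow> 'k mpoly" where
  "column_form n A j \<equiv> linear_form n (\<lambda>i. A i j)"

text \<open>The projection of the span of the \<open>w\<^sub>i\<close> onto the span of the non-pivot variables, along the
  forms given by the columns of \<open>A\<close>; its extension to polynomials has the ideal of these forms as
  kernel.\<close>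

definition eliminate :: "nat \<Rightarrow> nat \<Rightarrow> (nat \<Rightarrow> nat \<Rightarrow> 'k::comm_ring_1) \<Rightarrow> (nat \<Rightarrow> nat \<Rightarrow> 'k) \<Rightarrow> var \<Rightarrow> 'k mpoly" where
  "eliminate n m A t v = (case v of
     Vw i \<Rightarrow> if i < n then Var (Vw i) - (\<Sum>j<m. Const (t j i) * column_form n A j) else Var v
   | _ \<Rightarrow> Var v)"

lemma eliminate_not_Vw [simp]: "v \<notin> range Vw \<Longrightarrow> eliminate n m A t v = Var v"
  by (auto simp: eliminate_def split: var.splits)

lemma subst_eliminate_linear_form:
  "subst (eliminate n m A t) (linear_form n \<alpha>)
    = linear_form n \<alpha> - (\<Sum>k<m. Const (\<Sum>i<n. t k i * \<alpha> i) * column_form n A k)"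
proof -
  have "(\<Sum>i<n. Const (\<alpha> i) * (\<Sum>k<m. Const (t k i) * column_form n A k))
    = (\<Sum>k<m. Const (\<Sum>i<n. t k i * \<alpha> i) * column_form n A k)"
    unfolding sum_distrib_left
    by (subst sum.swap, intro sum.cong refl) (simp only: Const_sum Const_mult sum_distrib_right sum_distrib_left mult_ac)
  then show ?thesis
    by (simp add: subst_linear_form eliminate_def right_diff_distrib sum_subtractf linear_form_def)
qed

context
  fixes n m :: nat and A t :: "nat \<Rightarrow> nat \<Rightarrow> 'k::field" and I :: "nat set"
  assumes piv: "pivot_inverse n m A t I"
begin

lemma eliminate_column: "j < m \<Longrightarrow> subst (eliminate n m A t) (column_form n A j) = 0"
proof -
  assume "j < m"
  then have "(\<Sum>k<m. Const (\<Sum>i<n. t k i * A i j) * column_form n A k)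
    = (\<Sum>k<m. if k = j then column_form n A k else 0)"
    using piv by (intro sum.cong refl) (simp add: pivot_inverse_def)
  with \<open>j < m\<close> show ?thesis
    by (simp add: subst_eliminate_linear_form)
qed

lemma diff_eliminate_mem: "p - subst (eliminate n m A t) p \<in> lin_ideal (column_form n A) m"
proof (rule diff_subst_mem[OF ideal_set_lin_ideal])
  fix v
  have "(\<Sum>j<m. Const (t j i) * column_form n A j) \<in> lin_ideal (column_form n A) m" for i
    by (rule lin_idealI[of _ _ "\<lambda>j. Const (t j i)"]) (simp add: mult.commute)
  then show "Var v - eliminate n m A t v \<in> lin_ideal (column_form n A) m"
    by (auto simp: eliminate_def ideal_setD[OF ideal_set_lin_ideal] split: var.splits)
qed

lemma eliminate_eq_0_iff: "subst (eliminate n m A t) p = 0 \<longleftrightarrow> p \<in> lin_ideal (column_form n A) m"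
proof
  assume "subst (eliminate n m A t) p = 0"
  then show "p \<in> lin_ideal (column_form n A) m"
    using diff_eliminate_mem[of p] by simp
next
  assume "p \<in> lin_ideal (column_form n A) m"
  then show "subst (eliminate n m A t) p = 0"
    by (elim lin_idealE) (simp add: eliminate_column)
qed

lemma eliminate_nonpivot: "i \<notin> I \<Longrightarrow> eliminate n m A t (Vw i) = Var (Vw i)"
  using piv by (simp add: eliminate_def pivot_inverse_def)

lemma eliminate_in_nonpivots:
  assumes "i < n"
  obtains c where "eliminate n m A t (Vw i) = (\<Sum>i'\<in>{..<n} - I. Const (c i') * Var (Vw i'))"
proof -
  define c where "c i' = (if i' = i then 1 else 0) - (\<Sum>j<m. A i' j * t j i)" for i'
  have "(\<Sum>j<m. Const (t j i) * column_form n A j) = linear_form n (\<lambda>i'. \<Sum>j<m. A i' j * t j i)"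
    by (simp add: linear_form_scale linear_form_sum mult.commute)
  moreover have "Var (Vw i) = linear_form n (\<lambda>i'. if i' = i then 1 else (0 :: 'k))"
    using assms by (simp add: linear_form_def if_distrib if_distribR cong: if_cong)
  moreover have "eliminate n m A t (Vw i) = Var (Vw i) - (\<Sum>j<m. Const (t j i) * column_form n A j)"
    using assms by (simp add: eliminate_def)
  ultimately have "eliminate n m A t (Vw i) = linear_form n c"
    by (simp only: linear_form_diff c_def[abs_def])
  also have "\<dots> = (\<Sum>i'\<in>{..<n} - I. Const (c i') * Var (Vw i'))"
    unfolding linear_form_def using piv assms
    by (intro sum.mono_neutral_right) (auto simp: c_def pivot_inverse_def)
  finally show ?thesis
    by (rule that)
qed

end

text \<open>Independent linear forms are a regular sequence, as each quotient by some of them is again a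
  polynomial ring; hence all their syzygies are Koszul.\<close>

lemma koszul_syzygies:
  fixes A :: "nat \<Rightarrow> nat \<Rightarrow> 'k::field"
  assumes "independent_columns n m A" "(\<Sum>j<m. column_form n A j * c j) = 0"
  shows "\<exists>E. (\<forall>j k. E j k = - E k j) \<and> (\<forall>j. E j j = 0) \<and> (\<forall>j<m. c j = (\<Sum>k<m. E j k * column_form n A k))"
  using assms
proof (induction m arbitrary: c)
  case 0
  show ?case
    by (rule exI[of _ "\<lambda>_ _. 0"]) auto
next
  case (Suc m)
  let ?a = "column_form n A"
  have ind: "independent_columns n m A"
    by (rule independent_columns_Suc[OF Suc.prems(1)])
  then obtain t I where piv: "pivot_inverse n m A t I"
    using pivot_inverse_exists by blast
  let ?\<pi> = "subst (eliminate n m A t)"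
  have "?\<pi> (?a m) \<noteq> 0"
  proof
    assume "?\<pi> (?a m) = 0"
    then have "linear_form n (\<lambda>i. A i m - (\<Sum>k<m. (\<Sum>i<n. t k i * A i m) * A i k)) = 0"
      by (simp add: subst_eliminate_linear_form linear_form_scale linear_form_sum linear_form_diff)
    then have "\<forall>i<n. (\<Sum>j<Suc m. A i j * ((\<lambda>k. - (\<Sum>i<n. t k i * A i m))(m := 1)) j) = 0"
      by (auto dest!: linear_form_eq_0D simp: sum_negf mult.commute)
    then have "\<forall>j<Suc m. ((\<lambda>k. - (\<Sum>i<n. t k i * A i m))(m := 1)) j = 0"
      using Suc.prems(1) unfolding independent_columns_def by blast
    then show False
      by auto
  qed
  moreover have "?\<pi> (?a m) * ?\<pi> (c m) = 0"
  proof -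
    have "?\<pi> (\<Sum>j<Suc m. ?a j * c j) = ?\<pi> 0"
      by (simp only: Suc.prems(2))
    then show ?thesis
      by (simp add: eliminate_column[OF piv])
  qed
  ultimately have "?\<pi> (c m) = 0"
    by simp
  then obtain d where d: "c m = (\<Sum>k<m. ?a k * d k)"
    unfolding eliminate_eq_0_iff[OF piv] by (elim lin_idealE)
  have "(\<Sum>j<m. ?a j * (c j + ?a m * d j)) = (\<Sum>j<m. ?a j * c j) + ?a m * (\<Sum>j<m. ?a j * d j)"
    by (simp add: distrib_left sum.distrib sum_distrib_left mult.left_commute)
  also have "\<dots> = 0"
    using Suc.prems(2) by (simp add: d)
  finally obtain E where E: "\<And>j k. E j k = - E k j" "\<And>j. E j j = 0"
    "\<And>j. j < m \<Longrightarrow> c j + ?a m * d j = (\<Sum>k<m. E j k * ?a k)"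
    using Suc.IH[OF ind, of "\<lambda>j. c j + ?a m * d j"] by blast
  \<comment> \<open>add the Koszul relations that involve the last form\<close>
  define E' where "E' j k = (if j = m then (if k = m then 0 else d k) else if k = m then - d j else E j k)" for j k
  show ?case
  proof (intro exI[of _ E'] conjI allI impI)
    show "E' j k = - E' k j" for j k
      using E(1)[of j k] by (auto simp: E'_def)
    show "E' j j = 0" for j
      using E(2) by (simp add: E'_def)
    fix j assume "j < Suc m"
    then show "c j = (\<Sum>k<Suc m. E' j k * ?a k)"
      using d E(3)[of j] by (cases "j = m") (auto simp: E'_def algebra_simps)
  qed
qed

lemma alternating_form_eq_0:
  fixes l :: "nat \<Rightarrow> 'a::comm_ring_1"
  assumes "\<And>j k. E j k = - E k j" "\<And>j. E j j = 0"
  shows "(\<Sum>j<m. \<Sum>k<m. l j * E j k * l k) = 0"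
proof (induction m)
  case (Suc m)
  have "(\<Sum>k<m. l m * E m k * l k) = - (\<Sum>j<m. l j * E j m * l m)"
    unfolding sum_negf[symmetric]
  proof (rule sum.cong[OF refl])
    fix k
    show "l m * E m k * l k = - (l k * E k m * l m)"
      using assms(1)[of m k] by (simp add: algebra_simps)
  qed
  with Suc show ?case
    by (simp add: sum.distrib assms(2))
qed simp

section \<open>Torsion modulo the forms of a matrix pencil\<close>

abbreviation const_part :: "var \<Rightarrow> var \<Rightarrow> 'k::comm_ring_1 mpoly \<Rightarrow> 'k mpoly" where
  "const_part u v \<equiv> subst (Var(u := 0, v := 0))"

lemma const_part_idem [simp]: "const_part u v (const_part u v p) = const_part u v p"
  unfolding subst_subst by (rule arg_cong[of _ _ "\<lambda>\<sigma>. subst \<sigma> p"]) auto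

lemma const_part_decomp:
  fixes p :: "'k::comm_ring_1 mpoly"
  obtains p1 p2 where "p = const_part u v p + Var u * p1 + Var v * p2"
proof -
  let ?D = "{p :: 'k mpoly. \<exists>p1 p2. p = Var u * p1 + Var v * p2}"
  have "p - const_part u v p \<in> ?D"
  proof (rule diff_subst_mem)
    show "ideal_set ?D"
      unfolding ideal_set_def
    proof (intro conjI ballI allI)
      show "0 \<in> ?D"
        by (auto intro!: exI[of _ 0])
    next
      fix p q assume "p \<in> ?D" "q \<in> ?D"
      then obtain p1 p2 q1 q2 where "p = Var u * p1 + Var v * p2" "q = Var u * q1 + Var v * q2"
        by blast
      then have "p + q = Var u * (p1 + q1) + Var v * (p2 + q2)"
        by (simp add: algebra_simps)
      then show "p + q \<in> ?D"
        by blast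
    next
      fix p r assume "p \<in> ?D"
      then obtain p1 p2 where "p = Var u * p1 + Var v * p2"
        by blast
      then have "r * p = Var u * (r * p1) + Var v * (r * p2)"
        by (simp add: algebra_simps)
      then show "r * p \<in> ?D"
        by blast
    qed
    have "Var u * 1 + Var v * 0 \<in> ?D" "Var u * 0 + Var v * 1 \<in> ?D" "Var u * 0 + Var v * 0 \<in> ?D"
      by blast+
    then show "Var w - (Var(u := 0, v := 0)) w \<in> ?D" for w
      by auto
  qed
  then show ?thesis
    using that by (auto simp: algebra_simps)
qed

text \<open>Comparison of the parts of degree one in \<open>u, v\<close>.\<close>

lemma const_part_lowest_terms:
  fixes p q :: "'k::field mpoly"
  assumes "u \<noteq> v" "Var u * p + Var v * q = Var u * r + Var v * s"
    "const_part u v p = p" "const_part u v r = 0"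
  shows "p = 0"
proof -
  let ?h = "subst (Var(v := 0))"
  have h: "?h (const_part u v p') = const_part u v p'" "const_part u v (?h p') = const_part u v p'" for p'
    unfolding subst_subst by (rule arg_cong[of _ _ "\<lambda>\<sigma>. subst \<sigma> p'"], auto)+
  have "?h (Var u * p + Var v * q) = ?h (Var u * r + Var v * s)"
    by (simp only: assms(2))
  then have "?h p = ?h r"
    using assms(1) by simp
  then have "const_part u v p = const_part u v r"
    by (metis h(2))
  then show ?thesis
    using assms(3,4) by simp
qed

text \<open>Elements of positive degree in \<open>u, v\<close> have no \<open>(u - e v)\<close>-torsion modulo the forms
  \<open>u a\<^sub>j + v b\<^sub>j\<close>, as soon as the \<open>b\<^sub>j + e a\<^sub>j\<close> are independent.  Setting \<open>u = e v\<close> in a relation makes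
  its coefficients a syzygy of these forms.  The coefficients are divisible by \<open>v\<close>, and
  \<open>v (b\<^sub>j + e a\<^sub>j)\<close> is congruent to the \<open>j\<close>-th form of the pencil modulo \<open>u - e v\<close>; so the Koszul
  relations that produce them can be replaced by Koszul relations between the forms of the pencil,
  which contribute nothing.\<close>

lemma pencil_torsion_free:
  fixes A B :: "nat \<Rightarrow> nat \<Rightarrow> 'k::field" and e :: 'k
  assumes uv: "u \<noteq> v" "u \<notin> range Vw" "v \<notin> range Vw"
    and l: "\<And>j. l j = Var u * column_form n A j + Var v * column_form n B j"
    and ind: "independent_columns n m (\<lambda>i j. B i j + e * A i j)"
    and s: "const_part u v s = 0" "(Var u - Const e * Var v) * s \<in> lin_ideal l m"
  shows "s \<in> lin_ideal l m"
proof -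
  let ?\<mu> = "Var u - Const e * Var v"
  let ?o = "const_part u v"
  let ?\<xi> = "subst (Var(u := Const e * Var v))"
  let ?a = "column_form n A" and ?b = "column_form n B"
  let ?\<beta> = "column_form n (\<lambda>i j. B i j + e * A i j)"
  have w [simp]: "Vw i \<noteq> u" "Vw i \<noteq> v" for i
    using uv(2,3) by auto
  have \<beta>: "?\<beta> j = ?b j + Const e * ?a j" for j
    by (simp add: linear_form_scale linear_form_add)
  have l\<beta>: "l j = ?\<mu> * ?a j + Var v * ?\<beta> j" for j
    by (simp add: l \<beta> algebra_simps)
  obtain c where c: "?\<mu> * s = (\<Sum>j<m. l j * c j)"
    using s(2) by (elim lin_idealE)
  \<comment> \<open>the constant parts of the coefficients contribute nothing, as \<open>s\<close> has no terms of degree 0\<close>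
  define d where "d j = c j - ?o (c j)" for j
  have od: "?o (d j) = 0" for j
    by (simp add: d_def)
  have split: "Var u * (\<Sum>j<m. ?a j * ?o (c j)) + Var v * (\<Sum>j<m. ?b j * ?o (c j)) = (\<Sum>j<m. l j * ?o (c j))"
    by (simp add: l distrib_right sum.distrib sum_distrib_left mult.assoc)
  have rest: "(\<Sum>j<m. l j * ?o (c j)) = ?\<mu> * s - (\<Sum>j<m. l j * d j)"
    by (simp add: d_def right_diff_distrib sum_subtractf c)
  note split
  also note rest
  also have "?\<mu> * s - (\<Sum>j<m. l j * d j)
    = Var u * (s - (\<Sum>j<m. ?a j * d j)) + Var v * (- Const e * s - (\<Sum>j<m. ?b j * d j))"
    by (simp add: l distrib_right sum.distrib sum_distrib_left algebra_simps)
  finally have eq: "Var u * (\<Sum>j<m. ?a j * ?o (c j)) + Var v * (\<Sum>j<m. ?b j * ?o (c j))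
    = Var u * (s - (\<Sum>j<m. ?a j * d j)) + Var v * (- Const e * s - (\<Sum>j<m. ?b j * d j))" .
  have "(\<Sum>j<m. ?a j * ?o (c j)) = 0"
    by (rule const_part_lowest_terms[OF uv(1) eq]) (simp_all add: s od)
  moreover have "(\<Sum>j<m. ?b j * ?o (c j)) = 0"
  proof (rule const_part_lowest_terms[of v u])
    show "Var v * (\<Sum>j<m. ?b j * ?o (c j)) + Var u * (\<Sum>j<m. ?a j * ?o (c j))
      = Var v * (- Const e * s - (\<Sum>j<m. ?b j * d j)) + Var u * (s - (\<Sum>j<m. ?a j * d j))"
      using eq by (simp only: add.commute)
    have swap: "const_part v u = ?o"
      using uv(1) by (simp add: fun_upd_twist)
    show "const_part v u (\<Sum>j<m. ?b j * ?o (c j)) = (\<Sum>j<m. ?b j * ?o (c j))"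
      "const_part v u (- Const e * s - (\<Sum>j<m. ?b j * d j)) = 0"
      unfolding swap by (simp_all add: s od)
  qed (use uv(1) in auto)
  ultimately have sd: "?\<mu> * s = (\<Sum>j<m. l j * d j)"
    using split rest by simp
  have "\<exists>p q. d j = ?\<mu> * p + Var v * ?\<xi> q" for j
  proof -
    obtain p q where "d j = Var u * p + Var v * q"
      using const_part_decomp[of "d j" u v] by (metis od add_0)
    moreover obtain r where "Const e * p + q = ?\<xi> (Const e * p + q) + ?\<mu> * r"
      using factor_theorem[of u "Const e * Var v" "Const e * p + q"]
      by (elim dvdE) (metis add.commute diff_add_cancel)
    moreover have "Var u * p + Var v * q = ?\<mu> * p + Var v * (Const e * p + q)"
      by (simp add: algebra_simps)
    ultimately have "d j = ?\<mu> * p + Var v * (?\<xi> (Const e * p + q) + ?\<mu> * r)"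
      by (simp only:)
    also have "\<dots> = ?\<mu> * (p + Var v * r) + Var v * ?\<xi> (Const e * p + q)"
      by (simp only: distrib_left mult.left_commute add_ac)
    finally have "d j = ?\<mu> * (p + Var v * r) + Var v * ?\<xi> (Const e * p + q)" .
    then show ?thesis
      by blast
  qed
  then obtain p q where pq: "\<And>j. d j = ?\<mu> * p j + Var v * ?\<xi> (q j)"
    by metis
  have \<xi>\<xi>: "?\<xi> (?\<xi> r) = ?\<xi> r" for r
    unfolding subst_subst using uv(1) by (intro arg_cong[of _ _ "\<lambda>\<sigma>. subst \<sigma> r"]) auto
  have "?\<xi> (?\<mu> * s) = (\<Sum>j<m. (Var v * ?\<beta> j) * (Var v * ?\<xi> (q j)))"
    unfolding sd using uv(1) by (simp add: l\<beta> pq \<xi>\<xi>)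
  then have "Var v * (Var v * (\<Sum>j<m. ?\<beta> j * ?\<xi> (q j))) = 0"
    using uv(1) by (simp add: sum_distrib_left algebra_simps)
  then have "(\<Sum>j<m. ?\<beta> j * ?\<xi> (q j)) = 0"
    by simp
  from koszul_syzygies[OF ind this] obtain E where E: "\<And>j k. E j k = - E k j" "\<And>j. E j j = 0"
    "\<And>j. j < m \<Longrightarrow> ?\<xi> (q j) = (\<Sum>k<m. E j k * ?\<beta> k)"
    by blast
  have "(\<Sum>j<m. l j * (Var v * ?\<xi> (q j))) = (\<Sum>j<m. \<Sum>k<m. l j * E j k * (Var v * ?\<beta> k))"
    by (rule sum.cong[OF refl]) (simp add: E(3) sum_distrib_left algebra_simps)
  also have "\<dots> = (\<Sum>j<m. \<Sum>k<m. l j * E j k * l k) - ?\<mu> * (\<Sum>j<m. l j * (\<Sum>k<m. E j k * ?a k))"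
  proof -
    have "Var v * ?\<beta> k = l k - ?\<mu> * ?a k" for k
      by (simp add: l\<beta>)
    then have "(\<Sum>j<m. \<Sum>k<m. l j * E j k * (Var v * ?\<beta> k))
      = (\<Sum>j<m. \<Sum>k<m. l j * E j k * l k - ?\<mu> * (l j * (E j k * ?a k)))"
      by (simp only: right_diff_distrib mult_ac)
    then show ?thesis
      by (simp only: sum_subtractf sum_distrib_left)
  qed
  also have "(\<Sum>j<m. \<Sum>k<m. l j * E j k * l k) = 0"
    by (rule alternating_form_eq_0[OF E(1,2)])
  finally have "(\<Sum>j<m. l j * (Var v * ?\<xi> (q j))) = - (?\<mu> * (\<Sum>j<m. l j * (\<Sum>k<m. E j k * ?a k)))"
    by (simp only: diff_0)
  moreover have "?\<mu> * s = ?\<mu> * (\<Sum>j<m. l j * p j) + (\<Sum>j<m. l j * (Var v * ?\<xi> (q j)))"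
  proof -
    have "l j * d j = ?\<mu> * (l j * p j) + l j * (Var v * ?\<xi> (q j))" for j
      unfolding pq by (simp only: distrib_left mult.left_commute)
    then show ?thesis
      unfolding sd by (simp only: sum.distrib sum_distrib_left)
  qed
  ultimately have "?\<mu> * s = ?\<mu> * (\<Sum>j<m. l j * (p j - (\<Sum>k<m. E j k * ?a k)))"
    by (simp add: right_diff_distrib sum_subtractf)
  moreover have "?\<mu> \<noteq> 0"
  proof
    assume "?\<mu> = 0"
    then have "subst (Var(v := 0)) ?\<mu> = 0"
      by simp
    then show False
      using uv(1) by simp
  qed
  ultimately have "s = (\<Sum>j<m. l j * (p j - (\<Sum>k<m. E j k * ?a k)))"
    by simp
  then show ?thesis
    by (rule lin_idealI)
qed

text \<open>Setting \<open>v = 0\<close> and eliminating the \<open>a\<^sub>j\<close> shows that \<open>v\<close> divides \<open>p\<close>.  The quotient satisfies the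
  same hypotheses, because \<open>v\<close>-torsion can be cancelled; so every power of \<open>v\<close> divides \<open>p\<close>.\<close>

lemma reduced_in_pencil_ideal_eq_0:
  fixes A B :: "nat \<Rightarrow> nat \<Rightarrow> 'k::field"
  assumes uv: "u \<noteq> v" "u \<notin> range Vw" "v \<notin> range Vw"
    and l: "\<And>j. l j = Var u * column_form n A j + Var v * column_form n B j"
    and ind: "independent_columns n m A"
    and piv: "pivot_inverse n m A t I"
    and p: "subst (eliminate n m A t) p = p" "Var u * p \<in> lin_ideal l m"
  shows "p = 0"
proof (rule eq_0_if_all_powers_dvd[of v])
  fix N
  let ?\<pi> = "subst (eliminate n m A t)" and ?h = "subst (Var(v := 0))"
  have w [simp]: "Vw i \<noteq> u" "Vw i \<noteq> v" for i
    using uv(2,3) by auto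
  have comm: "?h (?\<pi> q) = ?\<pi> (?h q)" for q
    unfolding subst_subst
  proof (rule arg_cong[of _ _ "\<lambda>\<sigma>. subst \<sigma> q"], rule ext)
    fix x
    show "?h (eliminate n m A t x) = ?\<pi> ((Var(v := 0)) x)"
      using uv(3) by (cases x) (auto simp: eliminate_def)
  qed
  show "Var v ^ N dvd p"
    using p
  proof (induction N arbitrary: p)
    case (Suc N)
    obtain c where c: "Var u * p = (\<Sum>j<m. l j * c j)"
      using Suc.prems(2) by (elim lin_idealE)
    have "?h (Var u * p) = Var u * (\<Sum>j<m. column_form n A j * ?h (c j))"
      unfolding c using uv(1) by (simp add: l sum_distrib_left mult.assoc)
    then have "?h p = (\<Sum>j<m. column_form n A j * ?h (c j))"
      using uv(1) by simp
    then have "?\<pi> (?h p) = 0"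
      unfolding eliminate_eq_0_iff[OF piv] by (rule lin_idealI)
    then have "?h p = 0"
      using comm[of p] Suc.prems(1) by simp
    then obtain p' where p': "p = Var v * p'"
      using factor_theorem[of v 0 p] by (auto elim: dvdE)
    have "Var v * ?\<pi> p' = Var v * p'"
      using Suc.prems(1) uv(3) by (simp add: p')
    then have 1: "?\<pi> p' = p'"
      by simp
    have "(Var v - Const 0 * Var u) * (Var u * p') \<in> lin_ideal l m"
      using Suc.prems(2) by (simp add: p' mult.left_commute)
    with uv(1) have "Var u * p' \<in> lin_ideal l m"
      by (intro pencil_torsion_free[of v u l n B A m 0 "Var u * p'", OF _ uv(3,2)])
        (simp_all add: l add.commute ind)
    from Suc.IH[OF 1 this] show ?case
      by (simp add: p')
  qed simp
qed

section \<open>The saturation of the pencil ideal\<close>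

abbreviation retract :: "var set \<Rightarrow> 'k::comm_ring_1 mpoly \<Rightarrow> 'k mpoly" where
  "retract V \<equiv> subst (\<lambda>v. if v \<in> V then Var v else 0)"

lemma retract_in_carrier [simp]: "retract V p \<in> carrier (mpoly_ring V)"
  by (rule subst_in_carrier[OF carrier_UNIV]) auto

lemma retract_id: "p \<in> carrier (mpoly_ring V) \<Longrightarrow> retract V p = p"
  by (rule subst_id_carrier) auto

lemma factor_theorem_in_carrier:
  fixes p :: "'k::comm_ring_1 mpoly"
  assumes "p \<in> carrier (mpoly_ring V)" "q \<in> carrier (mpoly_ring V)" "v \<in> V"
  obtains r where "r \<in> carrier (mpoly_ring V)" "p = subst (Var(v := q)) p + (Var v - q) * r"
proof -
  obtain r where r: "p = subst (Var(v := q)) p + (Var v - q) * r"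
    using factor_theorem[of v q p] by (elim dvdE) (metis add.commute diff_add_cancel)
  have c: "subst (Var(v := q)) p \<in> carrier (mpoly_ring V)"
    using assms by (intro subst_in_carrier[OF assms(1)]) auto
  have "retract V p = retract V (subst (Var(v := q)) p + (Var v - q) * r)"
    using r by (rule arg_cong)
  also have "\<dots> = subst (Var(v := q)) p + (Var v - q) * retract V r"
    unfolding subst_add subst_mult subst_diff retract_id[OF c] retract_id[OF assms(2)]
    using assms(3) by simp
  finally show ?thesis
    using that[of "retract V r"] retract_id[OF assms(1)] by simp
qed

locale good_pencil =
  fixes n m :: nat and A B :: "nat \<Rightarrow> nat \<Rightarrow> 'k::alg_closed_field"
  assumes independent_at_infinity: "independent_columns n m A"
    and independent_at: "\<And>e. independent_columns n m (\<lambda>i j. B i j + e * A i j)"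
begin

abbreviation a :: "nat \<Rightarrow> 'k mpoly" where "a \<equiv> column_form n A"
abbreviation b :: "nat \<Rightarrow> 'k mpoly" where "b \<equiv> column_form n B"
abbreviation x :: "'k mpoly" where "x \<equiv> Var Vx"
abbreviation y :: "'k mpoly" where "y \<equiv> Var Vy"
abbreviation low :: "'k mpoly \<Rightarrow> 'k mpoly" where "low \<equiv> const_part Vx Vy"

definition l :: "nat \<Rightarrow> 'k mpoly" where
  "l j = x * a j + y * b j"

definition L :: "'k mpoly set" where
  "L = lin_ideal l m"

definition J :: "'k mpoly set" where
  "J = {s. x * s \<in> L \<and> y * s \<in> L}"

definition point_form :: "'k \<Rightarrow> 'k mpoly" where
  "point_form e = x - Const e * y"

lemma L_ideal: "ideal_set L"
  by (simp add: L_def)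

lemma J_ideal: "ideal_set J"
  unfolding ideal_set_def J_def
  using ideal_setD[OF L_ideal] by (auto simp: distrib_left mult.left_commute)

lemma L_subset_J: "L \<subseteq> J"
  unfolding J_def using ideal_setD[OF L_ideal] by auto

lemma l_in_L: "j < m \<Longrightarrow> l j \<in> L"
  unfolding L_def by (rule gen_in_lin_ideal)

lemma cancel_point_form_L: "low s = 0 \<Longrightarrow> point_form e * s \<in> L \<Longrightarrow> s \<in> L"
  unfolding L_def point_form_def
  by (rule pencil_torsion_free[OF _ _ _ _ independent_at]) (auto simp: l_def)

lemma cancel_point_form_J:
  assumes "point_form e * s \<in> J"
  shows "s \<in> J"
proof -
  have "point_form e * (x * s) \<in> L" "point_form e * (y * s) \<in> L"
    using assms by (simp_all add: J_def mult.left_commute)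
  then show ?thesis
    unfolding J_def by (auto intro: cancel_point_form_L)
qed

lemma cancel_point_forms_J: "(\<Prod>e\<leftarrow>es. point_form e) ^ N * s \<in> J \<Longrightarrow> s \<in> J"
proof (induction N arbitrary: s)
  case (Suc N)
  have "r \<in> J" if "(\<Prod>e\<leftarrow>es'. point_form e) * r \<in> J" for es' r
    using that by (induction es') (auto simp: mult.assoc dest: cancel_point_form_J)
  moreover have "(\<Prod>e\<leftarrow>es. point_form e) * ((\<Prod>e\<leftarrow>es. point_form e) ^ N * s) \<in> J"
    using Suc.prems by (simp only: power_Suc mult.assoc)
  ultimately show ?case
    using Suc.IH by blast
qed simp

text \<open>The saturation is graded by the degree in \<open>x, y\<close>.\<close>

lemma low_in_J:
  assumes "s \<in> J"
  shows "low s \<in> J"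
proof -
  have main: "Var h * low s \<in> L" if h: "Var h = x * Const \<alpha> + y * Const \<beta>" "Var h * s \<in> L" for h \<alpha> \<beta>
  proof -
    obtain c where c: "Var h * s = (\<Sum>j<m. l j * c j)"
      using h(2) unfolding L_def by (elim lin_idealE)
    define d where "d j = c j - low (c j)" for j
    define r where "r = s - low s"
    have od: "low (d j) = 0" "low r = 0" for j
      by (simp_all add: d_def r_def)
    have c': "c j = low (c j) + d j" and s': "s = low s + r" for j
      by (simp_all add: d_def r_def)
    have "(x * Const \<alpha> + y * Const \<beta>) * (low s + r) = (\<Sum>j<m. l j * (low (c j) + d j))"
      by (simp only: c h(1)[symmetric] c'[symmetric] s'[symmetric])
    also have "\<dots> = x * (\<Sum>j<m. a j * low (c j)) + y * (\<Sum>j<m. b j * low (c j))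
        + (x * (\<Sum>j<m. a j * d j) + y * (\<Sum>j<m. b j * d j))"
      by (simp only: l_def distrib_left distrib_right sum.distrib sum_distrib_left mult.assoc add_ac)
    finally have eq: "x * ((\<Sum>j<m. a j * low (c j)) - Const \<alpha> * low s)
        + y * ((\<Sum>j<m. b j * low (c j)) - Const \<beta> * low s)
      = x * (Const \<alpha> * r - (\<Sum>j<m. a j * d j)) + y * (Const \<beta> * r - (\<Sum>j<m. b j * d j))"
      (is "x * (?P - ?al) + y * (?Q - ?be) = x * (?ar - ?P') + y * (?br - ?Q')")
    proof -
      assume "(x * Const \<alpha> + y * Const \<beta>) * (low s + r) = x * ?P + y * ?Q + (x * ?P' + y * ?Q')"
      moreover have "(x * Const \<alpha> + y * Const \<beta>) * (low s + r) = x * ?al + y * ?be + (x * ?ar + y * ?br)"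
        by (simp only: distrib_left distrib_right mult.assoc add_ac)
      ultimately have "x * ?al + y * ?be + (x * ?ar + y * ?br) = x * ?P + y * ?Q + (x * ?P' + y * ?Q')"
        by (simp only:)
      then show ?thesis
        unfolding right_diff_distrib by (simp only: diff_eq_eq eq_diff_eq add_ac diff_add_eq add_diff_eq)
    qed
    have "(\<Sum>j<m. a j * low (c j)) - Const \<alpha> * low s = 0"
      by (rule const_part_lowest_terms[OF _ eq]) (simp_all add: od)
    moreover have "(\<Sum>j<m. b j * low (c j)) - Const \<beta> * low s = 0"
    proof -
      have swap: "const_part Vy Vx = low"
        by (simp add: fun_upd_twist)
      show ?thesis
        by (rule const_part_lowest_terms[OF _ eq[unfolded add.commute[of "x * _"]], unfolded swap])
          (simp_all add: od)
    qed
    moreover have "(\<Sum>j<m. l j * low (c j)) = x * (\<Sum>j<m. a j * low (c j)) + y * (\<Sum>j<m. b j * low (c j))"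
      by (simp only: l_def distrib_right sum.distrib sum_distrib_left mult.assoc)
    ultimately have "(\<Sum>j<m. l j * low (c j)) = x * (Const \<alpha> * low s) + y * (Const \<beta> * low s)"
      by (simp only: right_minus_eq)
    also have "\<dots> = Var h * low s"
      by (simp add: h(1) algebra_simps)
    finally show ?thesis
      unfolding L_def by (intro lin_idealI[of _ _ "\<lambda>j. low (c j)"]) simp
  qed
  show ?thesis
    using assms main[of Vx 1 0] main[of Vy 0 1] by (auto simp: J_def)
qed

text \<open>The point \<open>x = e y\<close> of the pencil: restricting to it and eliminating the forms
  \<open>b\<^sub>j + e a\<^sub>j\<close>, to which the \<open>l\<^sub>j\<close> specialise, gives a homomorphism to a domain that kills \<open>J\<close>.\<close>

abbreviation \<beta> :: "'k \<Rightarrow> nat \<Rightarrow> 'k mpoly" where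
  "\<beta> e \<equiv> column_form n (\<lambda>i j. B i j + e * A i j)"

definition fibre_inverse :: "'k \<Rightarrow> nat \<Rightarrow> nat \<Rightarrow> 'k" where
  "fibre_inverse e = (SOME t. \<exists>I. pivot_inverse n m (\<lambda>i j. B i j + e * A i j) t I)"

abbreviation at_point :: "'k \<Rightarrow> 'k mpoly \<Rightarrow> 'k mpoly" where
  "at_point e \<equiv> subst (Var(Vx := Const e * y))"

definition \<chi> :: "'k \<Rightarrow> 'k mpoly \<Rightarrow> 'k mpoly" where
  "\<chi> e p = subst (eliminate n m (\<lambda>i j. B i j + e * A i j) (fibre_inverse e)) (at_point e p)"

lemma fibre_inverse:
  obtains I where "pivot_inverse n m (\<lambda>i j. B i j + e * A i j) (fibre_inverse e) I"
proof -
  have "\<exists>I. pivot_inverse n m (\<lambda>i j. B i j + e * A i j) (fibre_inverse e) I"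
    using pivot_inverse_exists[OF independent_at[of e]] unfolding fibre_inverse_def by (rule someI_ex)
  then show ?thesis
    using that by blast
qed

lemma \<beta>_eq: "\<beta> e j = b j + Const e * a j"
  by (simp add: linear_form_scale linear_form_add)

lemma l_eq: "l j = point_form e * a j + y * \<beta> e j"
  unfolding l_def point_form_def \<beta>_eq by (simp add: algebra_simps)

lemma \<chi>_hom [simp]: "\<chi> e (p + q) = \<chi> e p + \<chi> e q" "\<chi> e (p * q) = \<chi> e p * \<chi> e q"
  "\<chi> e (p - q) = \<chi> e p - \<chi> e q" "\<chi> e 0 = 0" "\<chi> e y = y" "\<chi> e (sum f I) = (\<Sum>i\<in>I. \<chi> e (f i))"
  by (simp_all add: \<chi>_def image_iff)

lemma \<chi>_point_form [simp]: "\<chi> e (point_form e) = 0"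
  by (simp add: \<chi>_def point_form_def image_iff)

lemma \<chi>_\<beta> [simp]: "j < m \<Longrightarrow> \<chi> e (\<beta> e j) = 0"
  by (rule fibre_inverse[of e]) (simp add: \<chi>_def, rule eliminate_column)

lemma \<chi>_eq_0D:
  assumes "\<chi> e p = 0"
  obtains r d where "p = point_form e * r + (\<Sum>j<m. \<beta> e j * d j)"
proof -
  obtain I where piv: "pivot_inverse n m (\<lambda>i j. B i j + e * A i j) (fibre_inverse e) I"
    by (rule fibre_inverse)
  obtain d where "at_point e p = (\<Sum>j<m. \<beta> e j * d j)"
    using assms unfolding \<chi>_def eliminate_eq_0_iff[OF piv] by (elim lin_idealE)
  moreover obtain r where "p - at_point e p = point_form e * r"
    using factor_theorem[of Vx "Const e * y" p] unfolding point_form_def by (elim dvdE)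
  ultimately show ?thesis
    using that[of r d] by (metis diff_add_cancel)
qed

lemma \<chi>_J: "s \<in> J \<Longrightarrow> \<chi> e s = 0"
proof -
  assume "s \<in> J"
  then obtain c where c: "y * s = (\<Sum>j<m. l j * c j)"
    unfolding J_def L_def by (auto elim: lin_idealE)
  have "\<chi> e (y * s) = 0"
    unfolding c by (simp add: l_eq[of _ e])
  then show ?thesis
    by simp
qed

text \<open>In the quotient by \<open>J\<close>, the ideal of \<open>x - e y\<close> is the intersection of the prime \<open>(x, y)\<close> and the
  kernel of \<open>\<chi> e\<close>.\<close>

lemma point_form_dvd_mod_J:
  assumes "low c \<in> J" "\<chi> e c = 0"
  obtains r where "c - point_form e * r \<in> J"
proof -
  obtain p q where c: "c = low c + x * p + y * q"
    by (rule const_part_decomp[of c Vx Vy])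
  also have "\<dots> = low c + point_form e * p + y * (Const e * p + q)"
    by (simp add: point_form_def algebra_simps)
  finally have c: "c = low c + point_form e * p + y * (Const e * p + q)" .
  have "\<chi> e c = \<chi> e (low c + point_form e * p + y * (Const e * p + q))"
    using c by (rule arg_cong)
  also have "\<dots> = y * \<chi> e (Const e * p + q)"
    using \<chi>_J[OF assms(1), of e] by (simp add: distrib_left)
  finally have "\<chi> e (Const e * p + q) = 0"
    using assms(2) by simp
  then obtain r d where "Const e * p + q = point_form e * r + (\<Sum>j<m. \<beta> e j * d j)"
    by (rule \<chi>_eq_0D)
  then have c': "c = low c + point_form e * p + y * (point_form e * r + (\<Sum>j<m. \<beta> e j * d j))"
    using c by simp
  have y\<beta>: "y * (\<Sum>j<m. \<beta> e j * d j) = (\<Sum>j<m. l j * d j) - point_form e * (\<Sum>j<m. a j * d j)"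
    by (simp add: l_eq[of _ e] distrib_right sum.distrib sum_distrib_left mult.assoc)
  have "c' - f * (p' + y * r' - sa) = lo + sl"
    if "c' = lo + f * p' + y * (f * r' + sb)" "y * sb = sl - f * sa" for c' lo f p' r' sa sb sl :: "'k mpoly"
    using that by (simp add: algebra_simps)
  from this[OF c' y\<beta>]
  have "c - point_form e * (p + y * r - (\<Sum>j<m. a j * d j)) = low c + (\<Sum>j<m. l j * d j)" .
  moreover have "\<dots> \<in> J"
    using assms(1) L_subset_J lin_idealI[of "\<Sum>j<m. l j * d j" l d m]
    by (auto simp: L_def intro: ideal_setD[OF J_ideal])
  ultimately have "c - point_form e * (p + y * r - (\<Sum>j<m. a j * d j)) \<in> J"
    by (simp only:)
  then show ?thesis
    by (rule that)
qed

end

text \<open>Over the fractions of \<open>k[x, y]\<close> the forms \<open>l\<^sub>j\<close> express all \<open>w\<^sub>i\<close> by the two variables \<open>w\<^sub>p, w\<^sub>q\<close>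
  that are not pivots, so the quotient by \<open>J\<close> is birationally a polynomial ring.  The following
  makes this precise with an explicit denominator.\<close>

locale eliminated_pencil = good_pencil +
  fixes t :: "nat \<Rightarrow> nat \<Rightarrow> 'a" and I :: "nat set" and p q :: nat
  assumes pivots: "pivot_inverse n m A t I"
    and nonpivots: "{..<n} - I = {p, q}" "p \<noteq> q"
begin

abbreviation \<pi> :: "'a mpoly \<Rightarrow> 'a mpoly" where
  "\<pi> \<equiv> subst (eliminate n m A t)"

abbreviation reduced :: "var set \<Rightarrow> 'a mpoly set" where
  "reduced V \<equiv> carrier (mpoly_ring (V - Vw ` I))"

lemma \<pi>_reduced: "r \<in> reduced V \<Longrightarrow> \<pi> r = r"
proof (erule subst_id_carrier)
  fix v assume "v \<in> V - Vw ` I"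
  then show "eliminate n m A t v = Var v"
    by (cases v) (auto simp: eliminate_nonpivot[OF pivots] image_iff)
qed

lemma reduced_in_J_eq_0:
  assumes "r \<in> reduced V" "r \<in> J"
  shows "r = 0"
  using assms(2) unfolding J_def L_def
  by (intro reduced_in_pencil_ideal_eq_0[OF _ _ _ l_def independent_at_infinity pivots])
    (auto simp: \<pi>_reduced[OF assms(1)])

definition reducing_factors :: "'a list \<Rightarrow> bool" where
  "reducing_factors es \<longleftrightarrow>
    (\<forall>i<n. \<exists>r\<in>carrier (mpoly_ring {Vx, Vy}). \<exists>s\<in>carrier (mpoly_ring {Vx, Vy}).
     (\<Prod>e\<leftarrow>es. point_form e) * Var (Vw i) - (r * Var (Vw p) + s * Var (Vw q)) \<in> L)"

lemma linear_module:
  "homogeneous_module x y {u. \<exists>r\<in>carrier (mpoly_ring {Vx, Vy}). \<exists>s\<in>carrier (mpoly_ring {Vx, Vy}).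
     u - (r * Var (Vw p) + s * Var (Vw q)) \<in> L}" (is "homogeneous_module x y ?D")
proof -
  let ?C = "carrier (mpoly_ring {Vx, Vy})"
  let ?w = "\<lambda>r s. r * Var (Vw p) + s * Var (Vw q)"
  have mult: "c * u \<in> ?D" if u: "u \<in> ?D" and c: "c \<in> ?C" for c u
  proof -
    obtain r s where rs: "r \<in> ?C" "s \<in> ?C" "u - ?w r s \<in> L"
      using u by auto
    have "c * (u - ?w r s) \<in> L"
      by (rule ideal_setD(3)[OF L_ideal rs(3)])
    then have "c * u - ?w (c * r) (c * s) \<in> L"
      by (simp add: algebra_simps)
    then show ?thesis
      using rs c by (intro CollectI bexI[of _ "c * r"] bexI[of _ "c * s"]) auto
  qed
  show ?thesis
    unfolding homogeneous_module_def
  proof (intro conjI ballI allI)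
    show "0 \<in> ?D"
      by (intro CollectI bexI[of _ 0]) (auto simp: ideal_setD[OF L_ideal])
  next
    fix u v assume "u \<in> ?D" "v \<in> ?D"
    then obtain r s r' s' where *: "r \<in> ?C" "s \<in> ?C" "u - ?w r s \<in> L" "r' \<in> ?C" "s' \<in> ?C" "v - ?w r' s' \<in> L"
      by auto
    have "(u - ?w r s) + (v - ?w r' s') \<in> L"
      using *(3,6) by (rule ideal_setD(2)[OF L_ideal])
    then have "u + v - ?w (r + r') (s + s') \<in> L"
      by (simp add: algebra_simps)
    then show "u + v \<in> ?D"
      using * by (intro CollectI bexI[of _ "r + r'"] bexI[of _ "s + s'"]) auto
  qed (rule mult; simp)+
qed

text \<open>The linear factors come from the eigenvalues of the matrix by which \<open>x / y\<close> acts on the pivot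
  forms \<open>a\<^sub>j\<close>.\<close>

lemma linear_reduction: "\<exists>es. reducing_factors es"
proof -
  define D where "D = {u. \<exists>r\<in>carrier (mpoly_ring {Vx, Vy}). \<exists>s\<in>carrier (mpoly_ring {Vx, Vy}).
     u - (r * Var (Vw p) + s * Var (Vw q)) \<in> L}"
  have D: "homogeneous_module x y D"
    unfolding D_def by (rule linear_module)
  note DD = homogeneous_moduleD[OF D]
  have LD: "u \<in> D" if "u \<in> L" for u
    unfolding D_def using that by (intro CollectI bexI[of _ 0]) auto
  have wD: "Var (Vw p) \<in> D" "Var (Vw q) \<in> D"
  proof -
    show "Var (Vw p) \<in> D"
      unfolding D_def by (intro CollectI bexI[of _ 1] bexI[of _ 0]) (auto simp: ideal_setD[OF L_ideal])
    show "Var (Vw q) \<in> D"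
      unfolding D_def by (intro CollectI bexI[of _ 0] bexI[of _ 1]) (auto simp: ideal_setD[OF L_ideal])
  qed
  have \<pi>D: "\<pi> (Var (Vw i)) \<in> D" if i: "i < n" for i
  proof -
    obtain c where c: "eliminate n m A t (Vw i) = (\<Sum>i'\<in>{..<n} - I. Const (c i') * Var (Vw i'))"
      by (rule eliminate_in_nonpivots[OF pivots i])
    show ?thesis
      unfolding subst_Var c nonpivots(1)
      by (rule homogeneous_module_sum[OF D]) (auto intro: DD(5) wD)
  qed
  have \<pi>bD: "\<pi> (linear_form n \<alpha>) \<in> D" for \<alpha>
    unfolding linear_form_def subst_sum subst_mult subst_Const
    by (intro homogeneous_module_sum[OF D] DD(5) \<pi>D) auto
  have "\<exists>es. \<forall>j\<in>{..<m}. (\<Prod>e\<leftarrow>es. x - Const e * y) * a j \<in> D"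
  proof (rule linear_factors_annihilate[OF finite_lessThan D])
    fix j assume "j \<in> {..<m}"
    have "x * a j - y * (\<Sum>k<m. Const (- (\<Sum>i<n. t k i * B i j)) * a k) = l j - y * \<pi> (b j)"
      by (simp add: l_def subst_eliminate_linear_form Const_minus sum_negf algebra_simps)
    also have "\<dots> \<in> D"
      using \<open>j \<in> {..<m}\<close> by (intro DD(7) LD l_in_L DD(4) \<pi>bD) auto
    finally show "x * a j - y * (\<Sum>k<m. Const (- (\<Sum>i<n. t k i * B i j)) * a k) \<in> D" .
  qed
  then obtain es where es: "\<And>j. j < m \<Longrightarrow> (\<Prod>e\<leftarrow>es. x - Const e * y) * a j \<in> D"
    by auto
  have "(\<Prod>e\<leftarrow>es. point_form e) * Var (Vw i) \<in> D" if i: "i < n" for i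
  proof -
    let ?\<Lambda> = "\<Prod>e\<leftarrow>es. x - Const e * y"
    have "Var (Vw i) = \<pi> (Var (Vw i)) + (\<Sum>j<m. Const (t j i) * a j)"
      using i by (simp add: eliminate_def)
    then have "?\<Lambda> * Var (Vw i) = ?\<Lambda> * (\<pi> (Var (Vw i)) + (\<Sum>j<m. Const (t j i) * a j))"
      by (rule arg_cong)
    also have "\<dots> = ?\<Lambda> * \<pi> (Var (Vw i)) + (\<Sum>j<m. Const (t j i) * (?\<Lambda> * a j))"
      by (simp only: distrib_left sum_distrib_left mult.left_commute[of ?\<Lambda>])
    also have "\<dots> \<in> D"
      by (intro DD(2,5) homogeneous_module_prod[OF D] \<pi>D i homogeneous_module_sum[OF D] es) auto
    finally show ?thesis
      by (simp add: point_form_def[abs_def])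
  qed
  then show ?thesis
    unfolding D_def reducing_factors_def by blast
qed

text \<open>The denominators needed for the single variables accumulate in products, whence the power.\<close>

lemma reduction:
  assumes es: "reducing_factors es"
    and V: "{Vx, Vy, Vw p, Vw q} \<subseteq> V" and s: "s \<in> carrier (mpoly_ring V)"
  shows "\<exists>N. \<exists>s'\<in>reduced V. (\<Prod>e\<leftarrow>es. point_form e) ^ N * s - s' \<in> L"
  using s
proof (induction s rule: mpoly_ring_induct)
  let ?\<Lambda> = "\<Prod>e\<leftarrow>es. point_form e"
  have "point_form e \<in> reduced V" for e
    unfolding point_form_def using V by (intro diff_carrier mult_carrier) auto
  then have \<Lambda>: "?\<Lambda> \<in> reduced V"
    by (induction es) auto
  have trivial: "\<exists>N. \<exists>s'\<in>reduced V. ?\<Lambda> ^ N * s - s' \<in> L" if "s \<in> reduced V" for s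
    using that by (intro exI[of _ 0] bexI[of _ s]) (auto simp: ideal_setD[OF L_ideal])
  {
    case (Const c)
    show ?case by (rule trivial) simp
  next
    case (Var v)
    show ?case
    proof (cases "v \<in> Vw ` I")
      case False
      then show ?thesis using Var by (intro trivial) simp
    next
      case True
      then obtain i where i: "v = Vw i" "i < n"
        using pivots by (auto simp: pivot_inverse_def)
      obtain r s where rs: "r \<in> carrier (mpoly_ring {Vx, Vy})" "s \<in> carrier (mpoly_ring {Vx, Vy})"
        "?\<Lambda> * Var (Vw i) - (r * Var (Vw p) + s * Var (Vw q)) \<in> L"
        using es i(2) unfolding reducing_factors_def by blast
      have V': "{Vx, Vy} \<subseteq> V - Vw ` I" "Vw p \<in> V - Vw ` I" "Vw q \<in> V - Vw ` I"
        using V nonpivots by auto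
      have "r * Var (Vw p) + s * Var (Vw q) \<in> reduced V"
        using carrier_mono[OF V'(1) rs(1)] carrier_mono[OF V'(1) rs(2)] V'(2,3)
        by (intro add_carrier mult_carrier) simp_all
      then show ?thesis
        using rs(3) i by (intro exI[of _ 1]) auto
    qed
  next
    case (add s1 s2)
    then obtain N1 r1 N2 r2 where *: "r1 \<in> reduced V" "?\<Lambda> ^ N1 * s1 - r1 \<in> L"
      "r2 \<in> reduced V" "?\<Lambda> ^ N2 * s2 - r2 \<in> L"
      by auto
    have "?\<Lambda> ^ N2 * (?\<Lambda> ^ N1 * s1 - r1) + ?\<Lambda> ^ N1 * (?\<Lambda> ^ N2 * s2 - r2) \<in> L"
      using * by (intro ideal_setD(2,3)[OF L_ideal])
    then have "?\<Lambda> ^ (N1 + N2) * (s1 + s2) - (?\<Lambda> ^ N2 * r1 + ?\<Lambda> ^ N1 * r2) \<in> L"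
      by (simp add: power_add algebra_simps)
    then show ?case
      using * \<Lambda> by (intro exI[of _ "N1 + N2"] bexI[of _ "?\<Lambda> ^ N2 * r1 + ?\<Lambda> ^ N1 * r2"]) auto
  next
    case (mult s1 s2)
    then obtain N1 r1 N2 r2 where *: "r1 \<in> reduced V" "?\<Lambda> ^ N1 * s1 - r1 \<in> L"
      "r2 \<in> reduced V" "?\<Lambda> ^ N2 * s2 - r2 \<in> L"
      by auto
    have "(?\<Lambda> ^ N2 * s2) * (?\<Lambda> ^ N1 * s1 - r1) + r1 * (?\<Lambda> ^ N2 * s2 - r2) \<in> L"
      using * by (intro ideal_setD(2,3)[OF L_ideal])
    then have "?\<Lambda> ^ (N1 + N2) * (s1 * s2) - r1 * r2 \<in> L"
      by (simp add: power_add algebra_simps)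
    then show ?case
      using * by (intro exI[of _ "N1 + N2"] bexI[of _ "r1 * r2"]) auto
  }
qed

text \<open>Modulo \<open>J\<close> and up to a power of a product of linear factors, which can be cancelled, every
  polynomial agrees with one without pivot variables; and nonzero ones of these are not in \<open>J\<close>.\<close>

lemma J_prime:
  assumes "s1 * s2 \<in> J"
  shows "s1 \<in> J \<or> s2 \<in> J"
proof -
  obtain es where es: "reducing_factors es"
    using linear_reduction by blast
  let ?\<Lambda> = "\<Prod>e\<leftarrow>es. point_form e"
  have "\<exists>N. \<exists>s'\<in>reduced UNIV. ?\<Lambda> ^ N * s - s' \<in> L" for s
    by (rule reduction[OF es]) auto
  then obtain N1 r1 N2 r2 where *: "r1 \<in> reduced UNIV" "?\<Lambda> ^ N1 * s1 - r1 \<in> L"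
    "r2 \<in> reduced UNIV" "?\<Lambda> ^ N2 * s2 - r2 \<in> L"
    by metis
  have mem: "?\<Lambda> ^ N1 * s1 - r1 \<in> J" "?\<Lambda> ^ N2 * s2 - r2 \<in> J"
    using * L_subset_J by auto
  have "(?\<Lambda> ^ N1 * ?\<Lambda> ^ N2) * (s1 * s2) - (?\<Lambda> ^ N2 * s2) * (?\<Lambda> ^ N1 * s1 - r1) - r1 * (?\<Lambda> ^ N2 * s2 - r2) \<in> J"
    by (rule ideal_setD(6)[OF J_ideal ideal_setD(6)[OF J_ideal
          ideal_setD(3)[OF J_ideal assms] ideal_setD(3)[OF J_ideal mem(1)]] ideal_setD(3)[OF J_ideal mem(2)]])
  then have "r1 * r2 \<in> J"
    by (simp add: algebra_simps)
  then have "r1 * r2 = 0"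
    by (intro reduced_in_J_eq_0[of _ UNIV] mult_carrier *)
  then have "r1 = 0 \<or> r2 = 0"
    by simp
  then show ?thesis
    using mem cancel_point_forms_J by auto
qed

text \<open>The quotient by \<open>J\<close> and \<open>F\<close> has no \<open>(x - e y)\<close>-torsion if \<open>F\<close> lies in neither of the two primes
  whose intersection is the ideal of \<open>x - e y\<close>.\<close>

lemma regular_mod_J:
  assumes F: "low F \<notin> J" "\<chi> e F \<noteq> 0" and mem: "point_form e * s - F * c \<in> J"
  obtains c' where "s - F * c' \<in> J"
proof -
  have "\<chi> e (point_form e * s - F * c) = 0"
    by (rule \<chi>_J[OF mem])
  then have "\<chi> e c = 0"
    using F(2) by simp
  have "low (point_form e * s - F * c) = - (low F * low c)"
    by (simp add: point_form_def)
  with low_in_J[OF mem] have "- (low F * low c) \<in> J"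
    by metis
  then have "low F * low c \<in> J"
    using ideal_setD(5)[OF J_ideal] by fastforce
  then have "low c \<in> J"
    using J_prime F(1) by blast
  then obtain r where r: "c - point_form e * r \<in> J"
    using point_form_dvd_mod_J \<open>\<chi> e c = 0\<close> by blast
  have "(point_form e * s - F * c) + F * (c - point_form e * r) \<in> J"
    by (intro ideal_setD(2,3)[OF J_ideal] mem r)
  then have "point_form e * (s - F * r) \<in> J"
    by (simp add: algebra_simps)
  then show ?thesis
    using that cancel_point_form_J by blast
qed

lemma regular_power_mod_J:
  assumes F: "low F \<notin> J" "\<And>e. \<chi> e F \<noteq> 0" and mem: "(\<Prod>e\<leftarrow>es. point_form e) ^ N * s - F * c \<in> J"
  shows "\<exists>c'. s - F * c' \<in> J"
  using mem
proof (induction N arbitrary: s c)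
  case 0
  then show ?case by auto
next
  case (Suc N)
  have step: "\<exists>c'. r - F * c' \<in> J" if "(\<Prod>e\<leftarrow>es'. point_form e) * r - F * c \<in> J" for es' r c
    using that
  proof (induction es' arbitrary: r c)
    case (Cons e es')
    then have "point_form e * ((\<Prod>e\<leftarrow>es'. point_form e) * r) - F * c \<in> J"
      by (simp add: mult.assoc)
    then obtain c' where "(\<Prod>e\<leftarrow>es'. point_form e) * r - F * c' \<in> J"
      by (rule regular_mod_J[OF F])
    then show ?case
      by (rule Cons.IH)
  qed auto
  have "(\<Prod>e\<leftarrow>es. point_form e) * ((\<Prod>e\<leftarrow>es. point_form e) ^ N * s) - F * c \<in> J"
    using Suc.prems by (simp add: mult.assoc)
  from step[OF this] obtain c' where "(\<Prod>e\<leftarrow>es. point_form e) ^ N * s - F * c' \<in> J"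
    by blast
  then show ?case
    by (rule Suc.IH)
qed

text \<open>For an element outside the prime \<open>(x, y)\<close>, being a multiple of it can be tested after
  multiplication by both \<open>x\<close> and \<open>y\<close>.\<close>

lemma colon_xy_mod_J:
  assumes G: "low G \<notin> J" and mem: "x * s - G * c \<in> J" "y * s - G * d \<in> J"
  obtains c' where "s - G * c' \<in> J"
proof -
  have "G \<notin> J"
    using G low_in_J by blast
  have "x * (y * s - G * d) - y * (x * s - G * c) \<in> J"
    by (intro ideal_setD(3,6)[OF J_ideal] mem)
  then have "G * (y * c - x * d) \<in> J"
    by (simp add: algebra_simps)
  then have "y * c - x * d \<in> J"
    using J_prime \<open>G \<notin> J\<close> by blast
  then have "\<chi> 0 (y * c - x * d) = 0"
    by (rule \<chi>_J)
  moreover have "\<chi> 0 x = 0"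
    using \<chi>_point_form[of 0] by (simp add: point_form_def)
  ultimately have "\<chi> 0 c = 0"
    by simp
  have "low (x * s - G * c) = - (low G * low c)"
    by simp
  with low_in_J[OF mem(1)] have "- (low G * low c) \<in> J"
    by metis
  then have "low G * low c \<in> J"
    using ideal_setD(5)[OF J_ideal] by fastforce
  then have "low c \<in> J"
    using J_prime G by blast
  then obtain r where r: "c - point_form 0 * r \<in> J"
    using point_form_dvd_mod_J \<open>\<chi> 0 c = 0\<close> by blast
  have "(x * s - G * c) + G * (c - point_form 0 * r) \<in> J"
    by (intro ideal_setD(2,3)[OF J_ideal] mem r)
  then have "point_form 0 * (s - G * r) \<in> J"
    by (simp add: point_form_def algebra_simps)
  then show ?thesis
    using that cancel_point_form_J by blast
qed

end

context good_pencil
begin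

text \<open>A form \<open>F\<close>, linear in the \<open>w\<^sub>i\<close>, that is killed by \<open>\<chi> e\<close> is a combination of the \<open>\<beta> e j\<close> modulo
  \<open>x - e y\<close>.  As \<open>y \<beta> e j\<close> is congruent to \<open>l\<^sub>j\<close>, the multiple \<open>y F\<close> can be divided by \<open>x - e y\<close> modulo
  the \<open>l\<^sub>j\<close>, and the quotient is again linear in the \<open>w\<^sub>i\<close> with coefficients in \<open>R\<close>.\<close>

lemma \<chi>_linear_eq_0D:
  assumes \<phi>: "\<And>i. i < n \<Longrightarrow> \<phi> i \<in> carrier Rxyz" and F: "F = (\<Sum>i<n. \<phi> i * Var (Vw i))"
    and "\<chi> e F = 0"
  obtains \<nu> d where "\<And>i. i < n \<Longrightarrow> \<nu> i \<in> carrier Rxyz"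
    "y * F - point_form e * (\<Sum>i<n. \<nu> i * Var (Vw i)) = (\<Sum>j<m. l j * d j)"
proof -
  let ?t = "fibre_inverse e"
  have "\<exists>r. r \<in> carrier Rxyz \<and> \<phi> i = at_point e (\<phi> i) + point_form e * r" if "i < n" for i
  proof -
    have "Const e * y \<in> carrier Rxyz"
      by simp
    from factor_theorem_in_carrier[OF \<phi>[OF that] this, of Vx] show ?thesis
      unfolding point_form_def by blast
  qed
  then obtain r where r: "\<And>i. i < n \<Longrightarrow> r i \<in> carrier Rxyz"
    "\<And>i. i < n \<Longrightarrow> \<phi> i = at_point e (\<phi> i) + point_form e * r i"
    by metis
  have pt: "at_point e (\<phi> i) \<in> carrier Rxyz" if "i < n" for i
    by (rule subst_in_carrier[OF \<phi>[OF that]]) auto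
  define d where "d j = (\<Sum>i<n. at_point e (\<phi> i) * Const (?t j i))" for j
  have d: "d j \<in> carrier Rxyz" for j
    unfolding d_def by (intro sum_carrier mult_carrier pt) auto
  have fix_pt: "\<chi> e (\<phi> i) = at_point e (\<phi> i)" if "i < n" for i
    unfolding \<chi>_def by (rule subst_id_carrier[OF pt[OF that]]) (auto simp: image_iff)
  have "0 = (\<Sum>i<n. \<chi> e (\<phi> i) * \<chi> e (Var (Vw i)))"
    using assms(3) unfolding F by simp
  also have "\<dots> = (\<Sum>i<n. at_point e (\<phi> i) * (Var (Vw i) - (\<Sum>j<m. Const (?t j i) * \<beta> e j)))"
    by (intro sum.cong refl) (simp only: fix_pt lessThan_iff, simp add: \<chi>_def eliminate_def)
  also have "\<dots> = (\<Sum>i<n. at_point e (\<phi> i) * Var (Vw i)) - (\<Sum>j<m. \<beta> e j * d j)"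
  proof -
    have "(\<Sum>i<n. at_point e (\<phi> i) * (\<Sum>j<m. Const (?t j i) * \<beta> e j)) = (\<Sum>j<m. \<beta> e j * d j)"
      unfolding d_def sum_distrib_left by (subst sum.swap) (simp only: mult_ac)
    then show ?thesis
      by (simp only: right_diff_distrib sum_subtractf)
  qed
  finally have pt_sum: "(\<Sum>i<n. at_point e (\<phi> i) * Var (Vw i)) = (\<Sum>j<m. \<beta> e j * d j)"
    by simp
  define \<nu> where "\<nu> i = y * r i - (\<Sum>j<m. Const (A i j) * d j)" for i
  have "\<nu> i \<in> carrier Rxyz" if "i < n" for i
    unfolding \<nu>_def using r(1)[OF that] d by (intro diff_carrier mult_carrier sum_carrier) auto
  moreover have "y * F - point_form e * (\<Sum>i<n. \<nu> i * Var (Vw i)) = (\<Sum>j<m. l j * d j)"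
  proof -
    have "F = (\<Sum>i<n. (at_point e (\<phi> i) + point_form e * r i) * Var (Vw i))"
      unfolding F using r(2) by (intro sum.cong refl) (metis lessThan_iff)
    then have F': "F = (\<Sum>j<m. \<beta> e j * d j) + point_form e * (\<Sum>i<n. r i * Var (Vw i))"
      by (simp only: distrib_right sum.distrib pt_sum sum_distrib_left mult.assoc)
    have "(\<Sum>i<n. (\<Sum>j<m. Const (A i j) * d j) * Var (Vw i)) = (\<Sum>j<m. a j * d j)"
      unfolding linear_form_def sum_distrib_right by (subst sum.swap) (simp only: mult_ac)
    then have \<nu>': "(\<Sum>i<n. \<nu> i * Var (Vw i)) = y * (\<Sum>i<n. r i * Var (Vw i)) - (\<Sum>j<m. a j * d j)"
      by (simp only: \<nu>_def left_diff_distrib sum_subtractf sum_distrib_left mult.assoc)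
    have "(\<Sum>j<m. l j * d j) = point_form e * (\<Sum>j<m. a j * d j) + y * (\<Sum>j<m. \<beta> e j * d j)"
      unfolding l_eq[of _ e] by (simp only: distrib_right sum.distrib sum_distrib_left mult.assoc)
    then show ?thesis
      unfolding F' \<nu>' by (simp add: algebra_simps)
  qed
  ultimately show ?thesis
    by (rule that)
qed

end

section \<open>Finitely generated ideals and syzygies\<close>

lemma genideal_mpoly_ring:
  fixes g :: "nat \<Rightarrow> 'k::comm_ring_1 mpoly"
  assumes g: "\<And>j. j < k \<Longrightarrow> g j \<in> carrier (mpoly_ring V)"
  shows "Idl\<^bsub>mpoly_ring V\<^esub> (g ` {..<k}) = {(\<Sum>j<k. g j * c j) | c. \<forall>j. c j \<in> carrier (mpoly_ring V)}"
    (is "?I = ?D")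
proof -
  interpret cring "mpoly_ring V :: 'k mpoly ring"
    by (rule cring_mpoly_ring)
  have gC: "g ` {..<k} \<subseteq> carrier (mpoly_ring V)"
    using g by auto
  have I: "ideal ?I (mpoly_ring V)"
    by (rule genideal_ideal[OF gC])
  show ?thesis
  proof
    have D: "ideal ?D (mpoly_ring V)"
    proof (rule idealI)
      show "subgroup ?D (add_monoid (mpoly_ring V))"
      proof (rule group.subgroupI[OF a_group])
        show "?D \<subseteq> carrier (add_monoid (mpoly_ring V))"
          using g by (auto intro!: sum_carrier mult_carrier)
        show "?D \<noteq> {}"
          by (auto intro!: exI[of _ "\<lambda>_. 0"])
      next
        fix u assume "u \<in> ?D"
        then obtain c where c: "u = (\<Sum>j<k. g j * c j)" "\<forall>j. c j \<in> carrier (mpoly_ring V)"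
          by blast
        then have u: "u \<in> carrier (mpoly_ring V)"
          using g by (auto intro!: sum_carrier mult_carrier)
        have "\<ominus>\<^bsub>mpoly_ring V\<^esub> u = - u"
          using minus_equality[of "- u" u] u by simp
        then have "inv\<^bsub>add_monoid (mpoly_ring V)\<^esub> u = (\<Sum>j<k. g j * (- c j))"
          by (simp add: a_inv_def c sum_negf)
        then show "inv\<^bsub>add_monoid (mpoly_ring V)\<^esub> u \<in> ?D"
          using c(2) by (intro CollectI exI[of _ "\<lambda>j. - c j"]) auto
      next
        fix u v assume "u \<in> ?D" "v \<in> ?D"
        then obtain c d where "u = (\<Sum>j<k. g j * c j)" "\<forall>j. c j \<in> carrier (mpoly_ring V)"
          "v = (\<Sum>j<k. g j * d j)" "\<forall>j. d j \<in> carrier (mpoly_ring V)"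
          by blast
        then show "u \<otimes>\<^bsub>add_monoid (mpoly_ring V)\<^esub> v \<in> ?D"
          by (intro CollectI exI[of _ "\<lambda>j. c j + d j"]) (auto simp: distrib_left sum.distrib)
      qed
    next
      fix u r :: "'k mpoly" assume "u \<in> ?D" and r: "r \<in> carrier (mpoly_ring V)"
      then obtain c where c: "u = (\<Sum>j<k. g j * c j)" "\<forall>j. c j \<in> carrier (mpoly_ring V)"
        by blast
      have "r * u = (\<Sum>j<k. g j * (r * c j))"
        by (simp add: c sum_distrib_left mult.left_commute)
      then show "r \<otimes>\<^bsub>mpoly_ring V\<^esub> u \<in> ?D" "u \<otimes>\<^bsub>mpoly_ring V\<^esub> r \<in> ?D"
        using c(2) r by (auto simp: mult.commute[of u r] intro!: exI[of _ "\<lambda>j. r * c j"])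
    qed (rule ring_axioms)
    have "g j \<in> ?D" if "j < k" for j
      using that by (intro CollectI exI[of _ "\<lambda>i. if i = j then 1 else 0"])
        (simp add: if_distrib cong: if_cong)
    then show "?I \<subseteq> ?D"
      by (intro genideal_minimal[OF D]) auto
  next
    have gI: "g j \<in> ?I" if "j < k" for j
      using genideal_self[OF gC] that by auto
    have "(\<Sum>j<k'. g j * c j) \<in> ?I" if c: "\<forall>j. c j \<in> carrier (mpoly_ring V)" and "k' \<le> k" for c k'
      using that(2)
    proof (induction k')
      case 0
      show ?case
        using additive_subgroup.zero_closed[OF ideal.axioms(1)[OF I]] by simp
    next
      case (Suc k')
      have "g k' \<otimes>\<^bsub>mpoly_ring V\<^esub> c k' \<in> ?I"
        using Suc.prems c by (intro ideal.I_r_closed[OF I] gI) auto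
      then show ?case
        using additive_subgroup.a_closed[OF ideal.axioms(1)[OF I], of "\<Sum>j<k'. g j * c j" "g k' * c k'"]
          Suc by simp
    qed
    then show "?D \<subseteq> ?I"
      by blast
  qed
qed

text \<open>A linear relation with scalar coefficients would make one of the generators redundant.\<close>

lemma minimal_generators_independent:
  fixes f :: "'k::field mpoly vec"
  assumes f: "f \<in> carrier_vec n" "set\<^sub>v f \<subseteq> carrier Rxyz"
    and min: "min_gens Rxyz (gens_ideal f) = enat n"
    and c: "(\<Sum>i<n. Const (c i) * f $ i) = 0" "k < n"
  shows "c k = 0"
proof (rule ccontr)
  assume ck: "c k \<noteq> 0"
  interpret cring "Rxyz :: 'k mpoly ring"
    by (rule cring_mpoly_ring)
  let ?G = "($) f ` ({..<n} - {k})"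
  have fset: "set\<^sub>v f = ($) f ` {..<n}"
    using f(1) by (auto simp: vec_set_def)
  have GC: "?G \<subseteq> carrier Rxyz" and fC: "($) f ` {..<n} \<subseteq> carrier Rxyz"
    using f(2) unfolding fset by auto
  have I: "ideal (Idl\<^bsub>Rxyz\<^esub> ?G) Rxyz"
    by (rule genideal_ideal[OF GC])
  have G: "f $ i \<in> Idl\<^bsub>Rxyz\<^esub> ?G" if "i < n" "i \<noteq> k" for i
    using genideal_self[OF GC] that by auto
  have "f $ k = (\<Sum>i\<in>{..<n} - {k}. f $ i * Const (- c i / c k))"
  proof -
    have "Const (c k) * f $ k = - (\<Sum>i\<in>{..<n} - {k}. Const (c i) * f $ i)"
      using c by (simp add: sum.remove[of "{..<n}" k] add_eq_0_iff2)
    then have "Const (1 / c k) * (Const (c k) * f $ k) = (\<Sum>i\<in>{..<n} - {k}. Const (1 / c k) * (- (Const (c i) * f $ i)))"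
      by (simp add: sum_distrib_left sum_negf)
    also have "\<dots> = (\<Sum>i\<in>{..<n} - {k}. f $ i * Const (- c i / c k))"
      by (intro sum.cong refl) (simp add: Const_minus divide_inverse Const_mult algebra_simps)
    finally show ?thesis
      using ck by (simp add: mult.assoc[symmetric] flip: Const_mult)
  qed
  moreover have "(\<Sum>i\<in>K. f $ i * Const (- c i / c k)) \<in> Idl\<^bsub>Rxyz\<^esub> ?G"
    if "finite K" "K \<subseteq> {..<n} - {k}" for K
    using that
  proof (induction K rule: finite_induct)
    case empty
    show ?case
      using additive_subgroup.zero_closed[OF ideal.axioms(1)[OF I]] by simp
  next
    case (insert i K)
    have "f $ i \<otimes>\<^bsub>Rxyz\<^esub> Const (- c i / c k) \<in> Idl\<^bsub>Rxyz\<^esub> ?G"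
      using insert.prems by (intro ideal.I_r_closed[OF I] G) auto
    then show ?case
      using additive_subgroup.a_closed[OF ideal.axioms(1)[OF I],
          of "f $ i * Const (- c i / c k)" "\<Sum>i\<in>K. f $ i * Const (- c i / c k)"] insert by simp
  qed
  ultimately have "f $ k \<in> Idl\<^bsub>Rxyz\<^esub> ?G"
    by auto
  then have "($) f ` {..<n} \<subseteq> Idl\<^bsub>Rxyz\<^esub> ?G"
    using G by (auto simp: image_subset_iff)
  then have "Idl\<^bsub>Rxyz\<^esub> (($) f ` {..<n}) \<subseteq> Idl\<^bsub>Rxyz\<^esub> ?G"
    by (rule genideal_minimal[OF I])
  moreover have "Idl\<^bsub>Rxyz\<^esub> ?G \<subseteq> Idl\<^bsub>Rxyz\<^esub> (($) f ` {..<n})"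
    using genideal_self[OF fC] by (intro genideal_minimal[OF genideal_ideal[OF fC]]) auto
  ultimately have "Idl\<^bsub>Rxyz\<^esub> ?G = gens_ideal f"
    unfolding gens_ideal_def fset by blast
  then have "min_gens Rxyz (gens_ideal f) \<le> enat (card ?G)"
    unfolding min_gens_def using GC by (intro Inf_lower) blast
  also have "card ?G \<le> card ({..<n} - {k})"
    by (rule card_image_le) simp
  also have "\<dots> < n"
    using c(2) by simp
  finally show False
    using min by (simp add: min_def)
qed

lemma scalar_prod_sum: "v \<in> carrier_vec n \<Longrightarrow> u \<bullet> v = (\<Sum>i<n. u $ i * v $ i)"
  by (simp add: scalar_prod_def atLeast0LessThan)

lemma presents_syzygy:
  assumes \<phi>: "presents \<phi> f" "\<phi> \<in> carrier_mat n k" and f: "f \<in> carrier_vec n"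
    and c: "\<And>i. i < n \<Longrightarrow> c i \<in> carrier Rxyz" "(\<Sum>i<n. f $ i * c i) = 0"
  obtains d where "\<And>j. d j \<in> carrier Rxyz" "\<And>i. i < n \<Longrightarrow> c i = (\<Sum>j<k. \<phi> $$ (i, j) * d j)"
proof -
  have "vec n c \<in> carrier_vec n" "set\<^sub>v (vec n c) \<subseteq> carrier Rxyz" "f \<bullet> vec n c = 0"
    using c by (auto simp: vec_set_def scalar_prod_sum[of _ n])
  then obtain b where b: "b \<in> carrier_vec k" "set\<^sub>v b \<subseteq> carrier Rxyz" "vec n c = \<phi> *\<^sub>v b"
    using \<phi> f unfolding presents_def by auto
  define d where "d j = (if j < k then b $ j else 0)" for j
  have "d j \<in> carrier Rxyz" for j
    using b(1,2) by (auto simp: d_def vec_set_def)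
  moreover have "c i = (\<Sum>j<k. \<phi> $$ (i, j) * d j)" if "i < n" for i
  proof -
    have "c i = (\<phi> *\<^sub>v b) $ i"
      using that by (simp flip: b(3))
    also have "\<dots> = (\<Sum>j<k. \<phi> $$ (i, j) * d j)"
      using that \<phi>(2) b(1) by (simp add: scalar_prod_sum[of _ k] d_def)
    finally show ?thesis .
  qed
  ultimately show ?thesis
    by (rule that)
qed

lemma presents_column:
  assumes \<phi>: "presents \<phi> f" "\<phi> \<in> carrier_mat n k" "elements_mat \<phi> \<subseteq> carrier Rxyz"
    and f: "f \<in> carrier_vec n" and j: "j < k"
  shows "(\<Sum>i<n. f $ i * \<phi> $$ (i, j)) = 0"
proof -
  have "col \<phi> j \<in> carrier_vec n"
    using \<phi>(2) j by auto
  moreover have "set\<^sub>v (col \<phi> j) \<subseteq> carrier Rxyz"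
    using \<phi>(2,3) j by (force simp: vec_set_def elements_mat_def)
  moreover have "unit_vec k j \<in> carrier_vec k" "set\<^sub>v (unit_vec k j :: 'a mpoly vec) \<subseteq> carrier Rxyz"
    by (auto simp: vec_set_def unit_vec_def)
  moreover have "col \<phi> j = \<phi> *\<^sub>v unit_vec k j"
    using \<phi>(2) j by (intro eq_vecI) (auto simp: scalar_prod_right_unit)
  ultimately have "f \<bullet> col \<phi> j = 0"
    using \<phi>(1,2) f unfolding presents_def by (metis carrier_matD(2) carrier_vecD)
  then show ?thesis
    using \<phi>(2) j by (simp add: scalar_prod_sum[of _ n] cong: sum.cong_simp)
qed

text \<open>The Koszul relations \<open>f\<^sub>0 e\<^sub>i - f\<^sub>i e\<^sub>0\<close> factor through \<open>\<phi>\<close>, so the rank of \<open>\<phi>\<close> is at least the number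
  of its columns.\<close>

lemma presents_injective:
  fixes f :: "'k::field mpoly vec"
  assumes \<phi>: "presents \<phi> f" "\<phi> \<in> carrier_mat (Suc k) k"
    and f: "f \<in> carrier_vec (Suc k)" "set\<^sub>v f \<subseteq> carrier Rxyz" "f $ 0 \<noteq> 0"
    and c: "\<And>i. i < Suc k \<Longrightarrow> (\<Sum>j<k. \<phi> $$ (i, j) * c j) = 0" "j < k"
  shows "c j = 0"
proof -
  have fC: "f $ i \<in> carrier Rxyz" if "i < Suc k" for i
    using f(1,2) that by (auto simp: vec_set_def)
  define Q where "Q i d \<longleftrightarrow> (\<forall>i'<Suc k. (if i' = Suc i then f $ 0 else if i' = 0 then - f $ Suc i else 0)
    = (\<Sum>j<k. \<phi> $$ (i', j) * d j))" for i d
  have "\<exists>d. Q i d" if i: "i < k" for i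
  proof -
    let ?c = "\<lambda>i'. if i' = Suc i then f $ 0 else if i' = 0 then - f $ Suc i else 0"
    have c0: "(\<Sum>i'<Suc k. f $ i' * ?c i') = 0"
      using i by (subst sum.lessThan_Suc_shift) (simp add: if_distrib cong: if_cong)
    have cC: "?c i' \<in> carrier Rxyz" if "i' < Suc k" for i'
      using fC i that by simp
    show ?thesis
      unfolding Q_def by (rule presents_syzygy[OF \<phi> f(1) cC c0]) blast+
  qed
  then obtain d where "\<And>i. i < k \<Longrightarrow> Q i (d i)"
    by metis
  then have d: "(if i' = Suc i then f $ 0 else if i' = 0 then - f $ Suc i else 0) = (\<Sum>j<k. \<phi> $$ (i', j) * d i j)"
    if "i < k" "i' < Suc k" for i i'
    using that unfolding Q_def by blast
  define P where "P = mat k k (\<lambda>(i, j). \<phi> $$ (Suc i, j))"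
  define D where "D = mat k k (\<lambda>(j, i). d i j)"
  have P: "P \<in> carrier_mat k k" and D: "D \<in> carrier_mat k k"
    by (simp_all add: P_def D_def)
  have "P * D = f $ 0 \<cdot>\<^sub>m 1\<^sub>m k"
  proof (rule eq_matI)
    fix i i' assume "i < dim_row (f $ 0 \<cdot>\<^sub>m 1\<^sub>m k)" "i' < dim_col (f $ 0 \<cdot>\<^sub>m 1\<^sub>m k)"
    then have ii: "i < k" "i' < k"
      by auto
    have "(P * D) $$ (i, i') = (\<Sum>j<k. \<phi> $$ (Suc i, j) * d i' j)"
      using ii by (simp add: P_def D_def scalar_prod_def atLeast0LessThan)
    also have "\<dots> = (if i = i' then f $ 0 else 0)"
      using d[OF ii(2), of "Suc i"] ii by (cases "i = i'") simp_all
    finally show "(P * D) $$ (i, i') = (f $ 0 \<cdot>\<^sub>m 1\<^sub>m k) $$ (i, i')"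
      using ii by simp
  qed (use P D in auto)
  then have "det P * det D = f $ 0 ^ k"
    using det_mult[OF P D] by (simp add: det_smult)
  then have "det P \<noteq> 0"
    using f(3) by auto
  have "P *\<^sub>v vec k c = 0\<^sub>v k"
    using c(1) by (intro eq_vecI) (auto simp: P_def scalar_prod_sum[of _ k])
  moreover have "adj_mat P *\<^sub>v 0\<^sub>v k = 0\<^sub>v k"
    using adj_mat(1)[OF P] by (intro eq_vecI) auto
  ultimately have "(adj_mat P * P) *\<^sub>v vec k c = 0\<^sub>v k"
    using P adj_mat(1)[OF P] by (simp add: assoc_mult_mat_vec[of _ k k _ k])
  then have "(det P \<cdot>\<^sub>m 1\<^sub>m k) *\<^sub>v vec k c = 0\<^sub>v k"
    using adj_mat(3)[OF P] by simp
  moreover have "((det P \<cdot>\<^sub>m 1\<^sub>m k) *\<^sub>v vec k c) $ j = det P * c j"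
    using c(2) by (simp add: scalar_prod_sum[of _ k] if_distrib if_distribR cong: if_cong)
  ultimately show ?thesis
    using \<open>det P \<noteq> 0\<close> c(2) by simp
qed

section \<open>Shape of the entries of the matrix\<close>

lemma homogeneous_1_xy:
  fixes p :: "'k::comm_ring_1 mpoly"
  assumes "p \<in> carrier (mpoly_ring {Vx, Vy})" "homogeneous 1 p"
  shows "p = Const (Poly_Mapping.lookup p (Poly_Mapping.single Vx 1)) * Var Vx
    + Const (Poly_Mapping.lookup p (Poly_Mapping.single Vy 1)) * Var Vy"
proof -
  have keys: "m = Poly_Mapping.single Vx 1 \<or> m = Poly_Mapping.single Vy 1" if m: "m \<in> Poly_Mapping.keys p" for m
  proof -
    have sub: "Poly_Mapping.keys m \<subseteq> {Vx, Vy}"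
      using assms(1) m by (auto simp: carrier_mpoly_ring)
    have "(\<Sum>v\<in>Poly_Mapping.keys m. Poly_Mapping.lookup m v) = (\<Sum>v\<in>{Vx, Vy}. Poly_Mapping.lookup m v)"
      using sub by (intro sum.mono_neutral_left) (auto simp: in_keys_iff)
    then have deg: "Poly_Mapping.lookup m Vx + Poly_Mapping.lookup m Vy = 1"
      using assms(2) m by (simp add: homogeneous_def)
    have other: "Poly_Mapping.lookup m v = 0" if "v \<noteq> Vx" "v \<noteq> Vy" for v
      using sub that by (auto simp: in_keys_iff)
    show ?thesis
    proof (cases "Poly_Mapping.lookup m Vx = 1")
      case True
      then have "Poly_Mapping.lookup m v = Poly_Mapping.lookup (Poly_Mapping.single Vx 1) v" for v
        using deg other[of v] by (cases "v = Vx"; cases "v = Vy") (auto simp: lookup_single when_def)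
      then have "m = Poly_Mapping.single Vx 1"
        by (rule poly_mapping_eqI)
      then show ?thesis ..
    next
      case False
      then have "Poly_Mapping.lookup m v = Poly_Mapping.lookup (Poly_Mapping.single Vy 1) v" for v
        using deg other[of v] by (cases "v = Vx"; cases "v = Vy") (auto simp: lookup_single when_def)
      then have "m = Poly_Mapping.single Vy 1"
        by (rule poly_mapping_eqI)
      then show ?thesis ..
    qed
  qed
  have neq: "Poly_Mapping.single Vx (1 :: nat) \<noteq> Poly_Mapping.single Vy 1"
    by (metis lookup_single_eq lookup_single_not_eq var.distinct(1) zero_neq_one)
  show ?thesis
  proof (rule poly_mapping_eqI)
    fix m
    show "Poly_Mapping.lookup p m = Poly_Mapping.lookup
      (Const (Poly_Mapping.lookup p (Poly_Mapping.single Vx 1)) * Var Vx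
       + Const (Poly_Mapping.lookup p (Poly_Mapping.single Vy 1)) * Var Vy) m"
      using keys[of m] neq
      by (auto simp: Const_def Var_def mult_single lookup_add lookup_single when_def in_keys_iff)
  qed
qed

text \<open>A quadratic monomial other than \<open>z\<^sup>2\<close> involves \<open>x\<close> or \<open>y\<close>.\<close>

lemma const_part_homogeneous_2:
  fixes p :: "'k::comm_ring_1 mpoly"
  assumes "p \<in> carrier Rxyz" "homogeneous 2 p" "Poly_Mapping.lookup p (Poly_Mapping.single Vz 2) = 0"
  shows "const_part Vx Vy p = 0"
  unfolding subst_def
proof (rule sum.neutral, rule ballI)
  fix m assume m: "m \<in> Poly_Mapping.keys p"
  have sub: "Poly_Mapping.keys m \<subseteq> {Vx, Vy, Vz}"
    using assms(1) m by (auto simp: carrier_mpoly_ring)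
  have "\<exists>v\<in>Poly_Mapping.keys m. v \<noteq> Vz"
  proof (rule ccontr)
    assume "\<not> ?thesis"
    then have K: "Poly_Mapping.keys m \<subseteq> {Vz}"
      by auto
    then have "(\<Sum>v\<in>Poly_Mapping.keys m. Poly_Mapping.lookup m v) = (\<Sum>v\<in>{Vz}. Poly_Mapping.lookup m v)"
      by (intro sum.mono_neutral_left) (auto simp: in_keys_iff)
    then have "Poly_Mapping.lookup m Vz = 2"
      using assms(2) m by (simp add: homogeneous_def)
    moreover have "Poly_Mapping.lookup m v = 0" if "v \<noteq> Vz" for v
      using K that by (auto simp: in_keys_iff)
    ultimately have "m = Poly_Mapping.single Vz 2"
      by (intro poly_mapping_eqI) (auto simp: lookup_single when_def)
    then show False
      using m assms(3) by (simp add: in_keys_iff)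
  qed
  then obtain v where v: "v \<in> Poly_Mapping.keys m" "v = Vx \<or> v = Vy"
    using sub by auto
  then have "(Var(Vx := 0, Vy := 0)) v ^ Poly_Mapping.lookup m v = (0 :: 'k mpoly)"
    by (auto simp: in_keys_iff zero_power)
  with v(1) have "(\<Prod>v\<in>Poly_Mapping.keys m. (Var(Vx := 0, Vy := 0)) v ^ Poly_Mapping.lookup m v) = (0 :: 'k mpoly)"
    by (metis (no_types, lifting) finite_keys prod_zero)
  then show "Const (Poly_Mapping.lookup p m) *
      (\<Prod>v\<in>Poly_Mapping.keys m. (Var(Vx := 0, Vy := 0)) v ^ Poly_Mapping.lookup m v) = 0"
    by simp
qed

section \<open>Linear type away from the line \<open>x = y = 0\<close>\<close>

text \<open>A binary form vanishing at \<open>(- \<beta>, \<alpha>)\<close> is a multiple of \<open>\<alpha> u + \<beta> v\<close>, up to powers of \<open>\<Lambda>\<close>, if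
  \<open>\<alpha>, \<beta>\<close> is a regular sequence up to \<open>\<Lambda>\<close>: comparing the extreme coefficients, one splits off
  multiples of \<open>\<alpha> u + \<beta> v\<close>.\<close>

lemma binary_form_multiple:
  fixes \<alpha> \<beta> \<Lambda> u v :: "'k::field mpoly"
  assumes R: "\<alpha> \<in> carrier (mpoly_ring V)" "\<beta> \<in> carrier (mpoly_ring V)" "\<Lambda> \<in> carrier (mpoly_ring V)"
    and nz: "\<beta> \<noteq> 0"
    and reg: "\<And>c d. c \<in> carrier (mpoly_ring V) \<Longrightarrow> d \<in> carrier (mpoly_ring V) \<Longrightarrow> c * \<alpha> = d * \<beta> \<Longrightarrow>
      \<exists>e\<in>carrier (mpoly_ring V). \<Lambda> * c = e * \<beta>"
    and h: "\<And>i. h i \<in> carrier (mpoly_ring V)" "(\<Sum>i\<le>d. h i * (- \<beta>) ^ i * \<alpha> ^ (d - i)) = 0"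
  shows "\<exists>N c. \<Lambda> ^ N * (\<Sum>i\<le>d. h i * u ^ i * v ^ (d - i)) = (\<alpha> * u + \<beta> * v) * c"
  using h
proof (induction d arbitrary: h)
  case 0
  then show ?case
    by (intro exI[of _ 0]) simp
next
  case (Suc d)
  have reg_power: "\<exists>e\<in>carrier (mpoly_ring V). \<Lambda> ^ k * c = e * \<beta>"
    if "c \<in> carrier (mpoly_ring V)" "s \<in> carrier (mpoly_ring V)" "c * \<alpha> ^ k = s * \<beta>" for k c s
    using that
  proof (induction k arbitrary: c s)
    case 0
    then show ?case by auto
  next
    case (Suc k)
    have "(c * \<alpha> ^ k) * \<alpha> = s * \<beta>"
      using Suc.prems(3) by (simp add: mult_ac)
    then obtain e where e: "e \<in> carrier (mpoly_ring V)" "\<Lambda> * (c * \<alpha> ^ k) = e * \<beta>"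
      using reg[of "c * \<alpha> ^ k" s] Suc.prems R by auto
    then have "(\<Lambda> * c) * \<alpha> ^ k = e * \<beta>"
      by (simp add: mult.assoc)
    then obtain e' where "e' \<in> carrier (mpoly_ring V)" "\<Lambda> ^ k * (\<Lambda> * c) = e' * \<beta>"
      using Suc.IH[of "\<Lambda> * c" e] e Suc.prems(1) R by auto
    then show ?case
      by (intro bexI[of _ e']) (simp_all add: mult_ac)
  qed
  let ?s = "\<Sum>i\<le>d. h (Suc i) * (- \<beta>) ^ i * \<alpha> ^ (d - i)"
  have s: "?s \<in> carrier (mpoly_ring V)"
    using Suc.prems(1) R by (intro sum_carrier mult_carrier power_carrier uminus_carrier)
  have split: "h 0 * \<alpha> ^ Suc d - \<beta> * ?s = 0"
    using Suc.prems(2) by (subst (asm) sum.atMost_Suc_shift) (simp add: sum_distrib_left sum_negf mult_ac)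
  then have "h 0 * \<alpha> ^ Suc d = ?s * \<beta>"
    by (simp add: mult.commute)
  then obtain e where e: "e \<in> carrier (mpoly_ring V)" "\<Lambda> ^ Suc d * h 0 = e * \<beta>"
    using reg_power[OF Suc.prems(1) s] by blast
  \<comment> \<open>subtracting \<open>e v\<^sup>d (\<alpha> u + \<beta> v)\<close> from \<open>\<Lambda>\<^sup>d\<^sup>+\<^sup>1\<close> times the form cancels the term \<open>v\<^sup>d\<^sup>+\<^sup>1\<close>; these are
    the coefficients of the quotient by \<open>u\<close>\<close>
  define h' where "h' i = \<Lambda> ^ Suc d * h (Suc i) - (if i = 0 then e * \<alpha> else 0)" for i
  have h'C: "h' i \<in> carrier (mpoly_ring V)" for i
    unfolding h'_def using Suc.prems(1) R e(1) by (intro diff_carrier mult_carrier power_carrier) auto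
  have sum_h': "(\<Sum>i\<le>d. h' i * p ^ i * r ^ (d - i))
    = \<Lambda> ^ Suc d * (\<Sum>i\<le>d. h (Suc i) * p ^ i * r ^ (d - i)) - e * \<alpha> * r ^ d" for p r
  proof -
    have "(\<Sum>i\<le>d. (if i = 0 then e * \<alpha> else 0) * p ^ i * r ^ (d - i)) = e * \<alpha> * r ^ d"
      by (simp add: if_distrib[of "\<lambda>z. z * _"] cong: if_cong)
    then show ?thesis
      by (simp add: h'_def left_diff_distrib sum_subtractf sum_distrib_left mult.assoc del: power_Suc)
  qed
  have "\<beta> * (\<Sum>i\<le>d. h' i * (- \<beta>) ^ i * \<alpha> ^ (d - i)) = \<Lambda> ^ Suc d * (\<beta> * ?s) - (e * \<beta>) * \<alpha> ^ Suc d"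
    unfolding sum_h' by (simp add: right_diff_distrib mult_ac)
  also have "\<dots> = - (\<Lambda> ^ Suc d * (h 0 * \<alpha> ^ Suc d - \<beta> * ?s))"
    unfolding e(2)[symmetric] by (simp only: right_diff_distrib mult.assoc minus_diff_eq)
  finally have "(\<Sum>i\<le>d. h' i * (- \<beta>) ^ i * \<alpha> ^ (d - i)) = 0"
    unfolding split using nz by simp
  from Suc.IH[OF h'C this] obtain N c where
    c: "\<Lambda> ^ N * (\<Sum>i\<le>d. h' i * u ^ i * v ^ (d - i)) = (\<alpha> * u + \<beta> * v) * c"
    by blast
  have "(\<Sum>i\<le>Suc d. h i * u ^ i * v ^ (Suc d - i))
    = h 0 * v ^ Suc d + u * (\<Sum>i\<le>d. h (Suc i) * u ^ i * v ^ (d - i))"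
    by (subst sum.atMost_Suc_shift) (simp add: sum_distrib_left mult_ac)
  then have "\<Lambda> ^ Suc d * (\<Sum>i\<le>Suc d. h i * u ^ i * v ^ (Suc d - i))
    = (\<Lambda> ^ Suc d * h 0) * v ^ Suc d + u * (\<Lambda> ^ Suc d * (\<Sum>i\<le>d. h (Suc i) * u ^ i * v ^ (d - i)))"
    by (simp only: distrib_left mult_ac)
  also have "\<dots> = (\<alpha> * u + \<beta> * v) * (e * v ^ d) + u * (\<Sum>i\<le>d. h' i * u ^ i * v ^ (d - i))"
    unfolding e(2) sum_h' by (simp add: algebra_simps)
  finally have "\<Lambda> ^ (N + Suc d) * (\<Sum>i\<le>Suc d. h i * u ^ i * v ^ (Suc d - i))
    = \<Lambda> ^ N * ((\<alpha> * u + \<beta> * v) * (e * v ^ d)) + u * (\<Lambda> ^ N * (\<Sum>i\<le>d. h' i * u ^ i * v ^ (d - i)))"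
    by (simp only: power_add mult.assoc distrib_left mult.left_commute[of u])
  also have "\<dots> = (\<alpha> * u + \<beta> * v) * (\<Lambda> ^ N * (e * v ^ d) + u * c)"
    unfolding c by (simp only: distrib_left mult_ac)
  finally show ?case
    by blast
qed

text \<open>The Rees map multiplies a form of degree \<open>d\<close> in the \<open>w\<^sub>i\<close> by \<open>t\<^sup>d\<close>, so the forms of different degrees
  in the expansion can be treated separately.\<close>

lemma two_variable_expansion:
  fixes s :: "'k::comm_ring_1 mpoly"
  assumes s: "s \<in> carrier (mpoly_ring (V \<union> {u, v}))" and uv: "u \<noteq> v" "u \<notin> V" "v \<notin> V" "finite V"
  obtains D h where "\<And>d i. h d i \<in> carrier (mpoly_ring V)"
    "s = (\<Sum>d<D. \<Sum>i\<le>d. h d i * Var u ^ i * Var v ^ (d - i))"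
proof -
  let ?sum = "\<lambda>D h. \<Sum>d<D. \<Sum>i\<le>d. h d i * Var u ^ i * Var v ^ (d - i)"
  let ?P = "\<lambda>s. \<exists>D h. (\<forall>d i. h d i \<in> carrier (mpoly_ring V)) \<and> (\<forall>d\<ge>D. \<forall>i. h d i = 0) \<and> s = ?sum D h"
  have extend: "?sum D h = ?sum D' h" if "D \<le> D'" "\<forall>d\<ge>D. \<forall>i. h d i = 0" for D D' :: nat and h :: "nat \<Rightarrow> nat \<Rightarrow> 'k mpoly"
    using that by (intro sum.mono_neutral_left) auto
  have add: "?P (s1 + s2)" if "?P s1" "?P s2" for s1 s2 :: "'k mpoly"
  proof -
    obtain D1 h1 D2 h2 where *: "\<forall>d i. h1 d i \<in> carrier (mpoly_ring V)" "\<forall>d\<ge>D1. \<forall>i. h1 d i = 0" "s1 = ?sum D1 h1"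
      "\<forall>d i. h2 d i \<in> carrier (mpoly_ring V)" "\<forall>d\<ge>D2. \<forall>i. h2 d i = 0" "s2 = ?sum D2 h2"
      using \<open>?P s1\<close> \<open>?P s2\<close> by blast
    let ?D = "max D1 D2"
    have "s1 = ?sum ?D h1" "s2 = ?sum ?D h2"
      using extend[of D1 ?D h1] extend[of D2 ?D h2] * by simp_all
    then have "s1 + s2 = ?sum ?D (\<lambda>d i. h1 d i + h2 d i)"
      by (simp add: sum.distrib distrib_right)
    then show ?thesis
      using * by (intro exI[of _ ?D] exI[of _ "\<lambda>d i. h1 d i + h2 d i"]) auto
  qed
  have mono: "?P (Poly_Mapping.single m c)" if m: "Poly_Mapping.keys m \<subseteq> V \<union> {u, v}" for m and c :: 'k
  proof -
    let ?i = "Poly_Mapping.lookup m u" and ?k = "Poly_Mapping.lookup m v"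
    define r where "r = Const c * (\<Prod>x\<in>V. Var x ^ Poly_Mapping.lookup m x)"
    have r: "r \<in> carrier (mpoly_ring V)"
      by (auto simp: r_def)
    have "Poly_Mapping.single m c = Const c * eval_monomial Var m"
      by (simp add: monomial_eq_prod eval_monomial_def)
    also have "eval_monomial Var m = (\<Prod>x\<in>V \<union> {u, v}. Var x ^ Poly_Mapping.lookup m x)"
      using m uv by (intro eval_monomial_superset) auto
    also have "\<dots> = (\<Prod>x\<in>V. Var x ^ Poly_Mapping.lookup m x) * (Var u ^ ?i * Var v ^ ?k)"
      using uv by (simp add: prod.union_disjoint)
    finally have eq: "Poly_Mapping.single m c = r * Var u ^ ?i * Var v ^ ?k"
      by (simp add: r_def mult.assoc)
    let ?h = "\<lambda>d i. if d = ?i + ?k \<and> i = ?i then r else 0"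
    have "?sum (Suc (?i + ?k)) ?h = (\<Sum>i\<le>?i + ?k. ?h (?i + ?k) i * Var u ^ i * Var v ^ (?i + ?k - i))"
      by (simp add: sum.neutral)
    also have "\<dots> = (\<Sum>i\<le>?i + ?k. if i = ?i then r * Var u ^ ?i * Var v ^ ?k else 0)"
      by (intro sum.cong) auto
    also have "\<dots> = Poly_Mapping.single m c"
      by (simp add: eq)
    finally show ?thesis
      using r by (intro exI[of _ "Suc (?i + ?k)"] exI[of _ ?h]) auto
  qed
  have zero: "?P (0 :: 'k mpoly)"
    by (intro exI[of _ 0] exI[of _ "\<lambda>_ _. 0"]) auto
  have "?P (\<Sum>m\<in>K. Poly_Mapping.single m (Poly_Mapping.lookup s m))"
    if "K \<subseteq> Poly_Mapping.keys s" for K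
    using finite_subset[OF that finite_keys] that
  proof (induction K rule: finite_induct)
    case empty
    then show ?case
      using zero by (simp only: sum.empty)
  next
    case (insert m K)
    have "?P (Poly_Mapping.single m (Poly_Mapping.lookup s m))"
      using insert.prems s by (intro mono) (auto simp: carrier_mpoly_ring)
    moreover have "?P (\<Sum>m\<in>K. Poly_Mapping.single m (Poly_Mapping.lookup s m))"
      by (rule insert.IH) (use insert.prems in auto)
    ultimately show ?case
      unfolding sum.insert[OF insert.hyps] by (rule add)
  qed
  from this[OF order_refl] show ?thesis
    unfolding sum_single_lookup using that by blast
qed

lemma coefficients_eq_0:
  fixes h :: "nat \<Rightarrow> 'k::field mpoly"
  assumes "\<And>d. d < D \<Longrightarrow> h d \<in> carrier (mpoly_ring V)" "v \<notin> V" "(\<Sum>d<D. Var v ^ d * h d) = 0" "d < D"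
  shows "h d = 0"
  using assms
proof (induction D arbitrary: h d)
  case (Suc D)
  have *: "(\<Sum>d<Suc D. Var v ^ d * h d) = h 0 + Var v * (\<Sum>d<D. Var v ^ d * h (Suc d))"
    by (subst sum.lessThan_Suc_shift) (simp add: sum_distrib_left mult.assoc)
  have "h 0 = subst (Var(v := 0)) (h 0)"
    by (rule subst_id_carrier[symmetric, OF Suc.prems(1)]) (use Suc.prems(2) in auto)
  also have "\<dots> = subst (Var(v := 0)) (\<Sum>d<Suc D. Var v ^ d * h d)"
    unfolding * by simp
  finally have h0: "h 0 = 0"
    by (simp only: Suc.prems(3) subst_0)
  then have tail: "(\<Sum>d<D. Var v ^ d * h (Suc d)) = 0"
    using * Suc.prems(3) by simp
  show ?case
  proof (cases d)
    case (Suc d')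
    have "h (Suc d') = 0"
      by (rule Suc.IH[of "\<lambda>d. h (Suc d)"]) (use Suc.prems Suc tail in auto)
    then show ?thesis
      using Suc by simp
  qed (simp add: h0)
qed simp

section \<open>The Rees ideal\<close>

locale case_III_setting =
  fixes n :: nat and f :: "'k::alg_closed_field mpoly vec" and \<phi> :: "'k mpoly mat"
  assumes setting: "setting n f \<phi>" and case_III: "case_III n \<phi>"
begin

definition A :: "nat \<Rightarrow> nat \<Rightarrow> 'k" where
  "A i j = Poly_Mapping.lookup (\<phi> $$ (i, j)) (Poly_Mapping.single Vx 1)"

definition B :: "nat \<Rightarrow> nat \<Rightarrow> 'k" where
  "B i j = Poly_Mapping.lookup (\<phi> $$ (i, j)) (Poly_Mapping.single Vy 1)"

definition F :: "'k mpoly" where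
  "F = l_form \<phi> (n - 2)"

lemma n_gt_4: "n > 4"
  and f_vec: "f \<in> carrier_vec n" and f_set: "set\<^sub>v f \<subseteq> carrier Rxyz"
  and min_gens_f: "min_gens Rxyz (gens_ideal f) = enat n"
  and \<phi>_mat: "\<phi> \<in> carrier_mat n (n - 1)" and \<phi>_elements: "elements_mat \<phi> \<subseteq> carrier Rxyz"
  and presents_\<phi>: "presents \<phi> f"
  using setting by (auto simp: setting_def)

lemma f_carrier: "i < n \<Longrightarrow> f $ i \<in> carrier Rxyz"
  using f_vec f_set by (auto simp: vec_set_def)

lemma \<phi>_carrier: "i < n \<Longrightarrow> j < n - 1 \<Longrightarrow> \<phi> $$ (i, j) \<in> carrier Rxyz"
  using \<phi>_mat \<phi>_elements by (force simp: elements_mat_def)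

lemma entry_eq: "i < n \<Longrightarrow> j < n - 2 \<Longrightarrow> \<phi> $$ (i, j) = Const (A i j) * Var Vx + Const (B i j) * Var Vy"
  using case_III unfolding A_def B_def case_III_def by (intro homogeneous_1_xy) auto

lemma scalar_independence: "(\<Sum>i<n. Const (c i) * f $ i) = 0 \<Longrightarrow> i < n \<Longrightarrow> c i = 0"
  by (rule minimal_generators_independent[OF f_vec f_set min_gens_f])

lemma f_nonzero: "i < n \<Longrightarrow> f $ i \<noteq> 0"
  using scalar_independence[of "\<lambda>i'. if i' = i then 1 else 0" i]
  by (auto simp: if_distrib if_distribR cong: if_cong)

lemma column_syzygy: "j < n - 1 \<Longrightarrow> (\<Sum>i<n. f $ i * \<phi> $$ (i, j)) = 0"
  by (rule presents_column[OF presents_\<phi> \<phi>_mat \<phi>_elements f_vec])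

text \<open>A scalar combination of the linear columns divisible by a linear form \<open>h\<close> gives, after division
  by \<open>h\<close>, a scalar syzygy of the generators, which is zero by minimality; and \<open>\<phi>\<close> is injective.  So
  the linear columns stay independent at every point of the projective line.\<close>

lemma columns_independent_mod:
  assumes h: "h \<noteq> 0" and c: "\<And>i. i < n \<Longrightarrow> (\<Sum>j<n - 2. \<phi> $$ (i, j) * Const (c j)) = h * Const (\<mu> i)"
    and j: "j < n - 2"
  shows "c j = 0"
proof -
  have "h * (\<Sum>i<n. Const (\<mu> i) * f $ i) = (\<Sum>i<n. f $ i * (h * Const (\<mu> i)))"
    by (simp add: sum_distrib_left mult_ac)
  also have "\<dots> = (\<Sum>i<n. f $ i * (\<Sum>j<n - 2. \<phi> $$ (i, j) * Const (c j)))"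
    by (intro sum.cong refl) (simp add: c)
  also have "\<dots> = (\<Sum>j<n - 2. (\<Sum>i<n. f $ i * \<phi> $$ (i, j)) * Const (c j))"
    unfolding sum_distrib_left sum_distrib_right by (subst sum.swap) (simp only: mult.assoc)
  also have "\<dots> = 0"
    by (simp add: column_syzygy)
  finally have "(\<Sum>i<n. Const (\<mu> i) * f $ i) = 0"
    using h by simp
  then have \<mu>: "\<mu> i = 0" if "i < n" for i
    using scalar_independence that by blast
  define c' where "c' j = (if j < n - 2 then Const (c j) else 0)" for j
  have n1: "n - 1 = Suc (n - 2)" "Suc (n - 1) = n"
    using n_gt_4 by auto
  have sum: "(\<Sum>j<n - 1. \<phi> $$ (i, j) * c' j) = 0" if "i < n" for i
    unfolding n1(1) using c[OF that] \<mu>[OF that] by (simp add: c'_def)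
  have "c' j = 0"
    by (rule presents_injective[of \<phi> f "n - 1"])
      (use presents_\<phi> \<phi>_mat f_vec f_set f_nonzero[of 0] n_gt_4 sum j in \<open>simp_all add: n1(2)\<close>)
  then show ?thesis
    using j by (simp add: c'_def)
qed

sublocale good_pencil n "n - 2" A B
proof
  show "independent_columns n (n - 2) A"
    unfolding independent_columns_def
  proof (intro allI impI)
    fix c j assume c: "\<forall>i<n. (\<Sum>j<n - 2. A i j * c j) = 0" and "j < n - 2"
    have "(\<Sum>j<n - 2. \<phi> $$ (i, j) * Const (c j)) = Var Vy * Const (\<Sum>j<n - 2. B i j * c j)" if i: "i < n" for i
    proof -
      have "\<phi> $$ (i, j) * Const (c j) = Var Vx * Const (A i j * c j) + Var Vy * Const (B i j * c j)"
        if "j < n - 2" for j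
        using entry_eq[OF i that] by (simp add: Const_mult algebra_simps)
      then have "(\<Sum>j<n - 2. \<phi> $$ (i, j) * Const (c j))
        = (\<Sum>j<n - 2. Var Vx * Const (A i j * c j) + Var Vy * Const (B i j * c j))"
        by (intro sum.cong) auto
      also have "\<dots> = Var Vx * Const (\<Sum>j<n - 2. A i j * c j) + Var Vy * Const (\<Sum>j<n - 2. B i j * c j)"
        by (simp only: sum.distrib Const_sum sum_distrib_left)
      finally have "(\<Sum>j<n - 2. \<phi> $$ (i, j) * Const (c j))
        = Var Vx * Const (\<Sum>j<n - 2. A i j * c j) + Var Vy * Const (\<Sum>j<n - 2. B i j * c j)" .
      then show ?thesis
        using c i by simp
    qed
    from columns_independent_mod[OF Var_nonzero this \<open>j < n - 2\<close>] show "c j = 0" .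
  qed
next
  fix e
  show "independent_columns n (n - 2) (\<lambda>i j. B i j + e * A i j)"
    unfolding independent_columns_def
  proof (intro allI impI)
    fix c j assume c: "\<forall>i<n. (\<Sum>j<n - 2. (B i j + e * A i j) * c j) = 0" and "j < n - 2"
    let ?h = "Var Vx - Const e * Var Vy :: 'k mpoly"
    have cols: "(\<Sum>j<n - 2. \<phi> $$ (i, j) * Const (c j)) = ?h * Const (\<Sum>j<n - 2. A i j * c j)" if i: "i < n" for i
    proof -
      have "\<phi> $$ (i, j) * Const (c j) = ?h * Const (A i j * c j) + Var Vy * Const ((B i j + e * A i j) * c j)"
        if "j < n - 2" for j
        using entry_eq[OF i that] by (simp add: Const_mult Const_add algebra_simps)
      then have "(\<Sum>j<n - 2. \<phi> $$ (i, j) * Const (c j))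
        = (\<Sum>j<n - 2. ?h * Const (A i j * c j) + Var Vy * Const ((B i j + e * A i j) * c j))"
        by (intro sum.cong) auto
      also have "\<dots> = ?h * Const (\<Sum>j<n - 2. A i j * c j) + Var Vy * Const (\<Sum>j<n - 2. (B i j + e * A i j) * c j)"
        by (simp only: sum.distrib Const_sum sum_distrib_left)
      finally show ?thesis
        using c i by simp
    qed
    have "?h \<noteq> 0"
    proof
      assume "?h = 0"
      then have "subst (Var(Vy := 0)) ?h = 0"
        by simp
      then show False
        by simp
    qed
    from columns_independent_mod[OF this cols \<open>j < n - 2\<close>] show "c j = 0" .
  qed
qed

lemma point_form_nonzero: "point_form e \<noteq> 0"
proof
  assume "point_form e = 0"
  then have "subst (Var(Vy := 0)) (point_form e) = 0"
    by simp
  then show False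
    by (simp add: point_form_def)
qed

lemma elimination:
  obtains t I p q where "eliminated_pencil n (n - 2) A B t I p q"
proof -
  obtain t I where piv: "pivot_inverse n (n - 2) A t I"
    using pivot_inverse_exists[OF independent_at_infinity] by blast
  then have "I \<subseteq> {..<n}" "card I = n - 2"
    by (auto simp: pivot_inverse_def)
  then have "card ({..<n} - I) = 2"
    using n_gt_4 by (simp add: card_Diff_subset finite_subset)
  then obtain p q where "{..<n} - I = {p, q}" "p \<noteq> q"
    by (auto simp: card_2_iff)
  then show ?thesis
    using that[of t I p q] piv good_pencil_axioms
    by (simp add: eliminated_pencil_def eliminated_pencil_axioms_def)
qed

lemma l_form_eq: "j < n - 1 \<Longrightarrow> l_form \<phi> j = (\<Sum>i<n. \<phi> $$ (i, j) * Var (Vw i))"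
  using \<phi>_mat by (auto simp: l_form_def scalar_prod_sum[of _ n] mult.commute)

lemma l_eq_l_form: "j < n - 2 \<Longrightarrow> l j = l_form \<phi> j"
  unfolding l_def linear_form_def sum_distrib_left sum.distrib[symmetric]
  by (simp add: l_form_eq, intro sum.cong refl) (simp add: entry_eq algebra_simps)

lemma F_eq: "F = (\<Sum>i<n. \<phi> $$ (i, n - 2) * Var (Vw i))"
  unfolding F_def using n_gt_4 by (intro l_form_eq) simp

lemma low_F: "low F = Var Vz ^ 2 * Var (Vw 0)"
proof -
  have "low (\<phi> $$ (i, n - 2)) = 0" if "i < n" "i \<noteq> 0" for i
    using case_III that unfolding case_III_def by (intro const_part_homogeneous_2) auto
  moreover have "\<phi> $$ (0, n - 2) = Var Vz ^ 2"
    using case_III by (simp add: case_III_def)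
  ultimately have "low F = (\<Sum>i<n. if i = 0 then Var Vz ^ 2 * Var (Vw 0) else 0)"
    unfolding F_eq subst_sum by (intro sum.cong) auto
  then show ?thesis
    using n_gt_4 by simp
qed

text \<open>The Rees map, extended from \<open>S\<close> to all variables so that it can be applied to \<open>L\<close> and \<open>J\<close>.\<close>

definition \<rho> :: "'k mpoly \<Rightarrow> 'k mpoly" where
  "\<rho> = subst (\<lambda>v. case v of Vw i \<Rightarrow> if i < n then f $ i * Var Vt else 0 | _ \<Rightarrow> Var v)"

lemma \<rho>_hom [simp]: "\<rho> (p + q) = \<rho> p + \<rho> q" "\<rho> (p * q) = \<rho> p * \<rho> q" "\<rho> (p - q) = \<rho> p - \<rho> q"
  "\<rho> 0 = 0" "\<rho> (sum g K) = (\<Sum>i\<in>K. \<rho> (g i))" "\<rho> (p ^ k) = \<rho> p ^ k" "\<rho> (Const c) = Const c"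
  "\<rho> (Var Vx) = Var Vx" "\<rho> (Var Vy) = Var Vy" "\<rho> (Var Vz) = Var Vz"
  "i < n \<Longrightarrow> \<rho> (Var (Vw i)) = f $ i * Var Vt"
  by (simp_all add: \<rho>_def)

lemma \<rho>_base: "p \<in> carrier Rxyz \<Longrightarrow> \<rho> p = p"
  unfolding \<rho>_def by (rule subst_id_carrier) auto

lemma \<rho>_eq_Rees_map: "p \<in> carrier (S_ring n) \<Longrightarrow> \<rho> p = Rees_map f p"
  unfolding \<rho>_def Rees_map_def S_ring_def by (rule subst_cong_carrier) auto

lemma \<rho>_linear:
  assumes "\<And>i. i < n \<Longrightarrow> c i \<in> carrier Rxyz"
  shows "\<rho> (\<Sum>i<n. c i * Var (Vw i)) = (\<Sum>i<n. f $ i * c i) * Var Vt"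
  using assms by (simp add: \<rho>_base sum_distrib_left sum_distrib_right mult_ac)

lemma \<rho>_l_form: "j < n - 1 \<Longrightarrow> \<rho> (l_form \<phi> j) = 0"
  unfolding l_form_eq using column_syzygy \<phi>_carrier by (subst \<rho>_linear) auto

lemma \<rho>_F: "\<rho> F = 0"
  unfolding F_def using n_gt_4 by (intro \<rho>_l_form) simp

lemma \<rho>_L: "u \<in> L \<Longrightarrow> \<rho> u = 0"
  unfolding L_def using \<rho>_l_form by (elim lin_idealE) (simp add: l_eq_l_form)

lemma \<rho>_J: "u \<in> J \<Longrightarrow> \<rho> u = 0"
  using \<rho>_L[of "Var Vx * u"] by (simp add: J_def)

lemma z2w0_not_in_J: "Var Vz ^ 2 * Var (Vw 0) \<notin> J"
  using \<rho>_J[of "Var Vz ^ 2 * Var (Vw 0)"] f_nonzero[of 0] n_gt_4 by auto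

lemma low_F_not_in_J: "low F \<notin> J"
  by (simp only: low_F z2w0_not_in_J not_False_eq_True)

text \<open>In degree one in the \<open>w\<^sub>i\<close>, the Rees ideal is generated by the columns of \<open>\<phi>\<close>.\<close>

lemma syzygy_mod_L:
  assumes c: "\<And>i. i < n \<Longrightarrow> c i \<in> carrier Rxyz" "(\<Sum>i<n. f $ i * c i) = 0"
  obtains \<delta> where "\<delta> \<in> carrier Rxyz" "(\<Sum>i<n. c i * Var (Vw i)) - F * \<delta> \<in> L"
proof -
  obtain d where d: "\<And>j. d j \<in> carrier Rxyz" "\<And>i. i < n \<Longrightarrow> c i = (\<Sum>j<n - 1. \<phi> $$ (i, j) * d j)"
    using presents_syzygy[OF presents_\<phi> \<phi>_mat f_vec c] by blast
  have n1: "n - 1 = Suc (n - 2)"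
    using n_gt_4 by simp
  have "(\<Sum>i<n. c i * Var (Vw i)) = (\<Sum>i<n. \<Sum>j<n - 1. \<phi> $$ (i, j) * d j * Var (Vw i))"
    by (simp add: d(2) sum_distrib_right)
  also have "\<dots> = (\<Sum>j<n - 1. l_form \<phi> j * d j)"
    by (subst sum.swap, intro sum.cong refl)
      (simp add: l_form_eq sum_distrib_left sum_distrib_right mult_ac)
  also have "\<dots> = (\<Sum>j<n - 2. l j * d j) + F * d (n - 2)"
    unfolding n1 by (simp add: F_def l_eq_l_form)
  finally have "(\<Sum>i<n. c i * Var (Vw i)) - F * d (n - 2) = (\<Sum>j<n - 2. l j * d j)"
    by simp
  then have "(\<Sum>i<n. c i * Var (Vw i)) - F * d (n - 2) \<in> L"
    unfolding L_def by (rule lin_idealI)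
  with d(1) show ?thesis
    by (rule that)
qed

text \<open>If \<open>F\<close> vanished at a point of the pencil, division by \<open>x - e y\<close> would give a syzygy showing
  that \<open>F\<close> is torsion modulo the other columns, against the rank of \<open>\<phi>\<close>.\<close>

lemma \<chi>_F_nonzero: "\<chi> e F \<noteq> 0"
proof
  assume "\<chi> e F = 0"
  have "\<phi> $$ (i, n - 2) \<in> carrier Rxyz" if "i < n" for i
    using \<phi>_carrier[OF that, of "n - 2"] n_gt_4 by simp
  from \<chi>_linear_eq_0D[OF this F_eq \<open>\<chi> e F = 0\<close>] obtain \<nu> d where
    \<nu>: "\<And>i. i < n \<Longrightarrow> \<nu> i \<in> carrier Rxyz"
    and eq: "y * F - point_form e * (\<Sum>i<n. \<nu> i * Var (Vw i)) = (\<Sum>j<n - 2. l j * d j)"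
    by blast
  let ?W = "\<Sum>i<n. \<nu> i * Var (Vw i)"
  have mem: "y * F - point_form e * ?W \<in> L"
    unfolding eq L_def by (rule lin_idealI) simp
  have fac: "\<rho> (point_form e) = point_form e"
    by (simp add: point_form_def)
  have "\<rho> (y * F - point_form e * ?W) = 0"
    by (rule \<rho>_L[OF mem])
  then have "\<rho> ?W = 0"
    using fac \<rho>_F point_form_nonzero by simp
  then have "(\<Sum>i<n. f $ i * \<nu> i) = 0"
    using \<rho>_linear[OF \<nu>] by simp
  then obtain \<delta> where \<delta>: "\<delta> \<in> carrier Rxyz" "?W - F * \<delta> \<in> L"
    using syzygy_mod_L[of \<nu>, OF \<nu>] by blast
  have "(y * F - point_form e * ?W) + point_form e * (?W - F * \<delta>) \<in> L"
    by (intro ideal_setD(2)[OF L_ideal mem] ideal_setD(3)[OF L_ideal \<delta>(2)])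
  then have "(y - point_form e * \<delta>) * F \<in> L"
    by (simp add: algebra_simps)
  then have prod: "(y - point_form e * \<delta>) * F \<in> J"
    using L_subset_J by blast
  obtain t I p q where "eliminated_pencil n (n - 2) A B t I p q"
    by (rule elimination)
  then interpret eliminated_pencil n "n - 2" A B t I p q .
  have "F \<notin> J"
    using low_F_not_in_J low_in_J by blast
  then have "y - point_form e * \<delta> \<in> J"
    using J_prime prod by blast
  from \<chi>_J[OF this, of e] show False
    by simp
qed

text \<open>Modulo the linear columns and up to a power of a product \<open>\<Lambda>\<close> of linear forms in \<open>x, y\<close>, only two
  of the \<open>w\<^sub>i\<close> survive, and \<open>F\<close> becomes \<open>\<alpha> w\<^sub>p + \<beta> w\<^sub>q\<close>.  Exactness of the presentation says that all
  syzygies of \<open>f\<^sub>p, f\<^sub>q\<close> are multiples of \<open>(\<alpha>, \<beta>)\<close>; applied to the syzygy \<open>(f\<^sub>q, - f\<^sub>p)\<close> this makes \<open>\<alpha>, \<beta>\<close>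
  a regular sequence and \<open>(f\<^sub>p, f\<^sub>q)\<close> proportional to \<open>(- \<beta>, \<alpha>)\<close>.  So the ideal is of linear type
  there, and \<open>\<Lambda>\<close> can be cancelled.\<close>

lemma Rees_ideal_mod_J:
  assumes s: "s \<in> carrier (S_ring n)" "\<rho> s = 0"
  shows "\<exists>c. s - F * c \<in> J"
proof -
  obtain t I p q where "eliminated_pencil n (n - 2) A B t I p q"
    by (rule elimination)
  then interpret eliminated_pencil n "n - 2" A B t I p q .
  have pq: "p < n" "q < n"
    using nonpivots by auto
  obtain es where es: "reducing_factors es"
    using linear_reduction by blast
  define \<Lambda> where "\<Lambda> = (\<Prod>e\<leftarrow>es. point_form e)"
  let ?R = "carrier (Rxyz :: 'k mpoly ring)"
  let ?w = "\<lambda>c d. c * Var (Vw p) + d * Var (Vw q)"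
  have "point_form e \<in> ?R" for e
    unfolding point_form_def by (intro diff_carrier mult_carrier) auto
  then have \<Lambda>R: "\<Lambda> \<in> ?R"
    unfolding \<Lambda>_def by (induction es) auto
  have "(\<Prod>e\<leftarrow>es'. point_form e) \<noteq> 0" for es'
    by (induction es') (auto simp: point_form_nonzero)
  then have \<Lambda>0: "\<Lambda> \<noteq> 0"
    by (simp add: \<Lambda>_def)
  define Q where "Q i r s \<longleftrightarrow> r \<in> ?R \<and> s \<in> ?R \<and> \<Lambda> * Var (Vw i) - ?w r s \<in> L" for i r s
  have "\<exists>r s. Q i r s" if i: "i < n" for i
  proof -
    have "{Vx, Vy} \<subseteq> {Vx, Vy, Vz}"
      by auto
    note mono = carrier_mono[OF this]
    obtain r s where "r \<in> carrier (mpoly_ring {Vx, Vy})" "s \<in> carrier (mpoly_ring {Vx, Vy})"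
      "\<Lambda> * Var (Vw i) - ?w r s \<in> L"
      using es i unfolding reducing_factors_def \<Lambda>_def by blast
    then show ?thesis
      using mono unfolding Q_def by blast
  qed
  then obtain r' s' where "\<And>i. i < n \<Longrightarrow> Q i (r' i) (s' i)"
    by metis
  then have rs: "\<And>i. i < n \<Longrightarrow> r' i \<in> ?R" "\<And>i. i < n \<Longrightarrow> s' i \<in> ?R"
    "\<And>i. i < n \<Longrightarrow> \<Lambda> * Var (Vw i) - ?w (r' i) (s' i) \<in> L"
    unfolding Q_def by blast+
  define \<alpha> where "\<alpha> = (\<Sum>i<n. \<phi> $$ (i, n - 2) * r' i)"
  define \<beta> where "\<beta> = (\<Sum>i<n. \<phi> $$ (i, n - 2) * s' i)"
  have \<phi>R: "\<phi> $$ (i, n - 2) \<in> ?R" if "i < n" for i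
    using \<phi>_carrier[OF that, of "n - 2"] n_gt_4 by simp
  have \<alpha>R: "\<alpha> \<in> ?R" and \<beta>R: "\<beta> \<in> ?R"
    unfolding \<alpha>_def \<beta>_def using \<phi>R rs by (auto intro!: sum_carrier mult_carrier)
  have \<Lambda>F: "\<Lambda> * F - ?w \<alpha> \<beta> \<in> L"
  proof -
    have "\<Lambda> * F - ?w \<alpha> \<beta> = (\<Sum>i<n. \<phi> $$ (i, n - 2) * (\<Lambda> * Var (Vw i) - ?w (r' i) (s' i)))"
      by (simp add: F_eq \<alpha>_def \<beta>_def sum_distrib_left sum_distrib_right right_diff_distrib distrib_left
          sum_subtractf sum.distrib mult_ac)
    also have "\<dots> \<in> L"
      by (intro ideal_set_sum[OF L_ideal] ideal_setD(3)[OF L_ideal] rs) auto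
    finally show ?thesis .
  qed
  have w_reduced: "?w c d \<in> reduced ({Vx, Vy, Vz} \<union> Vw ` {..<n})" if "c \<in> ?R" "d \<in> ?R" for c d
  proof -
    have "c \<in> reduced ({Vx, Vy, Vz} \<union> Vw ` {..<n})" "d \<in> reduced ({Vx, Vy, Vz} \<union> Vw ` {..<n})"
      using that by (auto elim!: carrier_mono[rotated])
    moreover have "p \<notin> I" "q \<notin> I"
      using nonpivots by auto
    ultimately show ?thesis
      using pq by (intro add_carrier mult_carrier) auto
  qed
  have w_zero: "c = 0 \<and> d = 0" if "c \<in> ?R" "d \<in> ?R" "?w c d \<in> J" for c d
  proof -
    have 0: "?w c d = 0"
      by (rule reduced_in_J_eq_0[OF w_reduced]) (use that in auto)
    have base: "subst (Var(Vw p := u, Vw q := v)) c' = c'" if "c' \<in> ?R" for c' u v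
      using that by (rule subst_id_carrier) auto
    have "subst (Var(Vw p := 1, Vw q := 0)) (?w c d) = c" "subst (Var(Vw p := 0, Vw q := 1)) (?w c d) = d"
      using nonpivots(2) by (simp_all add: base that)
    then show ?thesis
      unfolding 0 by simp
  qed
  have syz: "\<exists>\<delta>\<in>?R. \<Lambda> * c = \<delta> * \<alpha> \<and> \<Lambda> * d = \<delta> * \<beta>"
    if cd: "c \<in> ?R" "d \<in> ?R" "c * f $ p + d * f $ q = 0" for c d
  proof -
    let ?c = "\<lambda>i. if i = p then c else if i = q then d else 0"
    have sums: "(\<Sum>i<n. g i * ?c i) = g p * c + g q * d" for g :: "nat \<Rightarrow> 'k mpoly"
    proof -
      have "(\<Sum>i<n. g i * ?c i) = (\<Sum>i\<in>{p, q}. g i * ?c i)"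
        using pq by (intro sum.mono_neutral_right) auto
      then show ?thesis
        using nonpivots(2) by simp
    qed
    have "(\<Sum>i<n. f $ i * ?c i) = 0"
      using cd(3) by (simp only: sums mult.commute)
    moreover have "?c i \<in> ?R" if "i < n" for i
      using cd by simp
    ultimately obtain \<delta> where \<delta>: "\<delta> \<in> ?R" "(\<Sum>i<n. ?c i * Var (Vw i)) - F * \<delta> \<in> L"
      using syzygy_mod_L[of ?c] by blast
    have "(\<Sum>i<n. ?c i * Var (Vw i)) = ?w c d"
      using sums[of "\<lambda>i. Var (Vw i)"] by (simp only: mult.commute)
    then have "\<Lambda> * (?w c d - F * \<delta>) + \<delta> * (\<Lambda> * F - ?w \<alpha> \<beta>) \<in> L"
      using \<delta>(2) \<Lambda>F by (intro ideal_setD(2,3)[OF L_ideal]) simp_all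
    then have "?w (\<Lambda> * c - \<delta> * \<alpha>) (\<Lambda> * d - \<delta> * \<beta>) \<in> L"
      by (simp add: algebra_simps)
    then have "\<Lambda> * c - \<delta> * \<alpha> = 0 \<and> \<Lambda> * d - \<delta> * \<beta> = 0"
      using L_subset_J cd(1,2) \<delta>(1) \<Lambda>R \<alpha>R \<beta>R by (intro w_zero) auto
    then show ?thesis
      using \<delta>(1) by auto
  qed
  obtain r where r: "r \<in> ?R" "\<Lambda> * f $ q = r * \<alpha>" "\<Lambda> * - (f $ p) = r * \<beta>"
    using syz[of "f $ q" "- (f $ p)"] f_carrier pq by auto
  then have nz: "r \<noteq> 0" "\<beta> \<noteq> 0"
    using \<Lambda>0 f_nonzero[OF pq(1)] by auto
  have regular: "\<exists>e\<in>?R. \<Lambda> * c = e * \<beta>" if cd: "c \<in> ?R" "d \<in> ?R" "c * \<alpha> = d * \<beta>" for c d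
  proof -
    have "c * (r * \<alpha>) = d * (r * \<beta>)"
      using cd(3) by (metis mult.left_commute)
    then have "\<Lambda> * (d * f $ p + c * f $ q) = 0"
      unfolding r(2,3)[symmetric] by (simp add: algebra_simps)
    then have "d * f $ p + c * f $ q = 0"
      using \<Lambda>0 by simp
    then show ?thesis
      using syz[OF cd(2,1)] by blast
  qed
  obtain N0 s0 where s0: "s0 \<in> reduced ({Vx, Vy, Vz} \<union> Vw ` {..<n})" "\<Lambda> ^ N0 * s - s0 \<in> L"
    using reduction[OF es, of "{Vx, Vy, Vz} \<union> Vw ` {..<n}" s] s(1) pq unfolding \<Lambda>_def S_ring_def by auto
  have \<rho>s0: "\<rho> s0 = 0"
    using \<rho>_L[OF s0(2)] s(2) by simp
  have "({Vx, Vy, Vz} \<union> Vw ` {..<n}) - Vw ` I = {Vx, Vy, Vz} \<union> {Vw p, Vw q}"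
  proof -
    have "({Vx, Vy, Vz} \<union> Vw ` {..<n}) - Vw ` I = {Vx, Vy, Vz} \<union> Vw ` ({..<n} - I)"
      by auto
    then show ?thesis
      by (simp add: nonpivots(1))
  qed
  with s0(1) have s0': "s0 \<in> carrier (mpoly_ring ({Vx, Vy, Vz} \<union> {Vw p, Vw q}))"
    by simp
  have distinct: "Vw p \<noteq> Vw q" "Vw p \<notin> {Vx, Vy, Vz}" "Vw q \<notin> {Vx, Vy, Vz}" "finite {Vx, Vy, Vz}"
    using nonpivots(2) by auto
  obtain D h where h: "\<And>d i. h d i \<in> ?R"
    and s0_eq: "s0 = (\<Sum>d<D. \<Sum>i\<le>d. h d i * Var (Vw p) ^ i * Var (Vw q) ^ (d - i))"
    using two_variable_expansion[OF s0' distinct] by blast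
  have fR: "f $ p \<in> ?R" "f $ q \<in> ?R"
    using f_carrier pq by auto
  have "(\<Sum>d<D. Var Vt ^ d * (\<Sum>i\<le>d. h d i * f $ p ^ i * f $ q ^ (d - i))) = \<rho> s0"
  proof -
    have mono: "h d i * (f $ p * Var Vt) ^ i * (f $ q * Var Vt) ^ (d - i)
      = Var Vt ^ d * (h d i * f $ p ^ i * f $ q ^ (d - i))" if "i \<le> d" for d i
    proof -
      have "Var Vt ^ d = Var Vt ^ i * (Var Vt ^ (d - i) :: 'k mpoly)"
        using that by (simp flip: power_add)
      then show ?thesis
        by (simp add: power_mult_distrib mult_ac)
    qed
    have "\<rho> s0 = (\<Sum>d<D. \<Sum>i\<le>d. h d i * (f $ p * Var Vt) ^ i * (f $ q * Var Vt) ^ (d - i))"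
      unfolding s0_eq by (simp add: pq \<rho>_base[OF h])
    also have "\<dots> = (\<Sum>d<D. \<Sum>i\<le>d. Var Vt ^ d * (h d i * f $ p ^ i * f $ q ^ (d - i)))"
      by (intro sum.cong refl, rule mono) simp
    finally show ?thesis
      by (simp only: sum_distrib_left)
  qed
  then have zero: "(\<Sum>i\<le>d. h d i * f $ p ^ i * f $ q ^ (d - i)) = 0" if "d < D" for d
    using that fR h \<rho>s0
    by (intro coefficients_eq_0[of D "\<lambda>d. \<Sum>i\<le>d. h d i * f $ p ^ i * f $ q ^ (d - i)" "{Vx, Vy, Vz}" Vt d])
      (auto intro!: sum_carrier mult_carrier)
  have part: "\<exists>N c. \<Lambda> ^ N * (\<Sum>i\<le>d. h d i * Var (Vw p) ^ i * Var (Vw q) ^ (d - i)) = ?w \<alpha> \<beta> * c"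
    if "d < D" for d
  proof (rule binary_form_multiple[OF \<alpha>R \<beta>R \<Lambda>R nz(2) regular h])
    have "r ^ d * (\<Sum>i\<le>d. h d i * (- \<beta>) ^ i * \<alpha> ^ (d - i))
      = (\<Sum>i\<le>d. h d i * (r * - \<beta>) ^ i * (r * \<alpha>) ^ (d - i))"
    proof -
      have scale: "r ^ d * (h d i * (- \<beta>) ^ i * \<alpha> ^ (d - i)) = h d i * (r * - \<beta>) ^ i * (r * \<alpha>) ^ (d - i)"
        if "i \<le> d" for i
      proof -
        have "r ^ d = r ^ i * r ^ (d - i)"
          using that by (simp flip: power_add)
        then show ?thesis
          by (simp only: power_mult_distrib mult_ac)
      qed
      show ?thesis
        unfolding sum_distrib_left by (intro sum.cong refl, rule scale) simp
    qed
    also have "\<dots> = (\<Sum>i\<le>d. h d i * (\<Lambda> * f $ p) ^ i * (\<Lambda> * f $ q) ^ (d - i))"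
    proof -
      have "r * - \<beta> = \<Lambda> * f $ p"
        by (simp flip: r(3))
      then show ?thesis
        by (simp only: r(2))
    qed
    also have "\<dots> = \<Lambda> ^ d * (\<Sum>i\<le>d. h d i * f $ p ^ i * f $ q ^ (d - i))"
    proof -
      have scale: "h d i * (\<Lambda> * f $ p) ^ i * (\<Lambda> * f $ q) ^ (d - i) = \<Lambda> ^ d * (h d i * f $ p ^ i * f $ q ^ (d - i))"
        if "i \<le> d" for i
      proof -
        have "\<Lambda> ^ d = \<Lambda> ^ i * \<Lambda> ^ (d - i)"
          using that by (simp flip: power_add)
        then show ?thesis
          by (simp only: power_mult_distrib mult_ac)
      qed
      show ?thesis
        unfolding sum_distrib_left by (intro sum.cong refl, rule scale) simp
    qed
    also have "\<dots> = 0"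
      by (simp add: zero[OF that])
    finally show "(\<Sum>i\<le>d. h d i * (- \<beta>) ^ i * \<alpha> ^ (d - i)) = 0"
      using nz(1) by simp
  qed
  have "\<exists>N c. \<Lambda> ^ N * (\<Sum>d<D'. \<Sum>i\<le>d. h d i * Var (Vw p) ^ i * Var (Vw q) ^ (d - i)) = ?w \<alpha> \<beta> * c"
    if "D' \<le> D" for D'
    using that
  proof (induction D')
    case 0
    then show ?case
      by (intro exI[of _ 0]) simp
  next
    case (Suc D')
    let ?s = "\<Sum>d<D'. \<Sum>i\<le>d. h d i * Var (Vw p) ^ i * Var (Vw q) ^ (d - i)"
      and ?t = "\<Sum>i\<le>D'. h D' i * Var (Vw p) ^ i * Var (Vw q) ^ (D' - i)"
    obtain N1 c1 N2 c2 where c: "\<Lambda> ^ N1 * ?s = ?w \<alpha> \<beta> * c1" "\<Lambda> ^ N2 * ?t = ?w \<alpha> \<beta> * c2"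
      using Suc part[of D'] by auto
    have "\<Lambda> ^ (N1 + N2) * (?s + ?t) = \<Lambda> ^ N2 * (\<Lambda> ^ N1 * ?s) + \<Lambda> ^ N1 * (\<Lambda> ^ N2 * ?t)"
      by (simp only: power_add distrib_left mult_ac)
    also have "\<dots> = ?w \<alpha> \<beta> * (\<Lambda> ^ N2 * c1 + \<Lambda> ^ N1 * c2)"
      unfolding c by (simp only: distrib_left[of "?w \<alpha> \<beta>"] mult.left_commute[of _ "?w \<alpha> \<beta>"])
    finally show ?case
      unfolding sum.lessThan_Suc by blast
  qed
  from this[OF order_refl] obtain N c where Nc: "\<Lambda> ^ N * s0 = ?w \<alpha> \<beta> * c"
    unfolding s0_eq by blast
  have "\<Lambda> ^ N * (\<Lambda> ^ N0 * s - s0) - c * (\<Lambda> * F - ?w \<alpha> \<beta>) \<in> L"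
    by (rule ideal_setD(6)[OF L_ideal ideal_setD(3)[OF L_ideal s0(2)] ideal_setD(3)[OF L_ideal \<Lambda>F]])
  moreover have "\<Lambda> ^ N * (\<Lambda> ^ N0 * s - s0) - c * (\<Lambda> * F - ?w \<alpha> \<beta>)
    = \<Lambda> ^ (N + N0) * s - F * (c * \<Lambda>) - (\<Lambda> ^ N * s0 - ?w \<alpha> \<beta> * c)"
    by (simp add: power_add algebra_simps)
  ultimately have "\<Lambda> ^ (N + N0) * s - F * (c * \<Lambda>) \<in> J"
    unfolding Nc using L_subset_J by auto
  then show ?thesis
    unfolding \<Lambda>_def by (rule regular_power_mod_J[OF low_F_not_in_J \<chi>_F_nonzero])
qed

lemma colon_z2w0:
  assumes "x * s - Var Vz ^ 2 * Var (Vw 0) * c \<in> J" "y * s - Var Vz ^ 2 * Var (Vw 0) * d \<in> J"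
  shows "\<exists>c. s - Var Vz ^ 2 * Var (Vw 0) * c \<in> J"
proof -
  obtain t I p q where "eliminated_pencil n (n - 2) A B t I p q"
    by (rule elimination)
  then interpret eliminated_pencil n "n - 2" A B t I p q .
  have "low (Var Vz ^ 2 * Var (Vw 0)) \<notin> J"
    using z2w0_not_in_J by simp
  from colon_xy_mod_J[OF this assms] show ?thesis
    by blast
qed

lemma J_prime:
  assumes "s1 * s2 \<in> J"
  shows "s1 \<in> J \<or> s2 \<in> J"
proof -
  obtain t I p q where "eliminated_pencil n (n - 2) A B t I p q"
    by (rule elimination)
  from eliminated_pencil.J_prime[OF this assms] show ?thesis .
qed

end

section \<open>The quotient ring and its fractions\<close>

lemma (in domain) fraction_cancel:
  assumes "a \<in> carrier R" "g \<in> carrier R" "g \<noteq> \<zero>"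
  shows "fraction R (carrier R - {\<zero>}) (a \<otimes> g) g = fraction R (carrier R - {\<zero>}) a \<one>"
proof -
  have "u \<otimes> ((a \<otimes> g) \<otimes> t) = u \<otimes> (b \<otimes> g) \<longleftrightarrow> u \<otimes> (a \<otimes> t) = u \<otimes> (b \<otimes> \<one>)"
    if "u \<in> carrier R - {\<zero>}" "t \<in> carrier R" "b \<in> carrier R" for u t b
  proof -
    have "u \<otimes> ((a \<otimes> g) \<otimes> t) = (u \<otimes> (a \<otimes> t)) \<otimes> g" "u \<otimes> (b \<otimes> g) = (u \<otimes> (b \<otimes> \<one>)) \<otimes> g"
      using that assms by (simp_all add: m_ac)
    then show ?thesis
      using that assms by (simp add: m_rcancel)
  qed
  then show ?thesis
    unfolding fraction_def by auto
qed

lemma (in cring) colon_genideal_iff: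
  assumes I: "ideal I R" and G: "G \<subseteq> carrier R"
  shows "r \<in> colon R I (Idl G) \<longleftrightarrow> r \<in> carrier R \<and> (\<forall>a\<in>G. r \<otimes> a \<in> I)"
proof
  assume "r \<in> colon R I (Idl G)"
  then show "r \<in> carrier R \<and> (\<forall>a\<in>G. r \<otimes> a \<in> I)"
    using genideal_self[OF G] by (auto simp: colon_def)
next
  assume r: "r \<in> carrier R \<and> (\<forall>a\<in>G. r \<otimes> a \<in> I)"
  let ?K = "{b \<in> carrier R. r \<otimes> b \<in> I}"
  interpret I: ideal I R
    by (rule I)
  have "ideal ?K R"
  proof (rule idealI[OF ring_axioms])
    show "subgroup ?K (add_monoid R)"
    proof (rule group.subgroupI[OF a_group])
      show "?K \<noteq> {}"
        using r by (auto intro!: exI[of _ \<zero>])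
    next
      fix b assume b: "b \<in> ?K"
      then have "r \<otimes> (\<ominus> b) \<in> I"
        using r by (simp add: r_minus)
      with b show "inv\<^bsub>add_monoid R\<^esub> b \<in> ?K"
        by (simp add: a_inv_def[symmetric])
    qed (use r in \<open>auto simp: r_distr\<close>)
  next
    fix b c assume b: "b \<in> ?K" and c: "c \<in> carrier R"
    have "r \<otimes> (b \<otimes> c) = (r \<otimes> b) \<otimes> c"
      using b c r by (simp add: m_assoc)
    with b c show "b \<otimes> c \<in> ?K"
      by (simp add: I.I_r_closed)
    with b c show "c \<otimes> b \<in> ?K"
      by (simp add: m_comm)
  qed
  moreover have "G \<subseteq> ?K"
    using r G by auto
  ultimately have "Idl G \<subseteq> ?K"
    by (rule genideal_minimal)
  then show "r \<in> colon R I (Idl G)"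
    using r by (auto simp: colon_def)
qed

context case_III_setting
begin

abbreviation S :: "'k mpoly ring" where
  "S \<equiv> S_ring n"

abbreviation V\<^sub>S :: "var set" where
  "V\<^sub>S \<equiv> {Vx, Vy, Vz} \<union> Vw ` {..<n}"

lemma R_subset_S: "p \<in> carrier Rxyz \<Longrightarrow> p \<in> carrier S"
  unfolding S_ring_def by (rule carrier_mono[rotated]) auto

lemma S_simps [simp]:
  "p \<otimes>\<^bsub>S\<^esub> q = p * q" "p \<oplus>\<^bsub>S\<^esub> q = p + q" "\<one>\<^bsub>S\<^esub> = 1" "\<zero>\<^bsub>S\<^esub> = 0"
  by (simp_all add: S_ring_def)

lemma S_closed [simp]:
  "x \<in> carrier S" "y \<in> carrier S" "Var Vz \<in> carrier S" "0 \<in> carrier S"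
  "i < n \<Longrightarrow> Var (Vw i) \<in> carrier S"
  "s1 \<in> carrier S \<Longrightarrow> s2 \<in> carrier S \<Longrightarrow> s1 + s2 \<in> carrier S"
  "s1 \<in> carrier S \<Longrightarrow> s2 \<in> carrier S \<Longrightarrow> s1 - s2 \<in> carrier S"
  "s1 \<in> carrier S \<Longrightarrow> s2 \<in> carrier S \<Longrightarrow> s1 * s2 \<in> carrier S"
  "s1 \<in> carrier S \<Longrightarrow> s1 ^ k \<in> carrier S"
  by (simp_all add: S_ring_def)

lemma l_form_in_S: "j < n - 1 \<Longrightarrow> l_form \<phi> j \<in> carrier S"
proof -
  assume j: "j < n - 1"
  then have "\<phi> $$ (i, j) \<in> carrier S" if "i < n" for i
    using that by (intro R_subset_S \<phi>_carrier)
  then show ?thesis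
    unfolding l_form_eq[OF j] S_ring_def by (intro sum_carrier mult_carrier) auto
qed

lemma F_in_S [simp]: "F \<in> carrier S"
  unfolding F_def using n_gt_4 by (intro l_form_in_S) simp

text \<open>The retraction onto \<open>S\<close> shows that \<open>L\<close> and \<open>J\<close> meet \<open>S\<close> in the ideals of \<open>S\<close> defined in the same
  way.\<close>

lemma retract_S: "s \<in> carrier S \<Longrightarrow> retract V\<^sub>S s = s" "retract V\<^sub>S s \<in> carrier S"
  unfolding S_ring_def by (rule retract_id, assumption) (rule retract_in_carrier)

lemma genideal_l_forms: "s \<in> Idl\<^bsub>S\<^esub> (l_form \<phi> ` {..<n - 2}) \<longleftrightarrow> s \<in> carrier S \<and> s \<in> L"
proof -
  have img: "l_form \<phi> ` {..<n - 2} = l ` {..<n - 2}"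
    by (intro image_cong refl) (simp add: l_eq_l_form)
  have lS: "l j \<in> carrier S" if "j < n - 2" for j
    using that l_form_in_S[of j] by (simp add: l_eq_l_form)
  have Idl: "Idl\<^bsub>S\<^esub> (l ` {..<n - 2}) = {(\<Sum>j<n - 2. l j * c j) | c. \<forall>j. c j \<in> carrier S}"
    unfolding S_ring_def using lS[unfolded S_ring_def] by (rule genideal_mpoly_ring)
  show ?thesis
    unfolding img Idl
  proof (intro iffI; elim CollectE exE conjE)
    fix c assume s: "s = (\<Sum>j<n - 2. l j * c j)" and c: "\<forall>j. c j \<in> carrier S"
    have "s \<in> carrier S"
      unfolding s S_ring_def using lS c unfolding S_ring_def by (intro sum_carrier mult_carrier) auto
    then show "s \<in> carrier S \<and> s \<in> L"
      unfolding L_def using s by (auto intro: lin_idealI)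
  next
    assume s: "s \<in> carrier S" "s \<in> L"
    then obtain c where c: "s = (\<Sum>j<n - 2. l j * c j)"
      unfolding L_def by (auto elim: lin_idealE)
    have "s = retract V\<^sub>S (\<Sum>j<n - 2. l j * c j)"
      using retract_S(1)[OF s(1)] by (simp flip: c)
    also have "\<dots> = (\<Sum>j<n - 2. l j * retract V\<^sub>S (c j))"
      unfolding subst_sum subst_mult by (intro sum.cong refl) (simp only: retract_S(1) lS lessThan_iff)
    finally show "s \<in> {(\<Sum>j<n - 2. l j * c j) | c. \<forall>j. c j \<in> carrier S}"
      by (intro CollectI exI[of _ "\<lambda>j. retract V\<^sub>S (c j)"] conjI allI retract_S(2))
  qed
qed

lemma S_cring: "cring S"
  unfolding S_ring_def by (rule cring_mpoly_ring)

lemma J_ideal_iff: "s \<in> J_ideal n \<phi> \<longleftrightarrow> s \<in> carrier S \<and> s \<in> J"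
proof -
  interpret S: cring S
    by (rule S_cring)
  have lS: "l_form \<phi> ` {..<n - 2} \<subseteq> carrier S"
    by (auto intro: l_form_in_S)
  have "s \<in> J_ideal n \<phi> \<longleftrightarrow> s \<in> carrier S \<and> (\<forall>a\<in>{x, y}. s \<otimes>\<^bsub>S\<^esub> a \<in> Idl\<^bsub>S\<^esub> (l_form \<phi> ` {..<n - 2}))"
    unfolding J_ideal_def by (rule S.colon_genideal_iff[OF S.genideal_ideal[OF lS]]) simp
  also have "\<dots> \<longleftrightarrow> s \<in> carrier S \<and> s \<in> J"
    unfolding genideal_l_forms by (auto simp: J_def mult.commute)
  finally show ?thesis .
qed

text \<open>As \<open>B\<close> names the coefficients of \<open>y\<close>, the quotient ring is abbreviated by \<open>Q\<close>.\<close>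

abbreviation Q :: "'k mpoly set ring" where
  "Q \<equiv> B_ring n \<phi>"

abbreviation cls :: "'k mpoly \<Rightarrow> 'k mpoly set" where
  "cls \<equiv> bar n \<phi>"

lemma J_ideal_is_ideal: "ideal (J_ideal n \<phi>) S"
proof -
  interpret S: cring S
    by (rule S_cring)
  have neg: "\<ominus>\<^bsub>S\<^esub> s = - s" if "s \<in> carrier S" for s
    using that S.minus_equality[of "- s" s] by (simp add: S_ring_def)
  show ?thesis
  proof (rule idealI[OF S.ring_axioms])
    show "subgroup (J_ideal n \<phi>) (add_monoid S)"
    proof (rule group.subgroupI[OF S.a_group])
      show "J_ideal n \<phi> \<noteq> {}"
        using ideal_setD(1)[OF J_ideal] J_ideal_iff[of 0] by auto
    next
      fix s assume s: "s \<in> J_ideal n \<phi>"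
      then have "- s \<in> J_ideal n \<phi>"
        using ideal_setD(5)[OF J_ideal] by (auto simp: J_ideal_iff S_ring_def)
      with s show "inv\<^bsub>add_monoid S\<^esub> s \<in> J_ideal n \<phi>"
        using neg[of s] by (simp add: J_ideal_iff a_inv_def)
    qed (auto simp: J_ideal_iff ideal_setD[OF J_ideal])
  qed (auto simp: J_ideal_iff ideal_setD[OF J_ideal])
qed

lemma Q_cring: "cring Q"
  unfolding B_ring_def by (rule ideal.quotient_is_cring[OF J_ideal_is_ideal S_cring])

lemma cls_hom: "cls \<in> Ring.ring_hom S Q"
  unfolding B_ring_def bar_def[abs_def] by (rule ideal.rcos_ring_hom[OF J_ideal_is_ideal])

lemma cls_closed [simp]: "s \<in> carrier S \<Longrightarrow> cls s \<in> carrier Q"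
  using Ring.ring_hom_closed[OF cls_hom] by auto

lemma cls_mult: "s1 \<in> carrier S \<Longrightarrow> s2 \<in> carrier S \<Longrightarrow> cls s1 \<otimes>\<^bsub>Q\<^esub> cls s2 = cls (s1 * s2)"
  using Ring.ring_hom_mult[OF cls_hom, of s1 s2] by simp

lemma cls_surj:
  assumes "k \<in> carrier Q"
  obtains s where "s \<in> carrier S" "k = cls s"
  using assms unfolding B_ring_def bar_def FactRing_def A_RCOSETS_def' by auto

lemma cls_eq_iff: "s1 \<in> carrier S \<Longrightarrow> s2 \<in> carrier S \<Longrightarrow> cls s1 = cls s2 \<longleftrightarrow> s1 - s2 \<in> J"
proof -
  assume s: "s1 \<in> carrier S" "s2 \<in> carrier S"
  interpret S: cring S
    by (rule S_cring)
  interpret I: ideal "J_ideal n \<phi>" S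
    by (rule J_ideal_is_ideal)
  have "\<ominus>\<^bsub>S\<^esub> s2 = - s2"
    using s S.minus_equality[of "- s2" s2] by (simp add: S_ring_def)
  then have "s1 \<ominus>\<^bsub>S\<^esub> s2 = s1 - s2"
    by (simp add: a_minus_def)
  then show ?thesis
    using s S.quotient_eq_iff_same_a_r_cos[OF J_ideal_is_ideal s] unfolding bar_def
    by (simp add: J_ideal_iff)
qed

lemma cls_eq_0_iff: "s \<in> carrier S \<Longrightarrow> cls s = \<zero>\<^bsub>Q\<^esub> \<longleftrightarrow> s \<in> J"
proof -
  assume s: "s \<in> carrier S"
  have "\<zero>\<^bsub>Q\<^esub> = cls 0"
    using Ring.ring_hom_zero[OF cls_hom] S_cring Q_cring by (simp add: cring.axioms(1))
  then show ?thesis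
    using cls_eq_iff[OF s, of 0] by simp
qed

lemma Q_domain: "domain Q"
proof -
  interpret Q: cring Q
    by (rule Q_cring)
  have one: "\<one>\<^bsub>Q\<^esub> = cls 1"
    using Ring.ring_hom_one[OF cls_hom] by simp
  show ?thesis
  proof (rule domainI[OF Q_cring])
    have "(1 :: 'k mpoly) \<notin> J"
      using \<rho>_J[of 1] \<rho>_base[of 1] by auto
    then show "\<one>\<^bsub>Q\<^esub> \<noteq> \<zero>\<^bsub>Q\<^esub>"
      unfolding one by (subst cls_eq_0_iff) (auto simp: S_ring_def)
  next
    fix k1 k2 assume k: "k1 \<otimes>\<^bsub>Q\<^esub> k2 = \<zero>\<^bsub>Q\<^esub>" "k1 \<in> carrier Q" "k2 \<in> carrier Q"
    obtain s1 s2 where s: "s1 \<in> carrier S" "k1 = cls s1" "s2 \<in> carrier S" "k2 = cls s2"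
      using cls_surj[OF k(2)] cls_surj[OF k(3)] by metis
    then have "s1 * s2 \<in> J"
      using k(1) cls_eq_0_iff[of "s1 * s2"] by (simp add: cls_mult)
    then show "k1 = \<zero>\<^bsub>Q\<^esub> \<or> k2 = \<zero>\<^bsub>Q\<^esub>"
      using J_prime s cls_eq_0_iff by blast
  qed
qed

lemma genideal_cls:
  assumes g: "g \<in> carrier S"
  shows "Idl\<^bsub>Q\<^esub> {cls g} = {cls (g * c) | c. c \<in> carrier S}"
proof -
  interpret Q: cring Q
    by (rule Q_cring)
  have "Idl\<^bsub>Q\<^esub> {cls g} = {k \<otimes>\<^bsub>Q\<^esub> cls g | k. k \<in> carrier Q}"
    using Q.cgenideal_eq_genideal[of "cls g"] g by (auto simp: cgenideal_def)
  also have "\<dots> = {cls (g * c) | c. c \<in> carrier S}"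
  proof (intro equalityI subsetI)
    fix u assume "u \<in> {k \<otimes>\<^bsub>Q\<^esub> cls g | k. k \<in> carrier Q}"
    then obtain k where k: "k \<in> carrier Q" "u = k \<otimes>\<^bsub>Q\<^esub> cls g"
      by blast
    obtain c where "c \<in> carrier S" "k = cls c"
      by (rule cls_surj[OF k(1)])
    then show "u \<in> {cls (g * c) | c. c \<in> carrier S}"
      using k(2) g by (auto simp: cls_mult mult.commute)
  next
    fix u assume "u \<in> {cls (g * c) | c. c \<in> carrier S}"
    then obtain c where "c \<in> carrier S" "u = cls (g * c)"
      by blast
    then show "u \<in> {k \<otimes>\<^bsub>Q\<^esub> cls g | k. k \<in> carrier Q}"
      using g by (auto simp: cls_mult mult.commute intro!: exI[of _ "cls c"])
  qed
  finally show ?thesis .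
qed

lemma genideal_singleton_iff:
  assumes g: "g \<in> carrier S" and s: "s \<in> carrier S"
  shows "cls s \<in> Idl\<^bsub>Q\<^esub> {cls g} \<longleftrightarrow> (\<exists>c. s - g * c \<in> J)"
proof -
  have "cls s \<in> Idl\<^bsub>Q\<^esub> {cls g} \<longleftrightarrow> (\<exists>c\<in>carrier S. cls s = cls (g * c))"
    unfolding genideal_cls[OF g] by blast
  also have "\<dots> \<longleftrightarrow> (\<exists>c\<in>carrier S. s - g * c \<in> J)"
    using g s by (intro bex_cong refl) (simp add: cls_eq_iff)
  also have "\<dots> \<longleftrightarrow> (\<exists>c. s - g * c \<in> J)"
  proof
    assume "\<exists>c. s - g * c \<in> J"
    then obtain c where c: "s - g * c \<in> J" ..
    have "u \<in> L \<Longrightarrow> retract V\<^sub>S u \<in> L" for u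
    proof -
      assume "u \<in> L"
      then obtain c where "u = (\<Sum>j<n - 2. l j * c j)"
        unfolding L_def by (rule lin_idealE)
      moreover have "retract V\<^sub>S (l j) = l j" if "j < n - 2" for j
        using that l_form_in_S[of j] by (simp only: l_eq_l_form retract_S)
      ultimately show ?thesis
        unfolding L_def by (intro lin_idealI[of _ _ "\<lambda>j. retract V\<^sub>S (c j)"]) simp
    qed
    from this[of "x * (s - g * c)"] this[of "y * (s - g * c)"] c
    have "retract V\<^sub>S (s - g * c) \<in> J"
      by (auto simp: J_def)
    then have "s - g * retract V\<^sub>S c \<in> J"
      by (simp only: subst_diff subst_mult retract_S(1)[OF g] retract_S(1)[OF s])
    then show "\<exists>c\<in>carrier S. s - g * c \<in> J"
      using retract_S(2) by blast
  qed blast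
  finally show ?thesis .
qed

abbreviation g :: "'k mpoly" where
  "g \<equiv> Var Vz ^ 2 * Var (Vw 0)"

lemma g_in_S [simp]: "g \<in> carrier S"
  using n_gt_4 by simp

text \<open>\<open>z\<^sup>2 w\<^sub>0\<close> is regular modulo \<open>(x, y)\<close>, so the colon ideal is generated by \<open>z\<^sup>2 w\<^sub>0\<close> itself.\<close>

lemma K_ideal_eq: "K_ideal n \<phi> = Idl\<^bsub>Q\<^esub> {cls g}"
proof -
  interpret Q: cring Q
    by (rule Q_cring)
  have I: "ideal (Idl\<^bsub>Q\<^esub> {cls g}) Q"
    by (rule Q.genideal_ideal) simp
  have iff: "k \<in> K_ideal n \<phi> \<longleftrightarrow> k \<in> carrier Q \<and> (\<forall>a\<in>{cls x, cls y, cls g}. k \<otimes>\<^bsub>Q\<^esub> a \<in> Idl\<^bsub>Q\<^esub> {cls g})" for k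
    unfolding K_ideal_def by (rule Q.colon_genideal_iff[OF I]) auto
  show ?thesis
  proof (intro equalityI subsetI)
    fix k assume "k \<in> K_ideal n \<phi>"
    then have k: "k \<in> carrier Q" "k \<otimes>\<^bsub>Q\<^esub> cls x \<in> Idl\<^bsub>Q\<^esub> {cls g}" "k \<otimes>\<^bsub>Q\<^esub> cls y \<in> Idl\<^bsub>Q\<^esub> {cls g}"
      using iff by auto
    obtain s where s: "s \<in> carrier S" "k = cls s"
      by (rule cls_surj[OF k(1)])
    obtain c d where "s * x - g * c \<in> J" "s * y - g * d \<in> J"
      using k(2,3) s genideal_singleton_iff[of g "s * x"] genideal_singleton_iff[of g "s * y"]
      by (auto simp: cls_mult)
    then have "\<exists>c. s - g * c \<in> J"
      by (intro colon_z2w0) (simp_all add: mult.commute)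
    then show "k \<in> Idl\<^bsub>Q\<^esub> {cls g}"
      using genideal_singleton_iff[of g s] s by simp
  next
    fix k assume k: "k \<in> Idl\<^bsub>Q\<^esub> {cls g}"
    then have "k \<in> carrier Q"
      using ideal.Icarr[OF I] by blast
    with k show "k \<in> K_ideal n \<phi>"
      unfolding iff using ideal.I_r_closed[OF I k] by auto
  qed
qed

lemma A_ideal_iff: "s \<in> A_ideal f \<longleftrightarrow> s \<in> carrier S \<and> \<rho> s = 0"
proof -
  have "dim_vec f = n"
    using f_vec by auto
  moreover have "\<zero>\<^bsub>Rees_algebra (gens_ideal f)\<^esub> = 0"
    by (simp add: Rees_algebra_def mpoly_ring_def)
  ultimately show ?thesis
    unfolding A_ideal_def a_kernel_def' using \<rho>_eq_Rees_map by auto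
qed

lemma bar_A_ideal_eq: "cls ` A_ideal f = {cls (F * c) | c. c \<in> carrier S}"
proof (intro equalityI subsetI)
  fix k assume "k \<in> cls ` A_ideal f"
  then obtain s where s: "s \<in> carrier S" "\<rho> s = 0" "k = cls s"
    by (auto simp: A_ideal_iff)
  then show "k \<in> {cls (F * c) | c. c \<in> carrier S}"
    using genideal_singleton_iff[of F s] Rees_ideal_mod_J[of s] genideal_cls[of F] by simp
next
  fix k assume "k \<in> {cls (F * c) | c. c \<in> carrier S}"
  then obtain c where "c \<in> carrier S" "k = cls (F * c)"
    by auto
  then show "k \<in> cls ` A_ideal f"
    by (auto simp: A_ideal_iff \<rho>_F)
qed

lemma D_ideal_eq: "D_ideal n \<phi> = to_Frac Q ` cls ` A_ideal f"
proof -
  interpret Q: domain Q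
    by (rule Q_domain)
  have g0: "cls g \<noteq> \<zero>\<^bsub>Q\<^esub>"
    using cls_eq_0_iff[OF g_in_S] z2w0_not_in_J by simp
  have "fdiv Q (cls F \<otimes>\<^bsub>Q\<^esub> cls (g * c)) (cls g) = to_Frac Q (cls (F * c))" if "c \<in> carrier S" for c
  proof -
    have "cls F \<otimes>\<^bsub>Q\<^esub> cls (g * c) = cls (F * (g * c))"
      using that by (intro cls_mult S_closed(8) F_in_S g_in_S)
    also have "\<dots> = cls ((F * c) * g)"
      by (simp only: mult_ac)
    also have "\<dots> = cls (F * c) \<otimes>\<^bsub>Q\<^esub> cls g"
      using that by (intro cls_mult[symmetric] S_closed(8) F_in_S g_in_S)
    finally have "cls F \<otimes>\<^bsub>Q\<^esub> cls (g * c) = cls (F * c) \<otimes>\<^bsub>Q\<^esub> cls g" .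
    then show ?thesis
      using Q.fraction_cancel[of "cls (F * c)" "cls g"] that g0 by simp
  qed
  then have frac: "{fdiv Q (cls F \<otimes>\<^bsub>Q\<^esub> cls (g * c)) (cls g) | c. c \<in> carrier S}
    = {to_Frac Q (cls (F * c)) | c. c \<in> carrier S}"
    by (intro Collect_cong ex_cong1) auto
  have "D_ideal n \<phi> = {fdiv Q (cls F \<otimes>\<^bsub>Q\<^esub> cls (g * c)) (cls g) | c. c \<in> carrier S}"
    unfolding D_ideal_def K_ideal_eq genideal_cls[OF g_in_S] F_def[symmetric] by blast
  also have "\<dots> = {to_Frac Q (cls (F * c)) | c. c \<in> carrier S}"
    by (rule frac)
  also have "\<dots> = to_Frac Q ` cls ` A_ideal f"
    unfolding bar_A_ideal_eq by blast
  finally show ?thesis .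
qed

end

theorem theorem6p5:
  fixes n :: nat
    and f :: "'k::alg_closed_field mpoly vec"
    and \<phi> :: "'k mpoly mat"
  assumes "setting n f \<phi>"
    and "case_III n \<phi>"
  shows "D_ideal n \<phi> = to_Frac (B_ring n \<phi>) ` (bar n \<phi> ` A_ideal f)"
proof -
  interpret case_III_setting n f \<phi>
    using assms by unfold_locales
  show ?thesis
    by (rule D_ideal_eq)
qed

end
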